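(* Let $d\geq 2$ and let $r_0,S$ be real numbers with $\frac12<r_0<\min\left(\frac d2,\,S-\frac12\right)$. Then for every $0<r<S$ the embedding $H^{S,r_0}_{rad,+}(\mathbb{R}^d)\subset \dot H^r_{rad}(\mathbb{R}^d)$ is compact: every sequence $(\varphi_n)$ in $H^{S,r_0}_{rad,+}(\mathbb{R}^d)$ that is bounded in $H^S(\mathbb{R}^d)$ has a subsequence converging in the $\dot H^r(\mathbb{R}^d)$ norm $\|D^r\cdot\|_{L^2(\mathbb{R}^d)}$ (to its weak limit in $H^S(\mathbb{R}^d)$).
   Context: For $s\in\mathbb{R}$, $D^s$ denotes the Fourier multiplier $\widehat{D^s\varphi}(\xi)=|\xi|^s\widehat\varphi(\xi)$. $H^S(\mathbb{R}^d)$ is the usual inhomogeneous $L^2$-Sobolev space and $\dot H^r(\mathbb{R}^d)$ the homogeneous Sobolev space with norm $\|D^r\varphi\|_{L^2}$; the subscript $rad$ means restriction to radially symmetric functions $\varphi(x)=\varphi(|x|)$. $H^{S,r_0}_{rad,+}(\mathbb{R}^d)=\{\varphi\in H^S(\mathbb{R}^d)\text{ radially symmetric}:\ D^{r_0}\varphi\geq 0\text{ a.e.}\}$. *)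

theory Defs
  imports "HOL-Analysis.Analysis"
begin

definition L2fun :: "('a::euclidean_space \<Rightarrow> complex) \<Rightarrow> bool" where
  "L2fun f \<longleftrightarrow> f \<in> borel_measurable lborel \<and> integrable lborel (\<lambda>x. (cmod (f x))\<^sup>2)"

definition fourier_L1 :: "('a::euclidean_space \<Rightarrow> complex) \<Rightarrow> 'a \<Rightarrow> complex" where
  "fourier_L1 g \<xi> = complex_of_real ((2 * pi) powr (- real DIM('a) / 2)) *
     (LINT x|lborel. exp (- \<i> * complex_of_real (x \<bullet> \<xi>)) * g x)"

text \<open>F is (a representative of) the L^2 (Plancherel) Fourier transform of the L^2 function f,
  characterised by the multiplication formula against all g in L^1 \<inter> L^2
  (a dense class, so this determines F a.e.).\<close>
definition is_fourier_L2 :: "('a::euclidean_space \<Rightarrow> complex) \<Rightarrow> ('a \<Rightarrow> complex) \<Rightarrow> bool" where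
  "is_fourier_L2 f F \<longleftrightarrow> L2fun F \<and>
     (\<forall>g. integrable lborel g \<and> L2fun g \<longrightarrow>
        (LINT \<xi>|lborel. F \<xi> * g \<xi>) = (LINT x|lborel. f x * fourier_L1 g x))"

definition FT :: "('a::euclidean_space \<Rightarrow> complex) \<Rightarrow> 'a \<Rightarrow> complex" where
  "FT f = (SOME F. is_fourier_L2 f F)"

definition sobolev :: "real \<Rightarrow> ('a::euclidean_space \<Rightarrow> real) \<Rightarrow> bool" where
  "sobolev S \<phi> \<longleftrightarrow> L2fun (\<lambda>x. complex_of_real (\<phi> x)) \<and>
     (\<exists>F. is_fourier_L2 (\<lambda>x. complex_of_real (\<phi> x)) F \<and>
          integrable lborel (\<lambda>\<xi>. (1 + (norm \<xi>)\<^sup>2) powr S * (cmod (F \<xi>))\<^sup>2))"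

definition sobolev_inner :: "real \<Rightarrow> ('a::euclidean_space \<Rightarrow> real) \<Rightarrow> ('a \<Rightarrow> real) \<Rightarrow> complex" where
  "sobolev_inner S \<phi> \<psi> = (LINT \<xi>|lborel. complex_of_real ((1 + (norm \<xi>)\<^sup>2) powr S) *
      FT (\<lambda>x. complex_of_real (\<phi> x)) \<xi> * cnj (FT (\<lambda>x. complex_of_real (\<psi> x)) \<xi>))"

definition sobolev_norm :: "real \<Rightarrow> ('a::euclidean_space \<Rightarrow> real) \<Rightarrow> real" where
  "sobolev_norm S \<phi> = sqrt (LINT \<xi>|lborel. (1 + (norm \<xi>)\<^sup>2) powr S *
      (cmod (FT (\<lambda>x. complex_of_real (\<phi> x)) \<xi>))\<^sup>2)"

text \<open>Homogeneous Sobolev seminorm \<parallel>D^r \<phi>\<parallel>_{L^2} (via Plancherel: \<parallel>|\<xi>|^r \<phi>^\<parallel>_{L^2}).\<close>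
definition hom_sobolev_norm :: "real \<Rightarrow> ('a::euclidean_space \<Rightarrow> real) \<Rightarrow> real" where
  "hom_sobolev_norm r \<phi> = sqrt (LINT \<xi>|lborel. (norm \<xi>) powr (2 * r) *
      (cmod (FT (\<lambda>x. complex_of_real (\<phi> x)) \<xi>))\<^sup>2)"

definition radial :: "('a::euclidean_space \<Rightarrow> 'b) \<Rightarrow> bool" where
  "radial \<phi> \<longleftrightarrow> (\<forall>x y. norm x = norm y \<longrightarrow> \<phi> x = \<phi> y)"

definition Dpow_nonneg :: "real \<Rightarrow> ('a::euclidean_space \<Rightarrow> real) \<Rightarrow> bool" where
  "Dpow_nonneg r0 \<phi> \<longleftrightarrow> (\<exists>\<psi>::'a \<Rightarrow> real.
      is_fourier_L2 (\<lambda>x. complex_of_real (\<psi> x))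
        (\<lambda>\<xi>. complex_of_real ((norm \<xi>) powr r0) * FT (\<lambda>x. complex_of_real (\<phi> x)) \<xi>) \<and>
      (AE x in lborel. \<psi> x \<ge> 0))"

definition H_rad_plus :: "real \<Rightarrow> real \<Rightarrow> ('a::euclidean_space \<Rightarrow> real) set" where
  "H_rad_plus S r0 = {\<phi>. sobolev S \<phi> \<and> radial \<phi> \<and> Dpow_nonneg r0 \<phi>}"

end

theory Submission
  imports Defs "HOL-Probability.Probability" "HOL-Complex_Analysis.Great_Picard"
begin

text \<open>
  Write \<open>F\<^sub>n\<close> for the Fourier transform of \<open>\<phi>\<^sub>n\<close> and let \<open>U\<^sub>n\<close> be the convolution of \<open>D\<^bsup>r\<^sub>0\<^esup> \<phi>\<^sub>n \<ge> 0\<close> with a fixed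
  Gaussian, so that \<open>U\<^sub>n\<close> is the Fourier integral of \<open>\<bar>\<xi>\<bar>\<^bsup>r\<^sub>0\<^esup> exp (- \<bar>\<xi>\<bar>\<^sup>2 / 2) F\<^sub>n\<close>. Testing \<open>D\<^bsup>r\<^sub>0\<^esup> \<phi>\<^sub>n\<close> against a
  Gaussian of width \<open>R\<close> and using the factor \<open>\<bar>\<xi>\<bar>\<^bsup>r\<^sub>0\<^esup>\<close> gives \<open>\<integral> U\<^sub>n = O(R\<^bsup>d/2 - r\<^sub>0\<^esup>)\<close> over the ball of radius \<open>2 R\<close>.
  Nonnegativity yields a Harnack inequality, so the radial function \<open>U\<^sub>n\<close> is bounded on the sphere of radius \<open>R\<close>
  by its average over a shell of volume of order \<open>R\<^bsup>d - 1\<^esup>\<close>, that is by \<open>O(R\<^bsup>1 - d/2 - r\<^sub>0\<^esup>)\<close>. Multiplying the two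
  bounds, the integral of \<open>U\<^sub>n\<^sup>2\<close> over \<open>R \<le> \<bar>x\<bar> < 2 R\<close> is \<open>O(R\<^bsup>1 - 2 r\<^sub>0\<^esup>)\<close>, which is summable over dyadic \<open>R\<close>
  because \<open>r\<^sub>0 > 1/2\<close>. Hence the uniformly Lipschitz sequence \<open>U\<^sub>n\<close> is tight and precompact in \<open>L\<^sup>2\<close>; by
  Plancherel so is \<open>\<bar>\<xi>\<bar>\<^bsup>r\<^sub>0\<^esup> exp (- \<bar>\<xi>\<bar>\<^sup>2 / 2) F\<^sub>n\<close>, and \<open>0 < r < S\<close> leaves room at both ends of the spectrum to
  replace this weight by \<open>\<bar>\<xi>\<bar>\<^sup>r\<close>.
\<close>


section \<open>Square-integrable functions\<close>

text \<open>Positivity gives no pointwise control of D^r0 phi itself, so only its Gaussian averages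
  are estimated. Two variances occur: variance 1 carries the compactness argument and variance 2 the
  mass bound, because a Gaussian of variance 1 is dominated by one of variance 2 whose centre lies
  at distance at most 1. The exponent d/2 - r0 is born in Fourier space: a Gaussian of width R has a
  transform of height R^d concentrated on |xi| of order 1/R, and Cauchy-Schwarz gains R^(-d/2) from
  the volume of that region and R^(-r0) from the factor |xi|^r0. The shell has thickness 1 because
  this is the range of the Harnack inequality; without radial symmetry only a unit ball would be
  available for averaging. Two difficulties come from the Fourier transform being fixed only up to
  null sets and from functions being real: radiality of a spectrum is almost-everywhere invariance
  under each orthogonal map, and the limit, which is found as a spectrum by dividing an L^2 limit by
  the Gaussian weight, must be shown to belong to a real function in H^S.\<close>

definition L2sq :: "('a::euclidean_space \<Rightarrow> complex) \<Rightarrow> real" where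
  "L2sq f = (LINT x|lborel. (cmod (f x))\<^sup>2)"

lemma L2sq_nonneg [simp]: "0 \<le> L2sq f"
  by (simp add: L2sq_def)

lemma L2fun_measurable [measurable_dest]: "L2fun f \<Longrightarrow> f \<in> borel_measurable lborel"
  and L2fun_integrable: "L2fun f \<Longrightarrow> integrable lborel (\<lambda>x. (cmod (f x))\<^sup>2)"
  by (auto simp: L2fun_def)

lemma L2fun_dominated:
  assumes [measurable]: "f \<in> borel_measurable lborel" and "integrable lborel h"
    and "AE x in lborel. (cmod (f x))\<^sup>2 \<le> h x"
  shows "L2fun f"
  unfolding L2fun_def
proof
  show "integrable lborel (\<lambda>x. (cmod (f x))\<^sup>2)"
    by (rule Bochner_Integration.integrable_bound[OF assms(2)]) (use assms(3) in \<open>auto elim!: eventually_mono\<close>)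
qed simp

lemma norm_sq_add_le:
  fixes a b :: "'a::real_normed_vector"
  shows "(norm (a + b))\<^sup>2 \<le> 2 * (norm a)\<^sup>2 + 2 * (norm b)\<^sup>2"
proof -
  have "(norm (a + b))\<^sup>2 \<le> (norm a + norm b)\<^sup>2"
    by (intro power_mono norm_triangle_ineq) auto
  also have "\<dots> \<le> 2 * (norm a)\<^sup>2 + 2 * (norm b)\<^sup>2"
    using sum_squares_bound[of "norm a" "norm b"] by (simp add: power2_sum)
  finally show ?thesis .
qed

lemma L2fun_mult_bounded:
  assumes "L2fun f" and [measurable]: "m \<in> borel_measurable lborel" and b: "\<And>x. cmod (m x) \<le> B"
  shows "L2fun (\<lambda>x. m x * f x)"
proof (rule L2fun_dominated)
  show "(\<lambda>x. m x * f x) \<in> borel_measurable lborel"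
    using assms by measurable
  show "integrable lborel (\<lambda>x. B\<^sup>2 * (cmod (f x))\<^sup>2)"
    using L2fun_integrable[OF assms(1)] by simp
  show "AE x in lborel. (cmod (m x * f x))\<^sup>2 \<le> B\<^sup>2 * (cmod (f x))\<^sup>2"
    by (intro AE_I2) (auto simp: norm_mult power_mult_distrib intro!: mult_right_mono power_mono b)
qed

lemma L2fun_cmult: "L2fun f \<Longrightarrow> L2fun (\<lambda>x. c * f x)"
  using L2fun_mult_bounded[of f "\<lambda>_. c" "cmod c"] by simp

lemma L2fun_add:
  assumes "L2fun f" "L2fun g" shows "L2fun (\<lambda>x. f x + g x)"
proof (rule L2fun_dominated)
  show "(\<lambda>x. f x + g x) \<in> borel_measurable lborel"
    using assms by measurable
  show "integrable lborel (\<lambda>x. 2 * (cmod (f x))\<^sup>2 + 2 * (cmod (g x))\<^sup>2)"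
    using assms by (simp add: L2fun_integrable)
qed (use norm_sq_add_le in auto)

lemma L2fun_diff:
  assumes "L2fun f" "L2fun g" shows "L2fun (\<lambda>x. f x - g x)"
  using L2fun_add[OF assms(1) L2fun_cmult[OF assms(2), of "-1"]] by simp

lemma L2sq_add_le:
  assumes "L2fun f" "L2fun g"
  shows "L2sq (\<lambda>x. f x + g x) \<le> 2 * L2sq f + 2 * L2sq g"
proof -
  have "L2sq (\<lambda>x. f x + g x) \<le> (LINT x|lborel. 2 * (cmod (f x))\<^sup>2 + 2 * (cmod (g x))\<^sup>2)"
    unfolding L2sq_def
    by (intro integral_mono L2fun_integrable[OF L2fun_add[OF assms]])
       (use assms norm_sq_add_le in \<open>auto simp: L2fun_integrable\<close>)
  also have "\<dots> = 2 * L2sq f + 2 * L2sq g"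
    unfolding L2sq_def using assms by (simp add: L2fun_integrable)
  finally show ?thesis .
qed

lemma L2sq_diff_triangle:
  assumes "L2fun f" "L2fun g" "L2fun h"
  shows "L2sq (\<lambda>x. f x - h x) \<le> 2 * L2sq (\<lambda>x. f x - g x) + 2 * L2sq (\<lambda>x. g x - h x)"
  using L2sq_add_le[OF L2fun_diff[OF assms(1,2)] L2fun_diff[OF assms(2,3)]] by simp

lemma L2sq_commute: "L2sq (\<lambda>x. f x - g x) = L2sq (\<lambda>x. g x - f x)"
  unfolding L2sq_def by (simp add: norm_minus_commute)

lemma L2fun_cnj: "L2fun f \<Longrightarrow> L2fun (\<lambda>x. cnj (f x))"
  unfolding L2fun_def by (auto intro: borel_measurable_continuous_on[OF continuous_on_cnj])

lemma L2fun_mult_integrable: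
  assumes "L2fun f" "L2fun g" shows "integrable lborel (\<lambda>x. f x * g x)"
proof (rule Bochner_Integration.integrable_bound)
  show "integrable lborel (\<lambda>x. (cmod (f x))\<^sup>2 + (cmod (g x))\<^sup>2)"
    using assms by (simp add: L2fun_integrable)
  show "(\<lambda>x. f x * g x) \<in> borel_measurable lborel"
    using assms by measurable
  show "AE x in lborel. norm (f x * g x) \<le> norm ((cmod (f x))\<^sup>2 + (cmod (g x))\<^sup>2)"
  proof (rule AE_I2)
    fix x
    have "2 * (cmod (f x) * cmod (g x)) \<le> (cmod (f x))\<^sup>2 + (cmod (g x))\<^sup>2"
      using sum_squares_bound[of "cmod (f x)" "cmod (g x)"] by simp
    moreover have "0 \<le> cmod (f x) * cmod (g x)" by simp
    ultimately have "cmod (f x) * cmod (g x) \<le> (cmod (f x))\<^sup>2 + (cmod (g x))\<^sup>2"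
      by linarith
    then show "norm (f x * g x) \<le> norm ((cmod (f x))\<^sup>2 + (cmod (g x))\<^sup>2)"
      by (simp add: norm_mult)
  qed
qed

lemma L2_Cauchy_Schwarz_norm:
  assumes "L2fun f" "L2fun g"
  shows "(LINT x|lborel. cmod (f x) * cmod (g x)) \<le> sqrt (L2sq f) * sqrt (L2sq g)"
proof -
  note [measurable] = L2fun_measurable[OF assms(1)] L2fun_measurable[OF assms(2)]
  let ?I = "LINT x|lborel. cmod (f x) * cmod (g x)"
  have I: "integrable lborel (\<lambda>x. cmod (f x) * cmod (g x))"
    using integrable_norm[OF L2fun_mult_integrable[OF assms]] by (simp add: norm_mult)
  have I0: "0 \<le> ?I" by simp
  have "(\<integral>\<^sup>+x. ennreal (cmod (f x)) * ennreal (cmod (g x)) \<partial>lborel)\<^sup>2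
     \<le> (\<integral>\<^sup>+x. (ennreal (cmod (f x)))\<^sup>2 \<partial>lborel) * (\<integral>\<^sup>+x. (ennreal (cmod (g x)))\<^sup>2 \<partial>lborel)"
    by (rule Cauchy_Schwarz_nn_integral) auto
  also have "(\<integral>\<^sup>+x. (ennreal (cmod (f x)))\<^sup>2 \<partial>lborel) = ennreal (L2sq f)"
    unfolding L2sq_def using L2fun_integrable[OF assms(1)]
    by (simp add: ennreal_power nn_integral_eq_integral)
  also have "(\<integral>\<^sup>+x. (ennreal (cmod (g x)))\<^sup>2 \<partial>lborel) = ennreal (L2sq g)"
    unfolding L2sq_def using L2fun_integrable[OF assms(2)]
    by (simp add: ennreal_power nn_integral_eq_integral)
  also have "(\<integral>\<^sup>+x. ennreal (cmod (f x)) * ennreal (cmod (g x)) \<partial>lborel) = ennreal ?I"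
    using I by (simp add: ennreal_mult'[symmetric] nn_integral_eq_integral)
  finally have "?I\<^sup>2 \<le> L2sq f * L2sq g"
    using I0 by (simp add: ennreal_power ennreal_mult'[symmetric])
  then have "?I \<le> sqrt (L2sq f * L2sq g)"
    by (rule real_le_rsqrt)
  then show ?thesis by (simp add: real_sqrt_mult)
qed

lemma L2_Cauchy_Schwarz:
  assumes "L2fun f" "L2fun g"
  shows "cmod (LINT x|lborel. f x * g x) \<le> sqrt (L2sq f) * sqrt (L2sq g)"
proof -
  have "cmod (LINT x|lborel. f x * g x) \<le> (LINT x|lborel. cmod (f x * g x))"
    by (rule integral_norm_bound)
  then show ?thesis
    using L2_Cauchy_Schwarz_norm[OF assms] by (simp add: norm_mult)
qed

lemma L2fun_AE_eq:
  assumes "L2fun f" and "g \<in> borel_measurable lborel" and "AE x in lborel. f x = g x"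
  shows "L2fun g"
  using assms by (intro L2fun_dominated[OF assms(2) L2fun_integrable[OF assms(1)]]) auto

text \<open>Along a sequence with \<open>\<parallel>f (Suc k) - f k\<parallel>\<^sup>2 \<le> 4 ^ (-k)\<close>, the function
  \<open>\<Sum>k. 2 ^ k * \<bar>f (Suc k) - f k\<bar>\<^sup>2\<close> is integrable, which bounds the increments pointwise by a
  geometric sequence.\<close>

lemma L2_fast_Cauchy_AE_convergent:
  assumes f: "\<And>k. L2fun (f k)" and c: "\<And>k. L2sq (\<lambda>x. f (Suc k) x - f k x) \<le> (1/4) ^ k"
  shows "AE x in lborel. convergent (\<lambda>k. f k x)"
proof -
  note [measurable] = L2fun_measurable[OF f]
  define a where "a k x = (cmod (f (Suc k) x - f k x))\<^sup>2" for k x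
  have [measurable]: "a k \<in> borel_measurable borel" for k
    unfolding a_def using L2fun_measurable[OF f] by simp
  have int: "(\<integral>\<^sup>+x. ennreal (a k x) \<partial>lborel) \<le> ennreal ((1/4) ^ k)" for k
    unfolding a_def using L2fun_integrable[OF L2fun_diff[OF f f]] c
    by (subst nn_integral_eq_integral) (auto simp: L2sq_def[symmetric] intro!: ennreal_leI)
  have "(\<integral>\<^sup>+x. (\<Sum>k. ennreal (2 ^ k * a k x)) \<partial>lborel) = (\<Sum>k. \<integral>\<^sup>+x. ennreal (2 ^ k * a k x) \<partial>lborel)"
    by (rule nn_integral_suminf) simp
  also have "\<dots> \<le> (\<Sum>k. ennreal ((1/2) ^ k))"
  proof (rule suminf_le)
    fix k
    have "(\<integral>\<^sup>+x. ennreal (2 ^ k * a k x) \<partial>lborel) = ennreal (2 ^ k) * (\<integral>\<^sup>+x. ennreal (a k x) \<partial>lborel)"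
      by (subst nn_integral_cmult[symmetric]) (auto simp: ennreal_mult' a_def)
    also have "\<dots> \<le> ennreal (2 ^ k) * ennreal ((1/4) ^ k)"
      by (intro mult_left_mono int) auto
    also have "\<dots> = ennreal ((1/2) ^ k)"
      by (simp add: ennreal_mult'[symmetric] power_mult_distrib[symmetric])
    finally show "(\<integral>\<^sup>+x. ennreal (2 ^ k * a k x) \<partial>lborel) \<le> ennreal ((1/2) ^ k)" .
  qed auto
  also have "\<dots> = ennreal (\<Sum>k. (1/2) ^ k)"
    by (intro suminf_ennreal2) (auto intro: summable_geometric)
  also have "\<dots> < \<infinity>" by simp
  finally have "AE x in lborel. (\<Sum>k. ennreal (2 ^ k * a k x)) \<noteq> \<infinity>"
    by (intro nn_integral_PInf_AE) auto
  then show ?thesis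
  proof eventually_elim
    case (elim x)
    have "summable (\<lambda>k. 2 ^ k * a k x)"
      using elim by (intro summable_suminf_not_top) (auto simp: a_def)
    then have "(\<lambda>k. 2 ^ k * a k x) \<longlonglongrightarrow> 0" by (rule summable_LIMSEQ_zero)
    then obtain K where K: "\<And>k. k \<ge> K \<Longrightarrow> norm (2 ^ k * a k x - 0) < 1"
      using LIMSEQ_D[OF _ zero_less_one] by blast
    \<comment> \<open>The terms of a convergent series are eventually below 1, so the squared
      increments are at most \<open>(1/2) ^ k\<close>; the increments themselves then decay with the
      square root of that ratio.\<close>
    define q where "q = sqrt (1/2)"
    have q: "0 \<le> q" "q < 1" "q\<^sup>2 = 1/2" by (auto simp: q_def real_sqrt_less_iff)
    have bound: "cmod (f (Suc k) x - f k x) \<le> q ^ k" if "k \<ge> K" for k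
    proof (rule power2_le_imp_le)
      have "2 ^ k * a k x < 1" using K[OF that] by simp
      then have "a k x \<le> (1/2) ^ k" by (simp add: field_simps power_one_over)
      also have "(1/2) ^ k = (q ^ k)\<^sup>2" by (simp add: q(3)[symmetric] power_mult[symmetric] mult.commute)
      finally show "(cmod (f (Suc k) x - f k x))\<^sup>2 \<le> (q ^ k)\<^sup>2" by (simp add: a_def)
    qed (use q in auto)
    have "summable (\<lambda>k. f (Suc k) x - f k x)"
      by (rule summable_comparison_test[of _ "\<lambda>k. q ^ k"]) (use bound q in \<open>auto intro: summable_geometric\<close>)
    then have "convergent (\<lambda>n. \<Sum>k<n. f (Suc k) x - f k x)" by (simp add: summable_iff_convergent)
    then have "convergent (\<lambda>n. f n x - f 0 x)" by (simp add: sum_lessThan_telescope[of "\<lambda>k. f k x"])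
    then show "convergent (\<lambda>k. f k x)"
      using convergent_add[OF _ convergent_const[of "f 0 x"]] by fastforce
  qed
qed

text \<open>The bound is asked for only eventually because in the completeness proof it is available
  only from the Cauchy index on.\<close>

lemma L2_Fatou:
  assumes f: "\<And>k. L2fun (f k)" and [measurable]: "g \<in> borel_measurable lborel"
    and lim: "AE x in lborel. (\<lambda>k. f k x) \<longlonglongrightarrow> g x"
    and b: "eventually (\<lambda>k. L2sq (f k) \<le> B) sequentially"
  shows "L2fun g" "L2sq g \<le> B"
proof -
  note [measurable] = L2fun_measurable[OF f]
  have B: "0 \<le> B" using eventually_happens'[OF _ b] order.trans[OF L2sq_nonneg] by auto
  have "(\<integral>\<^sup>+x. ennreal ((cmod (g x))\<^sup>2) \<partial>lborel) = (\<integral>\<^sup>+x. liminf (\<lambda>k. ennreal ((cmod (f k x))\<^sup>2)) \<partial>lborel)"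
  proof (rule nn_integral_cong_AE)
    show "AE x in lborel. ennreal ((cmod (g x))\<^sup>2) = liminf (\<lambda>k. ennreal ((cmod (f k x))\<^sup>2))"
      using lim
    proof eventually_elim
      case (elim x)
      have "(\<lambda>k. ennreal ((cmod (f k x))\<^sup>2)) \<longlonglongrightarrow> ennreal ((cmod (g x))\<^sup>2)"
        by (intro tendsto_ennrealI tendsto_power tendsto_norm elim)
      then show ?case by (metis lim_imp_Liminf trivial_limit_sequentially)
    qed
  qed
  also have "\<dots> \<le> liminf (\<lambda>k. \<integral>\<^sup>+x. ennreal ((cmod (f k x))\<^sup>2) \<partial>lborel)"
    by (rule nn_integral_liminf) simp
  also have "\<dots> = liminf (\<lambda>k. ennreal (L2sq (f k)))"
    unfolding L2sq_def using L2fun_integrable[OF f] by (simp add: nn_integral_eq_integral)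
  also have "\<dots> \<le> ennreal B"
    using Liminf_le[of sequentially "\<lambda>k. ennreal (L2sq (f k))" "ennreal B"] b
    by (metis (mono_tags, lifting) ennreal_leI eventually_mono trivial_limit_sequentially)
  finally have le: "(\<integral>\<^sup>+x. ennreal ((cmod (g x))\<^sup>2) \<partial>lborel) \<le> ennreal B" .
  have int: "integrable lborel (\<lambda>x. (cmod (g x))\<^sup>2)"
    using le by (intro integrableI_bounded) (auto simp: order_le_less_trans)
  then show "L2fun g" by (simp add: L2fun_def)
  show "L2sq g \<le> B"
    using le B int unfolding L2sq_def by (subst (asm) nn_integral_eq_integral) auto
qed

text \<open>Riesz-Fischer. The almost everywhere convergent subsequence is exported too, since
  spectra are later identified, and their weighted norms bounded, by pointwise convergence.\<close>

lemma L2_complete: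
  assumes f: "\<And>k. L2fun (f k)"
    and cau: "\<And>e. e > 0 \<Longrightarrow> \<exists>N. \<forall>m\<ge>N. \<forall>n\<ge>N. L2sq (\<lambda>x. f m x - f n x) \<le> e"
  obtains g \<sigma> where "L2fun g" "(\<lambda>k. L2sq (\<lambda>x. f k x - g x)) \<longlonglongrightarrow> 0"
    "strict_mono (\<sigma>::nat\<Rightarrow>nat)" "AE x in lborel. (\<lambda>k. f (\<sigma> k) x) \<longlonglongrightarrow> g x"
proof -
  note [measurable] = L2fun_measurable[OF f]
  have "\<forall>k. \<exists>N. \<forall>m\<ge>N. \<forall>n\<ge>N. L2sq (\<lambda>x. f m x - f n x) \<le> (1/4) ^ k" for k :: nat
    using cau by simp
  then obtain N where N: "\<And>k m n. m \<ge> N k \<Longrightarrow> n \<ge> N k \<Longrightarrow> L2sq (\<lambda>x. f m x - f n x) \<le> (1/4) ^ k"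
    by metis
  \<comment> \<open>Summing successors makes the indices strictly increasing and at least
    \<open>N k\<close> at the same time.\<close>
  define \<sigma> where "\<sigma> k = (\<Sum>i\<le>k. Suc (N i))" for k
  have mono: "strict_mono \<sigma>" by (auto simp: strict_mono_Suc_iff \<sigma>_def)
  have ge: "N k \<le> \<sigma> k" for k unfolding \<sigma>_def
    by (cases k) auto
  have ge': "N k \<le> \<sigma> (Suc k)" for k
    using ge[of k] strict_monoD[OF mono, of k "Suc k"] by simp
  have "AE x in lborel. convergent (\<lambda>k. f (\<sigma> k) x)"
    by (rule L2_fast_Cauchy_AE_convergent[OF f N[OF ge' ge]])
  define g where "g x = lim (\<lambda>k. f (\<sigma> k) x)" for x
  have [measurable]: "g \<in> borel_measurable lborel"
    unfolding g_def by measurable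
  have lim: "AE x in lborel. (\<lambda>k. f (\<sigma> k) x) \<longlonglongrightarrow> g x"
    using \<open>AE x in lborel. convergent (\<lambda>k. f (\<sigma> k) x)\<close>
    by eventually_elim (simp add: g_def convergent_LIMSEQ_iff)
  \<comment> \<open>Fatou in k for \<open>f n - f (\<sigma> k)\<close> turns a Cauchy bound into a
    bound on the distance to the limit, and yields square integrability of \<open>f n - g\<close>,
    hence of \<open>g\<close>, on the way.\<close>
  have F: "L2fun (\<lambda>x. f n x - g x) \<and> L2sq (\<lambda>x. f n x - g x) \<le> e"
    if "\<forall>m\<ge>M. \<forall>n\<ge>M. L2sq (\<lambda>x. f m x - f n x) \<le> e" "n \<ge> M" for n M e
  proof -
    have 1: "AE x in lborel. (\<lambda>k. f n x - f (\<sigma> k) x) \<longlonglongrightarrow> f n x - g x"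
      using lim by eventually_elim (intro tendsto_intros)
    have 2: "eventually (\<lambda>k. L2sq (\<lambda>x. f n x - f (\<sigma> k) x) \<le> e) sequentially"
      using that seq_suble[OF mono] by (intro eventually_sequentiallyI[of M]) (meson order.trans)
    show ?thesis
      using L2_Fatou[of "\<lambda>k x. f n x - f (\<sigma> k) x", OF L2fun_diff[OF f f] _ 1 2] by auto
  qed
  show ?thesis
  proof (rule that)
    show "strict_mono \<sigma>" "AE x in lborel. (\<lambda>k. f (\<sigma> k) x) \<longlonglongrightarrow> g x" by fact+
    obtain M where M: "\<forall>m\<ge>M. \<forall>n\<ge>M. L2sq (\<lambda>x. f m x - f n x) \<le> 1"
      using cau[of 1] by auto
    show "L2fun g"
      using L2fun_diff[OF f[of M] conjunct1[OF F[OF M order.refl]]] by simp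
    show "(\<lambda>k. L2sq (\<lambda>x. f k x - g x)) \<longlonglongrightarrow> 0"
    proof (rule LIMSEQ_I)
      fix e :: real assume "0 < e"
      then obtain M where M: "\<forall>m\<ge>M. \<forall>n\<ge>M. L2sq (\<lambda>x. f m x - f n x) \<le> e/2"
        using cau[of "e/2"] by auto
      show "\<exists>no. \<forall>n\<ge>no. norm (L2sq (\<lambda>x. f n x - g x) - 0) < e"
        using F[OF M] \<open>0 < e\<close> by (intro exI[of _ M]) fastforce
    qed
  qed
qed


section \<open>Invariance properties of Lebesgue measure\<close>

lemma
  fixes T :: "'a::euclidean_space \<Rightarrow> 'a"
  assumes d: "distr lborel borel T = lborel" and [measurable]: "T \<in> borel \<rightarrow>\<^sub>M borel"
  shows integral_lborel_preserving:
      "\<And>f::'a \<Rightarrow> 'b::{banach,second_countable_topology}. f \<in> borel_measurable borel \<Longrightarrow>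
        (LINT x|lborel. f (T x)) = (LINT x|lborel. f x)"
    and integrable_lborel_preserving:
      "\<And>f::'a \<Rightarrow> 'b::{banach,second_countable_topology}. f \<in> borel_measurable borel \<Longrightarrow>
        integrable lborel (\<lambda>x. f (T x)) \<longleftrightarrow> integrable lborel f"
    and nn_integral_lborel_preserving:
      "\<And>f. f \<in> borel_measurable borel \<Longrightarrow> (\<integral>\<^sup>+x. f (T x) \<partial>lborel) = (\<integral>\<^sup>+x. f x \<partial>lborel)"
    and AE_lborel_preserving:
      "\<And>P. AE x in lborel. P x \<Longrightarrow> AE x in lborel. P (T x)"
proof -
  have T: "T \<in> lborel \<rightarrow>\<^sub>M borel" by simp
  show "(LINT x|lborel. f (T x)) = (LINT x|lborel. f x)"
    if "f \<in> borel_measurable borel" for f :: "'a \<Rightarrow> 'b"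
    using integral_distr[OF T that] by (simp add: d)
  show "integrable lborel (\<lambda>x. f (T x)) \<longleftrightarrow> integrable lborel f"
    if "f \<in> borel_measurable borel" for f :: "'a \<Rightarrow> 'b"
    using integrable_distr_eq[OF T that] by (simp add: d)
  show "(\<integral>\<^sup>+x. f (T x) \<partial>lborel) = (\<integral>\<^sup>+x. f x \<partial>lborel)" if "f \<in> borel_measurable borel" for f
    using nn_integral_distr[OF T, of f] that by (simp add: d)
  show "AE x in lborel. P (T x)" if "AE x in lborel. P x" for P
    by (rule AE_distrD[OF T, of P, unfolded d, OF that])
qed

lemma lborel_distr_uminus_euclidean: "distr lborel borel uminus = (lborel :: 'a::euclidean_space measure)"
  using lborel_affine[of "-1" "0::'a"] by (simp add: density_1)

lemma lborel_distr_minus_euclidean: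
  "distr lborel borel (\<lambda>x. c - x) = (lborel :: 'a::euclidean_space measure)"
  using lborel_affine[of "-1" c] by (simp add: density_1)

lemma integral_lborel_scaleR:
  fixes f :: "'a::euclidean_space \<Rightarrow> 'b::{banach,second_countable_topology}"
  assumes [measurable]: "f \<in> borel_measurable borel" and c: "c > 0"
  shows "(LINT x|lborel. f x) = c ^ DIM('a) *\<^sub>R (LINT x|lborel. f (c *\<^sub>R x))"
    and "integrable lborel (\<lambda>x. f (c *\<^sub>R x)) \<longleftrightarrow> integrable lborel f"
proof -
  have eq: "lborel = density (distr lborel borel (\<lambda>x::'a. c *\<^sub>R x)) (\<lambda>_. ennreal (c ^ DIM('a)))"
    using lborel_affine[of c "0::'a"] c by simp
  show "(LINT x|lborel. f x) = c ^ DIM('a) *\<^sub>R (LINT x|lborel. f (c *\<^sub>R x))"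
    by (subst eq, subst integral_density) (use c in \<open>auto simp: integral_distr\<close>)
  show "integrable lborel (\<lambda>x. f (c *\<^sub>R x)) \<longleftrightarrow> integrable lborel f"
  proof
    assume "integrable lborel (\<lambda>x. f (c *\<^sub>R x))"
    then show "integrable lborel f"
      by (subst eq, subst integrable_density) (use c in \<open>auto simp: integrable_distr_eq\<close>)
  next
    assume "integrable lborel f"
    then have "integrable lborel (\<lambda>x. c ^ DIM('a) *\<^sub>R f (c *\<^sub>R x))"
      by (subst (asm) eq, subst (asm) integrable_density) (use c in \<open>auto simp: integrable_distr_eq\<close>)
    then have "integrable lborel (\<lambda>x. inverse (c ^ DIM('a)) *\<^sub>R c ^ DIM('a) *\<^sub>R f (c *\<^sub>R x))"
      by (rule integrable_scaleR_right)
    then show "integrable lborel (\<lambda>x. f (c *\<^sub>R x))" using c by simp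
  qed
qed

text \<open>Uniqueness of Haar measure, normalised by the unit ball, which \<open>T\<close> preserves.\<close>

lemma lborel_distr_orthogonal:
  fixes T :: "'a::euclidean_space \<Rightarrow> 'a"
  assumes T: "orthogonal_transformation T"
  shows "distr lborel borel T = lborel"
proof (rule measure_eqI)
  have lin: "linear T" using T by (simp add: orthogonal_transformation_def)
  have [measurable]: "T \<in> borel \<rightarrow>\<^sub>M borel"
    using linear_continuous_on[of T UNIV] lin by (simp add: linear_conv_bounded_linear borel_measurable_continuous_onI)
  obtain T' where T': "\<And>y. T (T' y) = y"
    using orthogonal_transformation_surj[OF T] by (metis surjD)
  have normT: "norm (T x) = norm x" for x
    using T by (simp add: orthogonal_transformation)
  have [measurable]: "T' \<in> borel \<rightarrow>\<^sub>M borel"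
  proof -
    have "T' = inv T" using T' orthogonal_transformation_inj[OF T] by (metis inv_f_f ext)
    then have "orthogonal_transformation T'"
      using orthogonal_transformation_inv[OF T] by simp
    then have "linear T'" by (simp add: orthogonal_transformation_def)
    then show ?thesis
      using linear_continuous_on[of T' UNIV] by (simp add: linear_conv_bounded_linear borel_measurable_continuous_onI)
  qed
  fix A :: "'a set" assume "A \<in> sets (distr lborel borel T)"
  then have A[measurable]: "A \<in> sets borel" by simp
  define B where "B = (ball 0 1 :: 'a set)"
  have [measurable]: "B \<in> sets borel" by (simp add: B_def)
  let ?l = "lborel :: 'a measure"
  have B: "emeasure ?l B \<noteq> \<infinity>" "emeasure ?l B \<noteq> 0"
    using emeasure_lborel_ball_finite[of "0::'a" 1] content_ball_pos[of 1 "0::'a"]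
    by (auto simp: B_def less_top[symmetric] measure_def)
  have tr: "(\<integral>\<^sup>+x. f (x + c) \<partial>?l) = (\<integral>\<^sup>+x. f x \<partial>?l)" if "f \<in> borel_measurable borel" for f c
    using nn_integral_lborel_preserving[OF lborel_distr_plus[of c] _ that] by (simp add: add.commute)
  have "(\<integral>\<^sup>+x. indicator A x \<partial>distr lborel borel T) = (\<integral>\<^sup>+x. indicator A (T x) \<partial>?l)"
    by (rule nn_integral_distr) auto
  \<comment> \<open>The double integral of \<open>1_B(y) 1_A(T x + y)\<close> is evaluated in two
    ways. Shifting x by \<open>T' y\<close> removes y from the second factor; shifting y by
    \<open>T x\<close> instead moves the dependence on x into \<open>B\<close>, where invariance of
    the ball under \<open>T\<close> makes the x-integral equal to the measure of
    \<open>B\<close>.\<close>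
  then have "emeasure ?l B * emeasure (distr lborel borel T) A
      = emeasure ?l B * (\<integral>\<^sup>+x. indicator A (T x) \<partial>?l)"
    by simp
  also have "\<dots> = (\<integral>\<^sup>+y. indicator B y * (\<integral>\<^sup>+x. indicator A (T x) \<partial>?l) \<partial>?l)"
    by (subst nn_integral_multc) auto
  also have "\<dots> = (\<integral>\<^sup>+y. indicator B y * (\<integral>\<^sup>+x. indicator A (T x + y) \<partial>?l) \<partial>?l)"
  proof (rule nn_integral_cong, rule arg_cong2[where f="(*)"], rule refl)
    fix y
    show "(\<integral>\<^sup>+x. indicator A (T x) \<partial>?l) = (\<integral>\<^sup>+x. indicator A (T x + y) \<partial>?l)"
      using tr[of "\<lambda>x. indicator A (T x)" "T' y"] lin by (simp add: linear_add T')
  qed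
  also have "\<dots> = (\<integral>\<^sup>+y. (\<integral>\<^sup>+x. indicator B y * indicator A (T x + y) \<partial>?l) \<partial>?l)"
    by (subst nn_integral_cmult) auto
  also have "\<dots> = (\<integral>\<^sup>+x. (\<integral>\<^sup>+y. indicator B y * indicator A (T x + y) \<partial>?l) \<partial>?l)"
    by (rule lborel_pair.Fubini') measurable
  also have "\<dots> = (\<integral>\<^sup>+x. (\<integral>\<^sup>+y. indicator B (y - T x) * indicator A y \<partial>?l) \<partial>?l)"
  proof (rule nn_integral_cong)
    fix x
    show "(\<integral>\<^sup>+y. indicator B y * indicator A (T x + y) \<partial>?l) = (\<integral>\<^sup>+y. indicator B (y - T x) * indicator A y \<partial>?l)"
      using tr[of "\<lambda>y. indicator B (y - T x) * indicator A y" "T x"] by (simp add: add.commute)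
  qed
  also have "\<dots> = (\<integral>\<^sup>+y. (\<integral>\<^sup>+x. indicator B (y - T x) * indicator A y \<partial>?l) \<partial>?l)"
    by (rule lborel_pair.Fubini'[symmetric]) measurable
  also have "\<dots> = (\<integral>\<^sup>+y. (\<integral>\<^sup>+x. indicator B (T' y - x) \<partial>?l) * indicator A y \<partial>?l)"
  proof (rule nn_integral_cong)
    fix y
    have "y - T x = T (T' y - x)" for x using lin by (simp add: linear_diff T')
    then have "indicator B (y - T x) = (indicator B (T' y - x) :: ennreal)" for x
      by (simp add: indicator_def normT B_def)
    then show "(\<integral>\<^sup>+x. indicator B (y - T x) * indicator A y \<partial>?l) = (\<integral>\<^sup>+x. indicator B (T' y - x) \<partial>?l) * indicator A y"
      by (simp add: nn_integral_multc)
  qed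
  also have "\<dots> = (\<integral>\<^sup>+y. emeasure ?l B * indicator A y \<partial>?l)"
    by (subst nn_integral_lborel_preserving[OF lborel_distr_minus_euclidean]) auto
  also have "\<dots> = emeasure ?l B * emeasure ?l A"
    by (subst nn_integral_cmult) auto
  finally show "emeasure (distr lborel borel T) A = emeasure lborel A"
    using B by (simp add: ennreal_mult_cancel_left)
qed simp

section \<open>Gaussians\<close>

definition gauss :: "real \<Rightarrow> 'a::euclidean_space \<Rightarrow> real" where
  "gauss s x = exp (- (s * (norm x)\<^sup>2 / 2))"

lemma gauss_measurable [measurable]: "gauss s \<in> borel_measurable borel"
  unfolding gauss_def[abs_def] by measurable

lemma gauss_pos [simp]: "0 < gauss s x" and gauss_nonneg [simp]: "0 \<le> gauss s x"
  by (auto simp: gauss_def)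

lemma gauss_le_1: "0 \<le> s \<Longrightarrow> gauss s x \<le> 1"
  by (simp add: gauss_def)

lemma gauss_mult: "gauss s x * gauss t x = gauss (s + t) x"
  by (simp add: gauss_def exp_add[symmetric] field_simps)

lemma gauss_scaleR: "gauss s (c *\<^sub>R x) = gauss (s * c\<^sup>2) x"
  by (simp add: gauss_def power_mult_distrib mult.assoc)

lemma gauss_prod_Basis: "gauss s x = (\<Prod>b\<in>Basis. exp (- (s * (x \<bullet> b)\<^sup>2 / 2)))"
  unfolding gauss_def power2_norm_eq_inner euclidean_inner[of x x]
  by (subst exp_sum[symmetric]) (auto simp: sum_distrib_left sum_divide_distrib sum_negf power2_eq_square)

lemma integral_lborel_prod_Basis:
  fixes f :: "'a::euclidean_space \<Rightarrow> real \<Rightarrow> complex"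
  assumes "\<And>b. b \<in> Basis \<Longrightarrow> integrable lborel (f b)"
  shows "(LINT x|lborel. (\<Prod>b\<in>Basis. f b (x \<bullet> b))) = (\<Prod>b\<in>Basis. LINT t|lborel. f b t)"
    and "integrable lborel (\<lambda>x. \<Prod>b\<in>Basis. f b (x \<bullet> b))"
proof -
  interpret product_sigma_finite "\<lambda>b::'a. lborel :: real measure" by standard
  have [measurable]: "b \<in> Basis \<Longrightarrow> f b \<in> borel_measurable borel" for b
    using borel_measurable_integrable[OF assms] by simp
  have [measurable]: "(\<lambda>g. \<Sum>b\<in>Basis. g b *\<^sub>R b) \<in> measurable (\<Pi>\<^sub>M b\<in>Basis. lborel) (borel :: 'a measure)"
    by measurable
  have [measurable]: "(\<lambda>x::'a. \<Prod>b\<in>Basis. f b (x \<bullet> b)) \<in> borel_measurable borel"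
    by measurable
  have eq: "(\<Prod>b\<in>Basis. f b ((\<Sum>b\<in>Basis. g b *\<^sub>R b) \<bullet> b)) = (\<Prod>b\<in>Basis. f b (g b))" for g
    by (intro prod.cong) (auto simp: inner_sum_left_Basis)
  show "(LINT x|lborel. (\<Prod>b\<in>Basis. f b (x \<bullet> b))) = (\<Prod>b\<in>Basis. LINT t|lborel. f b t)"
    by (subst lborel_eq, subst integral_distr) (auto simp: eq product_integral_prod assms)
  show "integrable lborel (\<lambda>x. \<Prod>b\<in>Basis. f b (x \<bullet> b))"
    by (subst lborel_eq, subst integrable_distr_eq) (auto simp: eq intro!: product_integrable_prod assms)
qed

text \<open>This is the characteristic function of the standard normal law with the normalising
  factor of the density cleared.\<close>

lemma gauss_fourier_real:
  fixes t :: real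
  shows "integrable lborel (\<lambda>x::real. iexp (t * x) * complex_of_real (exp (- (x\<^sup>2 / 2))))"
    and "(LINT x|lborel. iexp (t * x) * complex_of_real (exp (- (x\<^sup>2 / 2)))) =
      complex_of_real (sqrt (2 * pi) * exp (- (t\<^sup>2 / 2)))"
proof -
  have "integrable lborel std_normal_density"
    by (rule integrable_normal_density) simp
  then have "integrable lborel (\<lambda>x. sqrt (2 * pi) * std_normal_density x)" by simp
  then have g: "integrable lborel (\<lambda>x::real. exp (- (x\<^sup>2 / 2)))"
    by (simp add: std_normal_density_def)
  show "integrable lborel (\<lambda>x::real. iexp (t * x) * complex_of_real (exp (- (x\<^sup>2 / 2))))"
    by (rule Bochner_Integration.integrable_bound[OF g]) (auto simp: norm_mult)
  have "char std_normal_distribution t = (LINT x|lborel. std_normal_density x *\<^sub>R iexp (t * x))"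
    unfolding char_def by (subst integral_density) (auto simp: normal_density_nonneg)
  also have "\<dots> = (LINT x|lborel. complex_of_real (1 / sqrt (2 * pi)) *
      (iexp (t * x) * complex_of_real (exp (- (x\<^sup>2 / 2)))))"
    by (intro Bochner_Integration.integral_cong) (auto simp: std_normal_density_def scaleR_conv_of_real)
  also have "\<dots> = complex_of_real (1 / sqrt (2 * pi)) *
      (LINT x|lborel. iexp (t * x) * complex_of_real (exp (- (x\<^sup>2 / 2))))"
    by (rule integral_mult_right_zero)
  finally have "complex_of_real (exp (- (t\<^sup>2) / 2)) = complex_of_real (1 / sqrt (2 * pi)) *
      (LINT x|lborel. iexp (t * x) * complex_of_real (exp (- (x\<^sup>2 / 2))))"
    by (simp add: char_std_normal_distribution)
  then show "(LINT x|lborel. iexp (t * x) * complex_of_real (exp (- (x\<^sup>2 / 2)))) =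
      complex_of_real (sqrt (2 * pi) * exp (- (t\<^sup>2 / 2)))"
    by (simp add: field_simps)
qed

lemma gauss_fourier_unit:
  fixes x :: "'a::euclidean_space"
  shows "integrable lborel (\<lambda>\<xi>::'a. iexp (x \<bullet> \<xi>) * complex_of_real (gauss 1 \<xi>))"
    and "(LINT \<xi>|lborel. iexp (x \<bullet> \<xi>) * complex_of_real (gauss 1 \<xi>)) =
      complex_of_real ((2 * pi) powr (DIM('a) / 2) * gauss 1 x)"
proof -
  let ?f = "\<lambda>b t. iexp ((x \<bullet> b) * t) * complex_of_real (exp (- (t\<^sup>2 / 2)))"
  have eq: "iexp (x \<bullet> \<xi>) * complex_of_real (gauss 1 \<xi>) = (\<Prod>b\<in>Basis. ?f b (\<xi> \<bullet> b))" for \<xi>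
    unfolding gauss_prod_Basis euclidean_inner[of x \<xi>] prod.distrib
    by (simp add: exp_sum sum_distrib_left)
  show "integrable lborel (\<lambda>\<xi>::'a. iexp (x \<bullet> \<xi>) * complex_of_real (gauss 1 \<xi>))"
    unfolding eq by (rule integral_lborel_prod_Basis(2)[OF gauss_fourier_real(1)])
  have "(LINT \<xi>|lborel. iexp (x \<bullet> \<xi>) * complex_of_real (gauss 1 \<xi>)) =
     (\<Prod>b\<in>Basis. complex_of_real (sqrt (2 * pi) * exp (- ((x \<bullet> b)\<^sup>2 / 2))))"
    unfolding eq by (subst integral_lborel_prod_Basis(1)[OF gauss_fourier_real(1)]) (simp only: gauss_fourier_real(2))
  also have "\<dots> = complex_of_real (\<Prod>b\<in>(Basis::'a set). sqrt (2 * pi) * exp (- ((x \<bullet> b)\<^sup>2 / 2)))"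
    by simp
  also have "(\<Prod>b\<in>(Basis::'a set). sqrt (2 * pi) * exp (- ((x \<bullet> b)\<^sup>2 / 2))) = sqrt (2 * pi) ^ DIM('a) * gauss 1 x"
    by (simp add: prod.distrib gauss_prod_Basis)
  also have "sqrt (2 * pi) ^ DIM('a) = (2 * pi) powr (DIM('a) / 2)"
    by (simp add: powr_half_sqrt[symmetric] powr_powr powr_realpow[symmetric])
  finally show "(LINT \<xi>|lborel. iexp (x \<bullet> \<xi>) * complex_of_real (gauss 1 \<xi>)) =
      complex_of_real ((2 * pi) powr (DIM('a) / 2) * gauss 1 x)" .
qed

lemma gauss_fourier:
  fixes x :: "'a::euclidean_space"
  assumes s: "s > 0"
  shows "(LINT \<xi>|lborel. iexp (x \<bullet> \<xi>) * complex_of_real (gauss s \<xi>)) =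
      complex_of_real ((2 * pi / s) powr (DIM('a) / 2) * gauss (1 / s) x)"
proof -
  let ?c = "1 / sqrt s"
  have c: "?c > 0" using s by simp
  have "(LINT \<xi>|lborel. iexp (x \<bullet> \<xi>) * complex_of_real (gauss s \<xi>)) =
     ?c ^ DIM('a) *\<^sub>R (LINT \<xi>|lborel. iexp (x \<bullet> (?c *\<^sub>R \<xi>)) * complex_of_real (gauss s (?c *\<^sub>R \<xi>)))"
    by (rule integral_lborel_scaleR(1)[OF _ c]) simp
  also have "\<dots> = ?c ^ DIM('a) *\<^sub>R (LINT \<xi>|lborel. iexp ((?c *\<^sub>R x) \<bullet> \<xi>) * complex_of_real (gauss 1 \<xi>))"
    using s by (simp add: gauss_scaleR power_divide)
  also have "\<dots> = complex_of_real (?c ^ DIM('a) * (2 * pi) powr (DIM('a) / 2) * gauss 1 (?c *\<^sub>R x))"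
    by (subst gauss_fourier_unit(2)) (simp add: scaleR_conv_of_real)
  also have "?c ^ DIM('a) = (1 / s) powr (DIM('a) / 2)"
    using s by (simp add: powr_half_sqrt[symmetric] powr_powr powr_realpow[symmetric] powr_divide)
  also have "(1 / s) powr (DIM('a) / 2) * (2 * pi) powr (DIM('a) / 2) = (2 * pi / s) powr (DIM('a) / 2)"
    using s by (simp add: powr_mult[symmetric])
  also have "gauss 1 (?c *\<^sub>R x) = gauss (1 / s) x"
    using s by (simp add: gauss_scaleR power_divide)
  finally show ?thesis .
qed

lemma integrable_gauss:
  assumes s: "s > 0"
  shows "integrable lborel (gauss s :: 'a::euclidean_space \<Rightarrow> real)"
proof -
  have "integrable lborel (\<lambda>\<xi>::'a. complex_of_real (gauss 1 \<xi>))"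
    using gauss_fourier_unit(1)[of 0] by simp
  then have "integrable lborel (gauss 1 :: 'a \<Rightarrow> real)"
    using integrable_Re by fastforce
  then have "integrable lborel (\<lambda>x::'a. gauss 1 (sqrt s *\<^sub>R x))"
    using s by (subst integral_lborel_scaleR(2)) auto
  then show ?thesis using s by (simp add: gauss_scaleR)
qed

lemma integral_gauss:
  assumes s: "s > 0"
  shows "(LINT x|lborel. gauss s (x::'a::euclidean_space)) = (2 * pi / s) powr (DIM('a) / 2)"
proof -
  have "(LINT x|lborel. complex_of_real (gauss s (x::'a))) = complex_of_real ((2 * pi / s) powr (DIM('a) / 2))"
    using gauss_fourier[OF s, of "0::'a"] by (simp add: gauss_def)
  then show ?thesis
    by (metis integral_complex_of_real of_real_eq_iff)
qed


section \<open>Continuity of translations in the mean\<close>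

lemma
  fixes f :: "'a::euclidean_space \<Rightarrow> 'b::{banach,second_countable_topology}"
  assumes [measurable]: "f \<in> borel_measurable borel"
  shows integral_lborel_shift: "(LINT x|lborel. f (x + z)) = (LINT x|lborel. f x)"
    and integrable_lborel_shift: "integrable lborel (\<lambda>x. f (x + z)) \<longleftrightarrow> integrable lborel f"
  using integral_lborel_preserving[OF lborel_distr_plus[of z] _ assms]
    integrable_lborel_preserving[OF lborel_distr_plus[of z] _ assms]
  by (simp_all add: add.commute)

text \<open>Sequences of shifts, rather than a limit along all z, let dominated convergence apply
  directly.\<close>

definition shift_continuous_L1 :: "('a::euclidean_space \<Rightarrow> real) \<Rightarrow> bool" where
  "shift_continuous_L1 f \<longleftrightarrow> (\<forall>z. z \<longlonglongrightarrow> 0 \<longrightarrow> (\<lambda>k. LINT x|lborel. \<bar>f (x + z k) - f x\<bar>) \<longlonglongrightarrow> 0)"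

text \<open>Translations are isometries of L^1, so replacing \<open>f\<close> by \<open>h\<close>
  costs the same before and after the shift, uniformly in the shift.\<close>

lemma shift_continuous_L1_closed:
  fixes f :: "'a::euclidean_space \<Rightarrow> real"
  assumes f: "integrable lborel f"
    and appr: "\<And>e. e > 0 \<Longrightarrow> \<exists>h. integrable lborel h \<and> shift_continuous_L1 h \<and> (LINT x|lborel. \<bar>f x - h x\<bar>) \<le> e"
  shows "shift_continuous_L1 f"
  unfolding shift_continuous_L1_def
proof (intro allI impI LIMSEQ_I)
  fix z :: "nat \<Rightarrow> 'a" and e :: real
  assume z: "z \<longlonglongrightarrow> 0" and e: "0 < e"
  obtain h where h: "integrable lborel h" "shift_continuous_L1 h" "(LINT x|lborel. \<bar>f x - h x\<bar>) \<le> e/4"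
    using appr[of "e/4"] e by auto
  note [measurable] = borel_measurable_integrable[OF f] borel_measurable_integrable[OF h(1)]
  have fb: "f \<in> borel_measurable borel" "h \<in> borel_measurable borel"
    using borel_measurable_integrable[OF f] borel_measurable_integrable[OF h(1)] by auto
  obtain N where N: "\<And>k. k \<ge> N \<Longrightarrow> norm ((LINT x|lborel. \<bar>h (x + z k) - h x\<bar>) - 0) < e/4"
    using LIMSEQ_D[OF h(2)[unfolded shift_continuous_L1_def, rule_format, OF z], of "e/4"] e by auto
  have "norm ((LINT x|lborel. \<bar>f (x + z k) - f x\<bar>) - 0) < e" if "k \<ge> N" for k
  proof -
    have ish: "integrable lborel (\<lambda>x. f (x + z k))" "integrable lborel (\<lambda>x. h (x + z k))"
      using f h(1) by (simp_all add: integrable_lborel_shift fb)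
    have i: "integrable lborel (\<lambda>x. \<bar>f (x + z k) - h (x + z k)\<bar>)" "integrable lborel (\<lambda>x. \<bar>h (x + z k) - h x\<bar>)"
      "integrable lborel (\<lambda>x. \<bar>f x - h x\<bar>)" "integrable lborel (\<lambda>x. \<bar>f (x + z k) - f x\<bar>)"
      using f h(1) ish by auto
    have "(LINT x|lborel. \<bar>f (x + z k) - f x\<bar>)
       \<le> (LINT x|lborel. \<bar>f (x + z k) - h (x + z k)\<bar> + (\<bar>h (x + z k) - h x\<bar> + \<bar>f x - h x\<bar>))"
      by (intro integral_mono i Bochner_Integration.integrable_add) linarith
    also have "\<dots> = (LINT x|lborel. \<bar>f (x + z k) - h (x + z k)\<bar>) +
        ((LINT x|lborel. \<bar>h (x + z k) - h x\<bar>) + (LINT x|lborel. \<bar>f x - h x\<bar>))"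
      using i by simp
    also have "(LINT x|lborel. \<bar>f (x + z k) - h (x + z k)\<bar>) = (LINT x|lborel. \<bar>f x - h x\<bar>)"
      using integral_lborel_shift[of "\<lambda>x. \<bar>f x - h x\<bar>" "z k"] fb by simp
    finally have "(LINT x|lborel. \<bar>f (x + z k) - f x\<bar>) < e"
      using N[OF that] h(3) e by simp
    then show ?thesis by simp
  qed
  then show "\<exists>no. \<forall>k\<ge>no. norm ((LINT x|lborel. \<bar>f (x + z k) - f x\<bar>) - 0) < e" by blast
qed

text \<open>The positive part of \<open>u x - u (x + z)\<close> is handled by dominated convergence; since \<open>u\<close> and its
  translate have the same integral, the negative part has the same integral as the positive one.\<close>

lemma shift_continuous_L1_open:
  fixes U :: "'a::euclidean_space set"
  assumes U: "open U" and fin: "emeasure lborel U < \<infinity>"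
  shows "shift_continuous_L1 (indicat_real U)"
  unfolding shift_continuous_L1_def
proof (intro allI impI)
  fix z :: "nat \<Rightarrow> 'a" assume z: "z \<longlonglongrightarrow> 0"
  have [measurable]: "U \<in> sets borel" using U by simp
  let ?u = "indicat_real U"
  have iu: "integrable lborel ?u" using fin by (simp add: integrable_indicator_iff)
  have ish: "integrable lborel (\<lambda>x. ?u (x + z k))" for k
    using iu by (subst integrable_lborel_shift) auto
  have "(\<lambda>k. LINT x|lborel. max 0 (?u x - ?u (x + z k))) \<longlonglongrightarrow> (LINT x|(lborel::'a measure). 0)"
  proof (rule integral_dominated_convergence[where w="?u"])
    show "AE x in lborel. (\<lambda>k. max 0 (?u x - ?u (x + z k))) \<longlonglongrightarrow> 0"
    proof (rule AE_I2)
      fix x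
      show "(\<lambda>k. max 0 (?u x - ?u (x + z k))) \<longlonglongrightarrow> 0"
      proof (cases "x \<in> U")
        case True
        have "(\<lambda>k. x + z k) \<longlonglongrightarrow> x" using tendsto_add[OF tendsto_const z, of x] by simp
        then have "eventually (\<lambda>k. x + z k \<in> U) sequentially"
          using topological_tendstoD[OF _ U True] by blast
        then have "eventually (\<lambda>k. max 0 (?u x - ?u (x + z k)) = 0) sequentially"
          by eventually_elim (use True in auto)
        then show ?thesis by (rule tendsto_eventually)
      next
        case False
        then have "max 0 (?u x - ?u (x + z k)) = 0" for k by (simp add: indicator_def)
        then show ?thesis by simp
      qed
    qed
    show "AE x in lborel. norm (max 0 (?u x - ?u (x + z k))) \<le> ?u x" for k
      by (intro AE_I2) (auto simp: max_def indicator_def)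
  qed (use iu in auto)
  then have lim: "(\<lambda>k. 2 * (LINT x|lborel. max 0 (?u x - ?u (x + z k)))) \<longlonglongrightarrow> 0"
    using tendsto_mult_right_zero by force
  have "(LINT x|lborel. \<bar>?u (x + z k) - ?u x\<bar>) = 2 * (LINT x|lborel. max 0 (?u x - ?u (x + z k)))" for k
  proof -
    have m: "integrable lborel (\<lambda>x. max 0 (?u x - ?u (x + z k)))"
      using iu ish by (intro integrable_max) auto
    have "(LINT x|lborel. \<bar>?u (x + z k) - ?u x\<bar>) =
        (LINT x|lborel. 2 * max 0 (?u x - ?u (x + z k)) + (?u (x + z k) - ?u x))"
      by (intro Bochner_Integration.integral_cong) (auto simp: max_def abs_if)
    also have "\<dots> = 2 * (LINT x|lborel. max 0 (?u x - ?u (x + z k))) + ((LINT x|lborel. ?u (x + z k)) - (LINT x|lborel. ?u x))"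
      using m iu ish by simp
    also have "(LINT x|lborel. ?u (x + z k)) = (LINT x|lborel. ?u x)"
      by (rule integral_lborel_shift) simp
    finally show ?thesis by simp
  qed
  with lim show "(\<lambda>k. LINT x|lborel. \<bar>?u (x + z k) - ?u x\<bar>) \<longlonglongrightarrow> 0" by simp
qed

lemma shift_continuous_L1_scale:
  "shift_continuous_L1 f \<Longrightarrow> shift_continuous_L1 (\<lambda>x. f x * c)"
  unfolding shift_continuous_L1_def
  by (auto simp: left_diff_distrib[symmetric] abs_mult intro: tendsto_mult_left_zero)

text \<open>Outer regularity reduces indicators of measurable sets to open sets, where pointwise
  convergence is available; linear combinations and L^1 limits preserve the property.\<close>

lemma shift_continuous_L1_integrable:
  fixes f :: "'a::euclidean_space \<Rightarrow> real"
  assumes "integrable lborel f"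
  shows "shift_continuous_L1 f"
  using assms
proof (induction rule: integrable_induct)
  case (base A c)
  then have [measurable]: "A \<in> sets borel" by simp
  have iA: "integrable lborel (indicat_real A)" using base by (simp add: integrable_indicator_iff)
  have "shift_continuous_L1 (indicat_real A)"
  proof (rule shift_continuous_L1_closed[OF iA])
    fix e :: real assume e: "e > 0"
    obtain U where U: "open U" "A \<subseteq> U" "emeasure lborel (U - A) < e"
      using outer_regular_lborel[OF _ e, of A] by auto
    have [measurable]: "U \<in> sets borel" using U by simp
    have "emeasure lborel U \<le> emeasure lborel A + emeasure lborel (U - A)"
      using emeasure_subadditive[of A lborel "U - A"] U(2) by (simp add: Un_absorb1)
    also have "\<dots> < \<infinity>" using base U(3) by (auto simp: less_top[symmetric] ennreal_add_eq_top top_unique)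
    finally have fin: "emeasure lborel U < \<infinity>" .
    have "(LINT x|lborel. \<bar>indicat_real A x - indicat_real U x\<bar>) = (LINT x|lborel. indicat_real (U - A) x)"
      using U(2) by (intro Bochner_Integration.integral_cong) (auto simp: indicator_def)
    also have "\<dots> = measure lborel (U - A)" by simp
    also have "\<dots> \<le> e"
      using U(3) e by (simp add: measure_def enn2real_leI less_imp_le)
    finally show "\<exists>h. integrable lborel h \<and> shift_continuous_L1 h \<and> (LINT x|lborel. \<bar>indicat_real A x - h x\<bar>) \<le> e"
      using shift_continuous_L1_open[OF U(1) fin] fin
      by (intro exI[of _ "indicat_real U"]) (auto simp: integrable_indicator_iff)
  qed
  from shift_continuous_L1_scale[OF this, of c] show ?case by simp
next
  case (add f g)
  note [measurable] = borel_measurable_integrable[OF add.hyps(1)] borel_measurable_integrable[OF add.hyps(2)]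
  have fb: "f \<in> borel_measurable borel" "g \<in> borel_measurable borel"
    using borel_measurable_integrable[OF add.hyps(1)] borel_measurable_integrable[OF add.hyps(2)] by auto
  show ?case unfolding shift_continuous_L1_def
  proof (intro allI impI)
    fix z :: "nat \<Rightarrow> 'a" assume z: "z \<longlonglongrightarrow> 0"
    have i: "integrable lborel (\<lambda>x. \<bar>f (x + z k) - f x\<bar>)" "integrable lborel (\<lambda>x. \<bar>g (x + z k) - g x\<bar>)"
      "integrable lborel (\<lambda>x. \<bar>f (x + z k) + g (x + z k) - (f x + g x)\<bar>)" for k
      using add.hyps by (auto simp: integrable_lborel_shift fb)
    show "(\<lambda>k. LINT x|lborel. \<bar>f (x + z k) + g (x + z k) - (f x + g x)\<bar>) \<longlonglongrightarrow> 0"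
    proof (rule tendsto_sandwich[OF _ _ tendsto_const])
      show "\<forall>\<^sub>F k in sequentially. (LINT x|lborel. \<bar>f (x + z k) + g (x + z k) - (f x + g x)\<bar>)
         \<le> (LINT x|lborel. \<bar>f (x + z k) - f x\<bar>) + (LINT x|lborel. \<bar>g (x + z k) - g x\<bar>)"
        by (intro always_eventually allI, subst Bochner_Integration.integral_add[symmetric, OF i(1,2)],
            intro integral_mono i Bochner_Integration.integrable_add) linarith
      show "(\<lambda>k. (LINT x|lborel. \<bar>f (x + z k) - f x\<bar>) + (LINT x|lborel. \<bar>g (x + z k) - g x\<bar>)) \<longlonglongrightarrow> 0"
        using tendsto_add[of _ 0 sequentially _ 0] add.IH z unfolding shift_continuous_L1_def by fastforce
    qed auto
  qed
next
  case (lim f s)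
  show ?case
  proof (rule shift_continuous_L1_closed[OF lim.hyps(4)])
    fix e :: real assume e: "e > 0"
    note [measurable] = borel_measurable_integrable[OF lim.hyps(1)] borel_measurable_integrable[OF lim.hyps(4)]
    have "(\<lambda>i. LINT x|lborel. \<bar>f x - s i x\<bar>) \<longlonglongrightarrow> (LINT x|(lborel::'a measure). 0)"
    \<comment> \<open>The induction rule supplies \<open>norm (s i x) \<le> 2 * norm (f x)\<close>,
      hence the factor 3.\<close>
    proof (rule integral_dominated_convergence[where w="\<lambda>x. 3 * \<bar>f x\<bar>"])
      show "AE x in lborel. (\<lambda>i. \<bar>f x - s i x\<bar>) \<longlonglongrightarrow> 0"
      proof (rule AE_I2)
        fix x
        have "(\<lambda>i. \<bar>f x - s i x\<bar>) \<longlonglongrightarrow> \<bar>f x - f x\<bar>"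
          by (intro tendsto_intros lim.hyps(2)) simp
        then show "(\<lambda>i. \<bar>f x - s i x\<bar>) \<longlonglongrightarrow> 0" by simp
      qed
      show "AE x in lborel. norm \<bar>f x - s i x\<bar> \<le> 3 * \<bar>f x\<bar>" for i
      proof (rule AE_I2)
        fix x show "norm \<bar>f x - s i x\<bar> \<le> 3 * \<bar>f x\<bar>"
          using lim.hyps(3)[of x i] by simp
      qed
    qed (use lim.hyps(4) in auto)
    then have "(\<lambda>i. LINT x|lborel. \<bar>f x - s i x\<bar>) \<longlonglongrightarrow> 0" by simp
    then obtain i where "norm ((LINT x|lborel. \<bar>f x - s i x\<bar>) - 0) < e"
      using LIMSEQ_D[OF _ e] by blast
    then show "\<exists>h. integrable lborel h \<and> shift_continuous_L1 h \<and> (LINT x|lborel. \<bar>f x - h x\<bar>) \<le> e"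
      using lim.hyps(1) lim.IH by (intro exI[of _ "s i"]) auto
  qed
qed

lemma L2fun_shift:
  assumes "L2fun g" shows "L2fun (\<lambda>x. g (x + z))" "L2sq (\<lambda>x. g (x + z)) = L2sq g"
proof -
  have [measurable]: "g \<in> borel_measurable borel" using L2fun_measurable[OF assms] by simp
  show "L2fun (\<lambda>x. g (x + z))"
    using assms integrable_lborel_shift[of "\<lambda>x. (cmod (g x))\<^sup>2" z] by (auto simp: L2fun_def)
  show "L2sq (\<lambda>x. g (x + z)) = L2sq g"
    unfolding L2sq_def by (rule integral_lborel_shift) simp
qed

text \<open>For nonnegative reals \<open>\<bar>a - b\<bar>\<^sup>2 \<le> \<bar>a\<^sup>2 - b\<^sup>2\<bar>\<close>, so the \<open>L\<^sup>1\<close> statement applies to the squares of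
  the four nonnegative parts of \<open>g\<close>.\<close>

lemma L2_shift_continuous:
  fixes g :: "'a::euclidean_space \<Rightarrow> complex"
  assumes g: "L2fun g" and z: "z \<longlonglongrightarrow> 0"
  shows "(\<lambda>k. L2sq (\<lambda>x. g (x + z k) - g x)) \<longlonglongrightarrow> 0"
proof -
  have [measurable]: "g \<in> borel_measurable borel" using L2fun_measurable[OF g] by simp
  have dom: "integrable lborel p" if [measurable]: "p \<in> borel_measurable borel"
    and "\<And>x. \<bar>p x\<bar> \<le> (cmod (g x))\<^sup>2" for p :: "'a \<Rightarrow> real"
    by (rule Bochner_Integration.integrable_bound[OF L2fun_integrable[OF g]]) (use that in auto)
  define P where "P = [\<lambda>x. (max 0 (Re (g x)))\<^sup>2, \<lambda>x. (max 0 (- Re (g x)))\<^sup>2, \<lambda>x. (max 0 (Im (g x)))\<^sup>2, \<lambda>x. (max 0 (- Im (g x)))\<^sup>2]"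
  have sq: "(max 0 a)\<^sup>2 \<le> a\<^sup>2" for a :: real by (auto simp: max_def)
  have iP: "integrable lborel p" if "p \<in> set P" for p
  proof (rule dom)
    show "p \<in> borel_measurable borel" using that by (auto simp: P_def)
    show "\<bar>p x\<bar> \<le> (cmod (g x))\<^sup>2" for x
      using that sq[of "Re (g x)"] sq[of "- Re (g x)"] sq[of "Im (g x)"] sq[of "- Im (g x)"]
        zero_le_power2[of "Re (g x)"] zero_le_power2[of "Im (g x)"]
      unfolding cmod_power2 by (auto simp: P_def intro: order_trans)
  qed
  have ish: "integrable lborel (\<lambda>x. \<bar>p (x + z k) - p x\<bar>)" if "p \<in> set P" for p k
    using iP[OF that] borel_measurable_integrable[OF iP[OF that]] by (auto simp: integrable_lborel_shift)
  have key: "(a - b)\<^sup>2 \<le> 2 * \<bar>(max 0 a)\<^sup>2 - (max 0 b)\<^sup>2\<bar> + 2 * \<bar>(max 0 (-a))\<^sup>2 - (max 0 (-b))\<^sup>2\<bar>" for a b :: real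
  proof -
    have pos: "(c - d)\<^sup>2 \<le> \<bar>c\<^sup>2 - d\<^sup>2\<bar>" if "0 \<le> c" "0 \<le> d" for c d :: real
    proof -
      have "\<bar>c - d\<bar> * \<bar>c - d\<bar> \<le> \<bar>c - d\<bar> * \<bar>c + d\<bar>"
        using that by (intro mult_left_mono) auto
      also have "\<dots> = \<bar>c\<^sup>2 - d\<^sup>2\<bar>"
        by (simp add: abs_mult[symmetric] power2_eq_square algebra_simps)
      finally show ?thesis by (simp add: power2_eq_square)
    qed
    have "(a - b)\<^sup>2 = ((max 0 a - max 0 b) + (max 0 (-b) - max 0 (-a)))\<^sup>2"
      by (rule arg_cong[where f="\<lambda>t. t\<^sup>2"]) (auto simp: max_def)
    also have "\<dots> \<le> 2 * (max 0 a - max 0 b)\<^sup>2 + 2 * (max 0 (-b) - max 0 (-a))\<^sup>2"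
      using norm_sq_add_le[of "max 0 a - max 0 b" "max 0 (-b) - max 0 (-a)"] by simp
    finally show ?thesis
      using pos[of "max 0 a" "max 0 b"] pos[of "max 0 (-b)" "max 0 (-a)"] by (simp add: abs_minus_commute)
  qed
  have bound: "L2sq (\<lambda>x. g (x + z k) - g x) \<le> (\<Sum>p\<leftarrow>P. 2 * (LINT x|lborel. \<bar>p (x + z k) - p x\<bar>))" for k
  proof -
    have lst: "integrable lborel (\<lambda>x. \<Sum>p\<leftarrow>Q. 2 * \<bar>p (x + z k) - p x\<bar>) \<and>
       (LINT x|lborel. (\<Sum>p\<leftarrow>Q. 2 * \<bar>p (x + z k) - p x\<bar>)) = (\<Sum>p\<leftarrow>Q. 2 * (LINT x|lborel. \<bar>p (x + z k) - p x\<bar>))"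
      if "set Q \<subseteq> set P" for Q
      using that by (induction Q) (auto simp: ish)
    have "L2sq (\<lambda>x. g (x + z k) - g x) \<le> (LINT x|lborel. (\<Sum>p\<leftarrow>P. 2 * \<bar>p (x + z k) - p x\<bar>))"
      unfolding L2sq_def
    proof (rule integral_mono)
      show "integrable lborel (\<lambda>x. (cmod (g (x + z k) - g x))\<^sup>2)"
        by (intro L2fun_integrable L2fun_diff L2fun_shift g)
      show "integrable lborel (\<lambda>x. \<Sum>p\<leftarrow>P. 2 * \<bar>p (x + z k) - p x\<bar>)"
        using lst[OF order.refl] by blast
      show "(cmod (g (x + z k) - g x))\<^sup>2 \<le> (\<Sum>p\<leftarrow>P. 2 * \<bar>p (x + z k) - p x\<bar>)" for x
        using key[of "Re (g (x + z k))" "Re (g x)"] key[of "Im (g (x + z k))" "Im (g x)"]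
        unfolding P_def cmod_power2 by simp
    qed
    also have "\<dots> = (\<Sum>p\<leftarrow>P. 2 * (LINT x|lborel. \<bar>p (x + z k) - p x\<bar>))"
      using lst[OF order.refl] by blast
    finally show ?thesis .
  qed
  have "(\<lambda>k. \<Sum>p\<leftarrow>P. 2 * (LINT x|lborel. \<bar>p (x + z k) - p x\<bar>)) \<longlonglongrightarrow> 0"
  proof -
    have "(\<lambda>k. 2 * (LINT x|lborel. \<bar>p (x + z k) - p x\<bar>)) \<longlonglongrightarrow> 0" if "p \<in> set P" for p
      using shift_continuous_L1_integrable[OF iP[OF that]] z tendsto_mult_right_zero
      unfolding shift_continuous_L1_def by blast
    then show ?thesis
      by (induction P) (auto intro!: tendsto_add_zero)
  qed
  then show ?thesis
    by (rule tendsto_sandwich[OF _ _ tendsto_const, rotated 2]) (use bound in auto)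
qed


section \<open>The Plancherel theorem\<close>

text \<open>Unnormalised and with the sign of the inverse transform, because spectra are the primary
  data here and functions are recovered from them.\<close>

definition fourier_int :: "('a::euclidean_space \<Rightarrow> complex) \<Rightarrow> 'a \<Rightarrow> complex" where
  "fourier_int u x = (LINT \<xi>|lborel. iexp (x \<bullet> \<xi>) * u \<xi>)"

lemma fourier_L1_eq_fourier_int:
  "fourier_L1 g x = complex_of_real ((2 * pi) powr (- real DIM('a) / 2)) * fourier_int g (- x :: 'a::euclidean_space)"
  unfolding fourier_L1_def fourier_int_def by (simp add: inner_commute)

lemma norm_exp_i_mult [simp]: "cmod (iexp t * z) = cmod z"
  by (simp add: norm_mult)

lemma integrable_exp_i_mult:
  fixes x :: "'a::euclidean_space"
  assumes "integrable lborel u"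
  shows "integrable lborel (\<lambda>\<xi>. iexp (x \<bullet> \<xi>) * u \<xi>)"
  by (rule Bochner_Integration.integrable_bound[OF assms]) (use assms in auto)

lemma fourier_int_measurable [measurable]:
  assumes [measurable]: "u \<in> borel_measurable borel"
  shows "fourier_int u \<in> borel_measurable borel"
  unfolding fourier_int_def[abs_def] by measurable

lemma norm_fourier_int_le:
  "cmod (fourier_int u x) \<le> (LINT \<xi>|lborel. cmod (u \<xi>))"
proof -
  have "cmod (fourier_int u x) \<le> (LINT \<xi>|lborel. cmod (iexp (x \<bullet> \<xi>) * u \<xi>))"
    unfolding fourier_int_def by (rule integral_norm_bound)
  then show ?thesis by simp
qed

lemma fourier_int_add:
  "integrable lborel u \<Longrightarrow> integrable lborel v \<Longrightarrow>
    fourier_int (\<lambda>\<xi>. u \<xi> + v \<xi>) = (\<lambda>x. fourier_int u x + fourier_int v x)"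
  unfolding fourier_int_def using integrable_exp_i_mult[of u] integrable_exp_i_mult[of v]
  by (simp add: distrib_left)

lemma fourier_int_diff:
  "integrable lborel u \<Longrightarrow> integrable lborel v \<Longrightarrow>
    fourier_int (\<lambda>\<xi>. u \<xi> - v \<xi>) = (\<lambda>x. fourier_int u x - fourier_int v x)"
  unfolding fourier_int_def using integrable_exp_i_mult[of u] integrable_exp_i_mult[of v]
  by (simp add: right_diff_distrib)

lemma fourier_int_cmult: "fourier_int (\<lambda>\<xi>. c * u \<xi>) = (\<lambda>x. c * fourier_int u x)"
  unfolding fourier_int_def by (simp add: mult.left_commute)

lemma integrable_pair_mult_bounded:
  fixes u v :: "'a::euclidean_space \<Rightarrow> complex" and m :: "'a \<times> 'a \<Rightarrow> complex"
  assumes u: "integrable lborel u" and v: "integrable lborel v"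
    and [measurable]: "m \<in> borel_measurable (borel \<Otimes>\<^sub>M borel)" and m: "\<And>p. cmod (m p) \<le> 1"
  shows "integrable (lborel \<Otimes>\<^sub>M lborel) (\<lambda>(x, y). m (x, y) * u x * v y)"
proof -
  have [measurable]: "u \<in> borel_measurable borel" "v \<in> borel_measurable borel"
    using u v by (auto dest: borel_measurable_integrable)
  have "integrable (lborel \<Otimes>\<^sub>M lborel) (\<lambda>p. u (fst p) * v (snd p))"
  proof (rule lborel_pair.Fubini_integrable)
    show "integrable lborel (\<lambda>x. LINT y|lborel. norm (u (fst (x, y)) * v (snd (x, y))))"
      using u by (simp add: norm_mult)
    show "AE x in lborel. integrable lborel (\<lambda>y. u (fst (x, y)) * v (snd (x, y)))"
      using v by simp
  qed measurable
  then show ?thesis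
  proof (rule Bochner_Integration.integrable_bound)
    show "AE p in lborel \<Otimes>\<^sub>M lborel. norm (case p of (x, y) \<Rightarrow> m (x, y) * u x * v y) \<le> norm (u (fst p) * v (snd p))"
    proof (rule AE_I2)
      fix p :: "'a \<times> 'a"
      have "cmod (m p) * (cmod (u (fst p)) * cmod (v (snd p))) \<le> 1 * (cmod (u (fst p)) * cmod (v (snd p)))"
        by (intro mult_right_mono m) auto
      then show "norm (case p of (x, y) \<Rightarrow> m (x, y) * u x * v y) \<le> norm (u (fst p) * v (snd p))"
        by (simp add: norm_mult split_beta mult.assoc)
    qed
  qed (simp add: split_beta, measurable)
qed

lemma fourier_int_multiplication:
  fixes u v :: "'a::euclidean_space \<Rightarrow> complex"
  assumes u: "integrable lborel u" and v: "integrable lborel v"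
  shows "(LINT x|lborel. fourier_int u x * v x) = (LINT w|lborel. u w * fourier_int v w)"
proof -
  let ?F = "\<lambda>w x. iexp (x \<bullet> w) * u w * v x"
  have i: "integrable (lborel \<Otimes>\<^sub>M lborel) (case_prod ?F)"
    using integrable_pair_mult_bounded[OF u v, of "\<lambda>(w, x). iexp (x \<bullet> w)"]
    by (simp add: split_beta)
  have "(LINT x|lborel. fourier_int u x * v x) = (LINT x|lborel. LINT w|lborel. ?F w x)"
    unfolding fourier_int_def by simp
  also have "\<dots> = (LINT w|lborel. LINT x|lborel. ?F w x)"
    by (rule lborel_pair.Fubini_integral[OF i])
  also have "\<dots> = (LINT w|lborel. u w * fourier_int v w)"
    unfolding fourier_int_def
    by (intro Bochner_Integration.integral_cong refl)
       (simp add: inner_commute mult.assoc mult.left_commute flip: integral_mult_right_zero)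
  finally show ?thesis .
qed

lemma fourier_int_gauss:
  "s > 0 \<Longrightarrow> fourier_int (\<lambda>\<xi>. complex_of_real (gauss s \<xi>)) (x::'a::euclidean_space) =
     complex_of_real ((2 * pi / s) powr (DIM('a) / 2) * gauss (1 / s) x)"
  unfolding fourier_int_def by (rule gauss_fourier)

definition autocorr :: "('a::euclidean_space \<Rightarrow> complex) \<Rightarrow> 'a \<Rightarrow> complex" where
  "autocorr g w = (LINT \<eta>|lborel. g (\<eta> + w) * cnj (g \<eta>))"

lemma cnj_measurable [measurable]:
  "f \<in> borel_measurable M \<Longrightarrow> (\<lambda>x. cnj (f x)) \<in> borel_measurable M"
  by (rule borel_measurable_continuous_on[OF continuous_on_cnj]) auto

lemma integrable_cnj: "integrable M f \<Longrightarrow> integrable M (\<lambda>x. cnj (f x))"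
  by (rule integrable_bounded_linear[OF bounded_linear_cnj])

text \<open>Wiener-Khinchin. After Fubini, the substitution w + eta for w splits the character into
  two factors, so the double integral becomes a product of the transform with its conjugate.\<close>

lemma
  fixes g :: "'a::euclidean_space \<Rightarrow> complex"
  assumes g: "integrable lborel g"
  shows integrable_autocorr: "integrable lborel (autocorr g)"
    and fourier_int_autocorr: "fourier_int (autocorr g) x = complex_of_real ((cmod (fourier_int g x))\<^sup>2)"
proof -
  have [measurable]: "g \<in> borel_measurable borel" using g by auto
  let ?e = "\<lambda>x w. iexp (x \<bullet> w)"
  have sh: "integrable lborel (\<lambda>w. g (\<eta> + w))" for \<eta>
    using integrable_lborel_shift[of g \<eta>] g by (simp add: add.commute)
  have int': "integrable (lborel \<Otimes>\<^sub>M lborel) (\<lambda>(\<eta>, w). ?e x w * g (\<eta> + w) * cnj (g \<eta>))" for x :: 'a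
    unfolding case_prod_beta
  proof (rule lborel_pair.Fubini_integrable)
    have "(LINT w|lborel. cmod (g (\<eta> + w))) = (LINT w|lborel. cmod (g w))" for \<eta>
      using integral_lborel_shift[of "\<lambda>w. cmod (g w)" \<eta>] by (simp add: add.commute)
    then show "integrable lborel (\<lambda>\<eta>. LINT w|lborel. norm (?e x (snd (\<eta>, w)) * g (fst (\<eta>, w) + snd (\<eta>, w)) * cnj (g (fst (\<eta>, w)))))"
      using g by (simp add: norm_mult)
    show "AE \<eta> in lborel. integrable lborel (\<lambda>w. ?e x (snd (\<eta>, w)) * g (fst (\<eta>, w) + snd (\<eta>, w)) * cnj (g (fst (\<eta>, w))))"
      using integrable_exp_i_mult[OF sh] by (intro AE_I2) simp
  qed measurable
  have "integrable lborel (\<lambda>w. LINT \<eta>|lborel. ?e 0 w * g (\<eta> + w) * cnj (g \<eta>))"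
    by (rule lborel_pair.integrable_snd[OF int'])
  then show "integrable lborel (autocorr g)"
    unfolding autocorr_def[abs_def] by simp
  have "fourier_int (autocorr g) x = (LINT w|lborel. LINT \<eta>|lborel. ?e x w * g (\<eta> + w) * cnj (g \<eta>))"
    unfolding fourier_int_def autocorr_def by (simp add: mult.assoc)
  also have "\<dots> = (LINT \<eta>|lborel. LINT w|lborel. ?e x w * g (\<eta> + w) * cnj (g \<eta>))"
    by (rule lborel_pair.Fubini_integral[OF int'])
  also have "\<dots> = (LINT \<eta>|lborel. fourier_int g x * cnj (?e x \<eta> * g \<eta>))"
  proof (rule Bochner_Integration.integral_cong[OF refl])
    fix \<eta>
    have e: "?e x (w + \<eta>) * exp (- (\<i> * complex_of_real (x \<bullet> \<eta>))) = ?e x w" for w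
      by (simp add: inner_add_right exp_add[symmetric] algebra_simps)
    have "fourier_int g x = (LINT w|lborel. ?e x (w + \<eta>) * g (w + \<eta>))"
      unfolding fourier_int_def by (rule integral_lborel_shift[symmetric]) measurable
    then have "fourier_int g x * cnj (?e x \<eta> * g \<eta>) =
        (LINT w|lborel. ?e x (w + \<eta>) * g (w + \<eta>)) * (exp (- (\<i> * complex_of_real (x \<bullet> \<eta>))) * cnj (g \<eta>))"
      by (simp add: exp_cnj)
    also have "\<dots> = (LINT w|lborel. ?e x (w + \<eta>) * g (w + \<eta>) * (exp (- (\<i> * complex_of_real (x \<bullet> \<eta>))) * cnj (g \<eta>)))"
      by (rule integral_mult_left_zero[symmetric])
    also have "\<dots> = (LINT w|lborel. ?e x w * g (\<eta> + w) * cnj (g \<eta>))"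
    proof (rule Bochner_Integration.integral_cong[OF refl])
      fix w
      have "?e x (w + \<eta>) * g (w + \<eta>) * (exp (- (\<i> * complex_of_real (x \<bullet> \<eta>))) * cnj (g \<eta>)) =
         (?e x (w + \<eta>) * exp (- (\<i> * complex_of_real (x \<bullet> \<eta>)))) * g (w + \<eta>) * cnj (g \<eta>)"
        by (simp only: mult_ac)
      then show "?e x (w + \<eta>) * g (w + \<eta>) * (exp (- (\<i> * complex_of_real (x \<bullet> \<eta>))) * cnj (g \<eta>)) =
          ?e x w * g (\<eta> + w) * cnj (g \<eta>)"
        unfolding add.commute[of \<eta> w] by (simp only: e)
    qed
    finally show "(LINT w|lborel. ?e x w * g (\<eta> + w) * cnj (g \<eta>)) = fourier_int g x * cnj (?e x \<eta> * g \<eta>)"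
      by (rule sym)
  qed
  also have "\<dots> = fourier_int g x * cnj (fourier_int g x)"
    unfolding fourier_int_def by (simp del: complex_cnj_mult)
  also have "\<dots> = complex_of_real ((cmod (fourier_int g x))\<^sup>2)"
    by (rule complex_norm_square[symmetric])
  finally show "fourier_int (autocorr g) x = complex_of_real ((cmod (fourier_int g x))\<^sup>2)" .
qed

lemma autocorr_0: "autocorr g 0 = complex_of_real (L2sq g)"
proof -
  have "autocorr g 0 = (LINT x|lborel. complex_of_real ((cmod (g x))\<^sup>2))"
    unfolding autocorr_def by (intro Bochner_Integration.integral_cong refl) (simp only: complex_norm_square add_0_right)
  then show ?thesis by (simp only: integral_complex_of_real L2sq_def)
qed

lemma norm_autocorr_le:
  assumes "L2fun g" shows "cmod (autocorr g w) \<le> L2sq g"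
proof -
  have "cmod (autocorr g w) \<le> sqrt (L2sq (\<lambda>\<eta>. g (\<eta> + w))) * sqrt (L2sq (\<lambda>x. cnj (g x)))"
    unfolding autocorr_def by (intro L2_Cauchy_Schwarz L2fun_shift L2fun_cnj assms)
  also have "\<dots> = L2sq g" using L2fun_shift(2)[OF assms, of w] by (simp add: L2sq_def)
  finally show ?thesis .
qed

text \<open>Cauchy-Schwarz reduces continuity at 0 to mean continuity of translations in L^2; this
  is what makes the concentrating Gaussian averages in Plancherel's theorem converge.\<close>

lemma autocorr_tendsto:
  assumes g: "L2fun g" and z: "z \<longlonglongrightarrow> 0"
  shows "(\<lambda>k. autocorr g (z k)) \<longlonglongrightarrow> autocorr g 0"
proof -
  have le: "cmod (autocorr g (z k) - autocorr g 0) \<le> sqrt (L2sq (\<lambda>\<eta>. g (\<eta> + z k) - g \<eta>)) * sqrt (L2sq g)" for k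
  proof -
    have "autocorr g (z k) - autocorr g 0 = (LINT \<eta>|lborel. (g (\<eta> + z k) - g \<eta>) * cnj (g \<eta>))"
      unfolding autocorr_def
      using L2fun_mult_integrable[OF L2fun_shift(1)[OF g, of "z k"] L2fun_cnj[OF g]]
        L2fun_mult_integrable[OF g L2fun_cnj[OF g]] by (simp add: left_diff_distrib)
    also have "cmod \<dots> \<le> sqrt (L2sq (\<lambda>\<eta>. g (\<eta> + z k) - g \<eta>)) * sqrt (L2sq (\<lambda>\<eta>. cnj (g \<eta>)))"
      by (intro L2_Cauchy_Schwarz L2fun_shift L2fun_cnj L2fun_diff g)
    finally show ?thesis by (simp add: L2sq_def)
  qed
  have lim: "(\<lambda>k. sqrt (L2sq (\<lambda>\<eta>. g (\<eta> + z k) - g \<eta>)) * sqrt (L2sq g)) \<longlonglongrightarrow> 0"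
    using tendsto_mult_left_zero[OF tendsto_real_sqrt[OF L2_shift_continuous[OF g z], simplified]] .
  have "(\<lambda>k. autocorr g (z k) - autocorr g 0) \<longlonglongrightarrow> 0"
    by (rule Lim_null_comparison[OF _ lim]) (use le in auto)
  then show ?thesis by (simp add: LIM_zero_iff)
qed

text \<open>The damped integrals \<open>\<integral> \<bar>\<G>\<bar>\<^sup>2 exp (- \<epsilon> \<bar>x\<bar>\<^sup>2 / 2)\<close>, with \<open>\<G>\<close> the Fourier integral of \<open>g\<close>, are Gaussian
  averages of the autocorrelation of \<open>g\<close>, which concentrate at \<open>0\<close> as \<open>\<epsilon> \<rightarrow> 0\<close>.\<close>

theorem Plancherel:
  fixes g :: "'a::euclidean_space \<Rightarrow> complex"
  assumes g: "integrable lborel g" "L2fun g"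
  shows "L2fun (fourier_int g)" "L2sq (fourier_int g) = (2 * pi) ^ DIM('a) * L2sq g"
proof -
  have [measurable]: "g \<in> borel_measurable borel" using g by auto
  have [measurable]: "autocorr g \<in> borel_measurable borel" using integrable_autocorr[OF g(1)] by auto
  define \<epsilon> where "\<epsilon> n = 1 / real (Suc n)" for n
  have \<epsilon>: "\<epsilon> n > 0" for n by (simp add: \<epsilon>_def)
  have \<epsilon>0: "\<epsilon> \<longlonglongrightarrow> 0" unfolding \<epsilon>_def by (rule LIMSEQ_Suc[OF lim_1_over_n])
  let ?c = "(2 * pi) powr (DIM('a) / 2)"
  \<comment> \<open>The multiplication formula moves the damping onto the autocorrelation as a
    Gaussian of variance \<open>\<epsilon> n\<close>. Rescaling by
    \<open>sqrt (\<epsilon> n)\<close> fixes the Gaussian and leaves n only in the argument of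
    \<open>autocorr g\<close>.\<close>
  have id: "(LINT x|lborel. (cmod (fourier_int g x))\<^sup>2 * gauss (\<epsilon> n) x) =
      Re (LINT z|lborel. ?c * autocorr g (sqrt (\<epsilon> n) *\<^sub>R z) * gauss 1 z)" for n
  proof -
    have sc: "sqrt (\<epsilon> n) ^ DIM('a) * (2 * pi / \<epsilon> n) powr (DIM('a) / 2) = ?c"
      using \<epsilon>[of n] by (simp add: powr_half_sqrt[symmetric] powr_powr powr_realpow[symmetric] powr_mult[symmetric])
    have "complex_of_real (LINT x|lborel. (cmod (fourier_int g x))\<^sup>2 * gauss (\<epsilon> n) x) =
        (LINT x|lborel. fourier_int (autocorr g) x * complex_of_real (gauss (\<epsilon> n) x))"
      by (subst integral_complex_of_real[symmetric]) (simp add: fourier_int_autocorr[OF g(1)])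
    also have "\<dots> = (LINT w|lborel. autocorr g w * fourier_int (\<lambda>x. complex_of_real (gauss (\<epsilon> n) x)) w)"
      using integrable_gauss[OF \<epsilon>, where 'a='a]
      by (intro fourier_int_multiplication integrable_autocorr g) (auto intro: integrable_of_real)
    also have "\<dots> = (LINT w|lborel. autocorr g w * complex_of_real ((2 * pi / \<epsilon> n) powr (DIM('a) / 2) * gauss (1 / \<epsilon> n) w))"
      by (simp only: fourier_int_gauss[OF \<epsilon>])
    also have "\<dots> = (sqrt (\<epsilon> n)) ^ DIM('a) *\<^sub>R (LINT z|lborel. autocorr g (sqrt (\<epsilon> n) *\<^sub>R z) *
          complex_of_real ((2 * pi / \<epsilon> n) powr (DIM('a) / 2) * gauss (1 / \<epsilon> n) (sqrt (\<epsilon> n) *\<^sub>R z)))"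
      by (rule integral_lborel_scaleR(1)) (use \<epsilon> in auto)
    also have "\<dots> = (LINT z|lborel. ?c * autocorr g (sqrt (\<epsilon> n) *\<^sub>R z) * gauss 1 z)"
      using \<epsilon>[of n] less_imp_le[OF \<epsilon>[of n]] by (subst sc[symmetric])
        (simp add: gauss_scaleR scaleR_conv_of_real mult_ac flip: integral_mult_right_zero)
    finally show ?thesis by (metis Re_complex_of_real)
  qed
  have "(\<lambda>n. LINT z|lborel. ?c * autocorr g (sqrt (\<epsilon> n) *\<^sub>R z) * gauss 1 z) \<longlonglongrightarrow>
        (LINT z|lborel. ?c * autocorr g 0 * gauss 1 (z::'a))"
  proof (rule integral_dominated_convergence[where w="\<lambda>z. ?c * L2sq g * gauss 1 z"])
    show "integrable lborel (\<lambda>z::'a. ?c * L2sq g * gauss 1 z)"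
      using integrable_gauss[of 1, where 'a='a] by simp
    show "AE z in lborel. (\<lambda>n. ?c * autocorr g (sqrt (\<epsilon> n) *\<^sub>R z) * gauss 1 z) \<longlonglongrightarrow> ?c * autocorr g 0 * gauss 1 (z::'a)"
    proof (rule AE_I2)
      fix z :: 'a
      have "(\<lambda>n. sqrt (\<epsilon> n) *\<^sub>R z) \<longlonglongrightarrow> 0"
        using tendsto_scaleR[OF tendsto_real_sqrt[OF \<epsilon>0] tendsto_const[of z]] by simp
      then show "(\<lambda>n. ?c * autocorr g (sqrt (\<epsilon> n) *\<^sub>R z) * gauss 1 z) \<longlonglongrightarrow> ?c * autocorr g 0 * gauss 1 z"
        by (intro tendsto_intros autocorr_tendsto g)
    qed
    show "AE z in lborel. norm (?c * autocorr g (sqrt (\<epsilon> n) *\<^sub>R z) * gauss 1 z) \<le> ?c * L2sq g * gauss 1 (z::'a)" for n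
      by (intro AE_I2) (auto simp: norm_mult intro!: mult_left_mono mult_right_mono norm_autocorr_le g)
  qed measurable
  also have "(LINT z|lborel. ?c * autocorr g 0 * gauss 1 (z::'a)) = ?c * autocorr g 0 * ?c"
    using integral_gauss[of 1, where 'a='a] by simp
  also have "\<dots> = complex_of_real (?c * ?c * L2sq g)"
    by (simp add: autocorr_0)
  also have "?c * ?c = (2 * pi) ^ DIM('a)"
    by (simp add: powr_add[symmetric] powr_realpow)
  finally have "(\<lambda>n. Re (LINT z|lborel. ?c * autocorr g (sqrt (\<epsilon> n) *\<^sub>R z) * gauss 1 z))
      \<longlonglongrightarrow> Re (complex_of_real ((2 * pi) ^ DIM('a) * L2sq g))"
    by (rule tendsto_Re)
  then have lim: "(\<lambda>n. LINT x|lborel. (cmod (fourier_int g x))\<^sup>2 * gauss (\<epsilon> n) x) \<longlonglongrightarrow> (2 * pi) ^ DIM('a) * L2sq g"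
    by (simp add: id)
  let ?B = "LINT \<xi>|lborel. cmod (g \<xi>)"
  have i: "integrable lborel (\<lambda>x. (cmod (fourier_int g x))\<^sup>2 * gauss (\<epsilon> n) x)" for n
  proof (rule Bochner_Integration.integrable_bound)
    show "integrable lborel (\<lambda>x::'a. ?B\<^sup>2 * gauss (\<epsilon> n) x)"
      using integrable_gauss[OF \<epsilon>, where 'a='a] by simp
    show "AE x in lborel. norm ((cmod (fourier_int g x))\<^sup>2 * gauss (\<epsilon> n) x) \<le> norm (?B\<^sup>2 * gauss (\<epsilon> n) x)"
      by (intro AE_I2) (auto simp: abs_mult intro!: mult_right_mono power_mono norm_fourier_int_le)
  qed measurable
  \<comment> \<open>Integrability of the undamped square is not known beforehand; monotone
    convergence delivers it together with the value.\<close>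
  have mono: "AE x in lborel. mono (\<lambda>n. (cmod (fourier_int g x))\<^sup>2 * gauss (\<epsilon> n) x)"
  proof (intro AE_I2 monoI mult_left_mono)
    fix x :: 'a and m n :: nat assume "m \<le> n"
    then have "\<epsilon> n \<le> \<epsilon> m" by (simp add: \<epsilon>_def frac_le)
    then show "gauss (\<epsilon> m) x \<le> gauss (\<epsilon> n) x"
      by (auto simp: gauss_def intro!: mult_right_mono divide_right_mono)
  qed simp
  have ptw: "AE x in lborel. (\<lambda>n. (cmod (fourier_int g x))\<^sup>2 * gauss (\<epsilon> n) x) \<longlonglongrightarrow> (cmod (fourier_int g x))\<^sup>2"
  proof (rule AE_I2)
    fix x :: 'a
    have "(\<lambda>n. (cmod (fourier_int g x))\<^sup>2 * gauss (\<epsilon> n) x) \<longlonglongrightarrow> (cmod (fourier_int g x))\<^sup>2 * exp (- (0 * (norm x)\<^sup>2 / 2))"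
      unfolding gauss_def by (intro tendsto_intros \<epsilon>0) auto
    then show "(\<lambda>n. (cmod (fourier_int g x))\<^sup>2 * gauss (\<epsilon> n) x) \<longlonglongrightarrow> (cmod (fourier_int g x))\<^sup>2" by simp
  qed
  have m: "(\<lambda>x. (cmod (fourier_int g x))\<^sup>2) \<in> borel_measurable lborel" by measurable
  show "L2fun (fourier_int g)"
    unfolding L2fun_def using integrable_monotone_convergence[OF i mono ptw lim m] by simp
  show "L2sq (fourier_int g) = (2 * pi) ^ DIM('a) * L2sq g"
    unfolding L2sq_def using integral_monotone_convergence[OF i mono ptw lim m] by (simp add: L2sq_def)
qed

lemma L2_polarization:
  assumes a: "L2fun a" and b: "L2fun b"
  shows "4 * (LINT x|lborel. a x * cnj (b x)) =
    complex_of_real (L2sq (\<lambda>x. a x + b x)) - complex_of_real (L2sq (\<lambda>x. a x - b x))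
    + \<i> * complex_of_real (L2sq (\<lambda>x. a x + \<i> * b x)) - \<i> * complex_of_real (L2sq (\<lambda>x. a x - \<i> * b x))"
proof -
  have i: "integrable lborel (\<lambda>x. complex_of_real ((cmod (f x))\<^sup>2))" if "L2fun f" for f :: "'a \<Rightarrow> complex"
    using L2fun_integrable[OF that] by (rule integrable_of_real)
  have L: "L2fun (\<lambda>x. a x + b x)" "L2fun (\<lambda>x. a x - b x)" "L2fun (\<lambda>x. a x + \<i> * b x)" "L2fun (\<lambda>x. a x - \<i> * b x)"
    using a b by (auto intro!: L2fun_add L2fun_diff L2fun_cmult)
  have sq: "complex_of_real (L2sq f) = (LINT x|lborel. complex_of_real ((cmod (f x))\<^sup>2))" for f :: "'a \<Rightarrow> complex"
    unfolding L2sq_def by (simp only: integral_complex_of_real)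
  have pt: "4 * (z * cnj w) = complex_of_real ((cmod (z + w))\<^sup>2) - complex_of_real ((cmod (z - w))\<^sup>2)
     + \<i> * complex_of_real ((cmod (z + \<i> * w))\<^sup>2) - \<i> * complex_of_real ((cmod (z - \<i> * w))\<^sup>2)" for z w
    unfolding cmod_power2 by (simp add: complex_eq_iff power2_eq_square algebra_simps)
  have "4 * (LINT x|lborel. a x * cnj (b x)) = (LINT x|lborel. 4 * (a x * cnj (b x)))"
    by simp
  also have "\<dots> = complex_of_real (L2sq (\<lambda>x. a x + b x)) - complex_of_real (L2sq (\<lambda>x. a x - b x))
    + \<i> * complex_of_real (L2sq (\<lambda>x. a x + \<i> * b x)) - \<i> * complex_of_real (L2sq (\<lambda>x. a x - \<i> * b x))"
    unfolding pt sq using i[OF L(1)] i[OF L(2)] i[OF L(3)] i[OF L(4)] by (simp del: of_real_power)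
  finally show ?thesis .
qed

lemma Plancherel_inner:
  fixes u v :: "'a::euclidean_space \<Rightarrow> complex"
  assumes u: "integrable lborel u" "L2fun u" and v: "integrable lborel v" "L2fun v"
  shows "(LINT x|lborel. fourier_int u x * cnj (fourier_int v x)) = (2 * pi) ^ DIM('a) * (LINT x|lborel. u x * cnj (v x))"
proof -
  have iv: "integrable lborel (\<lambda>x. \<i> * v x)" "L2fun (\<lambda>x. \<i> * v x)" using v by (auto intro: L2fun_cmult)
  note P = Plancherel(2)[OF Bochner_Integration.integrable_add[OF u(1) v(1)] L2fun_add[OF u(2) v(2)]]
    Plancherel(2)[OF Bochner_Integration.integrable_diff[OF u(1) v(1)] L2fun_diff[OF u(2) v(2)]]
    Plancherel(2)[OF Bochner_Integration.integrable_add[OF u(1) iv(1)] L2fun_add[OF u(2) iv(2)]]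
    Plancherel(2)[OF Bochner_Integration.integrable_diff[OF u(1) iv(1)] L2fun_diff[OF u(2) iv(2)]]
  have "4 * (LINT x|lborel. fourier_int u x * cnj (fourier_int v x)) =
      (2 * pi) ^ DIM('a) * (4 * (LINT x|lborel. u x * cnj (v x)))"
    unfolding L2_polarization[OF Plancherel(1)[OF u] Plancherel(1)[OF v]] L2_polarization[OF u(2) v(2)]
    using P unfolding fourier_int_add[OF u(1) v(1)] fourier_int_diff[OF u(1) v(1)]
      fourier_int_add[OF u(1) iv(1)] fourier_int_diff[OF u(1) iv(1)] fourier_int_cmult
    by (simp add: algebra_simps)
  then show ?thesis by simp
qed


section \<open>The Fourier transform on square-integrable functions\<close>

definition fourier_const :: "'a::euclidean_space itself \<Rightarrow> real" where
  "fourier_const _ = (2 * pi) powr (- real DIM('a) / 2)"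

lemma fourier_const_sq: "fourier_const TYPE('a::euclidean_space) * fourier_const TYPE('a) * (2 * pi) ^ DIM('a) = 1"
proof -
  have "fourier_const TYPE('a) * fourier_const TYPE('a) = (2 * pi) powr (- real DIM('a))"
    unfolding fourier_const_def by (subst powr_add[symmetric]) simp
  moreover have "(2 * pi) ^ DIM('a) = (2 * pi) powr real DIM('a)"
    by (rule powr_realpow[symmetric]) simp
  moreover have "(2 * pi) powr (- real DIM('a)) * (2 * pi) powr real DIM('a) = 1"
    by (subst powr_add[symmetric]) simp
  ultimately show ?thesis by simp
qed

lemma fourier_L1_eq: "fourier_L1 g x = complex_of_real (fourier_const TYPE('a)) * fourier_int g (- x :: 'a::euclidean_space)"
  by (simp add: fourier_const_def fourier_L1_eq_fourier_int)

lemma integral_lborel_uminus: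
  fixes f :: "'a::euclidean_space \<Rightarrow> 'b::{banach,second_countable_topology}"
  assumes "f \<in> borel_measurable borel"
  shows "(LINT x|lborel. f (- x)) = (LINT x|lborel. f x)"
    and "integrable lborel (\<lambda>x. f (- x)) \<longleftrightarrow> integrable lborel f"
  using integral_lborel_preserving[OF lborel_distr_uminus_euclidean _ assms]
    integrable_lborel_preserving[OF lborel_distr_uminus_euclidean _ assms] by auto

lemma L2fun_uminus:
  assumes "L2fun g" shows "L2fun (\<lambda>x. g (- x))"
proof -
  have [measurable]: "g \<in> borel_measurable borel" using L2fun_measurable[OF assms] by simp
  show ?thesis
    using assms integral_lborel_uminus(2)[of "\<lambda>x. (cmod (g x))\<^sup>2"] by (auto simp: L2fun_def)
qed

lemma cnj_fourier_int: "cnj (fourier_int u x) = fourier_int (\<lambda>\<xi>. cnj (u \<xi>)) (- x)"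
  unfolding fourier_int_def Bochner_Integration.integral_cnj[symmetric] by (simp add: exp_cnj)

lemma cnj_fourier_L1:
  fixes g :: "'a::euclidean_space \<Rightarrow> complex"
  assumes [measurable]: "g \<in> borel_measurable borel"
  shows "cnj (fourier_L1 g x) = fourier_L1 (\<lambda>\<xi>. cnj (g (- \<xi>))) x"
proof -
  have "fourier_int (\<lambda>\<xi>. cnj (g \<xi>)) x = fourier_int (\<lambda>\<xi>. cnj (g (- \<xi>))) (- x)"
    unfolding fourier_int_def
    using integral_lborel_uminus(1)[of "\<lambda>\<xi>. iexp (x \<bullet> \<xi>) * cnj (g \<xi>)"] by simp
  then show ?thesis by (simp add: fourier_L1_eq cnj_fourier_int)
qed

lemma L2fun_fourier_L1:
  assumes "integrable lborel g" "L2fun g" shows "L2fun (fourier_L1 g)"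
  unfolding fourier_L1_eq[abs_def]
  by (intro L2fun_cmult L2fun_uminus Plancherel assms)

lemma ball_in_borel [measurable]: "ball (a::'a::euclidean_space) r \<in> sets borel"
  by simp

lemma integrable_indicator_mult_L2:
  fixes F :: "'a::euclidean_space \<Rightarrow> complex"
  assumes "L2fun F" shows "integrable lborel (\<lambda>x. indicator (ball 0 R) x * F x)" "L2fun (\<lambda>x. indicator (ball 0 R) x * F x)"
proof -
  have "integrable lborel (\<lambda>x. (cmod (indicator (ball 0 R :: 'a set) x))\<^sup>2)"
  proof -
    have "(cmod (indicator (ball 0 R :: 'a set) x))\<^sup>2 = indicat_real (ball 0 R) x" for x by (simp add: indicator_def)
    then show ?thesis
      using emeasure_lborel_ball_finite[of "0::'a" R] by (simp add: integrable_indicator_iff)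
  qed
  then have "L2fun (indicator (ball 0 R :: 'a set) :: 'a \<Rightarrow> complex)" by (simp add: L2fun_def)
  then show "integrable lborel (\<lambda>x. indicator (ball 0 R) x * F x)"
    by (rule L2fun_mult_integrable[OF _ assms])
  show "L2fun (\<lambda>x. indicator (ball 0 R) x * F x)"
    by (rule L2fun_mult_bounded[OF assms, of _ 1]) (auto simp: indicator_def)
qed

text \<open>The natural test function is the conjugate of \<open>F\<close>, but it need not be
  integrable; truncating it to balls makes it admissible.\<close>

lemma L2fun_eq_0_if_orthogonal:
  fixes F :: "'a::euclidean_space \<Rightarrow> complex"
  assumes F: "L2fun F" and z: "\<And>g. integrable lborel g \<Longrightarrow> L2fun g \<Longrightarrow> (LINT \<xi>|lborel. F \<xi> * g \<xi>) = 0"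
  shows "AE \<xi> in lborel. F \<xi> = 0"
proof -
  have [measurable]: "F \<in> borel_measurable borel" using L2fun_measurable[OF F] by simp
  have "AE \<xi> in lborel. indicat_real (ball 0 (real n)) \<xi> * (cmod (F \<xi>))\<^sup>2 = 0" for n
  proof -
    have "(LINT \<xi>|lborel. F \<xi> * (indicator (ball 0 (real n)) \<xi> * cnj (F \<xi>))) = 0"
      by (intro z integrable_indicator_mult_L2 L2fun_cnj F)
    also have "(\<lambda>\<xi>. F \<xi> * (indicator (ball 0 (real n)) \<xi> * cnj (F \<xi>))) =
       (\<lambda>\<xi>. complex_of_real (indicat_real (ball 0 (real n)) \<xi> * (cmod (F \<xi>))\<^sup>2))"
      unfolding of_real_mult complex_norm_square by (auto simp: indicator_def fun_eq_iff)
    finally have "(LINT \<xi>|lborel. indicat_real (ball 0 (real n)) \<xi> * (cmod (F \<xi>))\<^sup>2) = 0"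
      unfolding integral_complex_of_real by (simp only: of_real_eq_0_iff)
    moreover have "integrable lborel (\<lambda>\<xi>. indicat_real (ball 0 (real n)) \<xi> * (cmod (F \<xi>))\<^sup>2)"
      by (rule Bochner_Integration.integrable_bound[OF L2fun_integrable[OF F]]) (auto simp: indicator_def)
    ultimately show ?thesis
      by (subst (asm) integral_nonneg_eq_0_iff_AE) auto
  qed
  then have "AE \<xi> in lborel. \<forall>n. indicat_real (ball 0 (real n)) \<xi> * (cmod (F \<xi>))\<^sup>2 = 0"
    unfolding AE_all_countable by blast
  then show ?thesis
  proof eventually_elim
    case (elim \<xi>)
    obtain n where "norm \<xi> < real n" using reals_Archimedean2 by blast
    with elim[rule_format, of n] show "F \<xi> = 0" by (simp add: indicator_def)
  qed
qed

lemma is_fourier_L2_unique: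
  assumes "is_fourier_L2 f F" "is_fourier_L2 f G"
  shows "AE \<xi> in lborel. F \<xi> = G \<xi>"
proof -
  have F: "L2fun F" and G: "L2fun G" using assms by (auto simp: is_fourier_L2_def)
  have "AE \<xi> in lborel. F \<xi> - G \<xi> = 0"
  proof (rule L2fun_eq_0_if_orthogonal[OF L2fun_diff[OF F G]])
    fix g :: "'a \<Rightarrow> complex" assume g: "integrable lborel g" "L2fun g"
    have "(LINT \<xi>|lborel. (F \<xi> - G \<xi>) * g \<xi>) = (LINT \<xi>|lborel. F \<xi> * g \<xi>) - (LINT \<xi>|lborel. G \<xi> * g \<xi>)"
      using L2fun_mult_integrable[OF F g(2)] L2fun_mult_integrable[OF G g(2)] by (simp add: left_diff_distrib)
    also have "\<dots> = 0" using assms g by (simp add: is_fourier_L2_def)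
    finally show "(LINT \<xi>|lborel. (F \<xi> - G \<xi>) * g \<xi>) = 0" .
  qed
  then show ?thesis by simp
qed

lemma is_fourier_L2_diff:
  assumes "is_fourier_L2 f F" "is_fourier_L2 h H" "L2fun f" "L2fun h"
  shows "is_fourier_L2 (\<lambda>x. f x - h x) (\<lambda>\<xi>. F \<xi> - H \<xi>)"
  unfolding is_fourier_L2_def
proof (intro conjI allI impI)
  have F: "L2fun F" and H: "L2fun H" using assms by (auto simp: is_fourier_L2_def)
  show "L2fun (\<lambda>\<xi>. F \<xi> - H \<xi>)" by (rule L2fun_diff[OF F H])
  fix g :: "'a \<Rightarrow> complex" assume "integrable lborel g \<and> L2fun g"
  then have g: "integrable lborel g" "L2fun g" by auto
  note ft = L2fun_fourier_L1[OF g]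
  show "(LINT \<xi>|lborel. (F \<xi> - H \<xi>) * g \<xi>) = (LINT x|lborel. (f x - h x) * fourier_L1 g x)"
    using L2fun_mult_integrable[OF F g(2)] L2fun_mult_integrable[OF H g(2)]
      L2fun_mult_integrable[OF assms(3) ft] L2fun_mult_integrable[OF assms(4) ft] assms(1,2) g
    by (simp add: left_diff_distrib is_fourier_L2_def)
qed

text \<open>For real \<open>f\<close> this becomes the Hermitian symmetry of the spectrum, the
  property by which a limit of spectra is recognised as that of a real function.\<close>

lemma is_fourier_L2_cnj:
  fixes f :: "'a::euclidean_space \<Rightarrow> complex"
  assumes "is_fourier_L2 f F"
  shows "is_fourier_L2 (\<lambda>x. cnj (f x)) (\<lambda>\<xi>. cnj (F (- \<xi>)))"
  unfolding is_fourier_L2_def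
proof (intro conjI allI impI)
  have F: "L2fun F" using assms by (auto simp: is_fourier_L2_def)
  then have [measurable]: "F \<in> borel_measurable borel" using L2fun_measurable[OF F] by simp
  show "L2fun (\<lambda>\<xi>. cnj (F (- \<xi>)))" by (intro L2fun_cnj L2fun_uminus F)
  fix g :: "'a \<Rightarrow> complex" assume "integrable lborel g \<and> L2fun g"
  then have g: "integrable lborel g" "L2fun g" by auto
  have [measurable]: "g \<in> borel_measurable borel" using g by auto
  let ?h = "\<lambda>\<xi>. cnj (g (- \<xi>))"
  have h: "integrable lborel ?h" "L2fun ?h"
    using g integral_lborel_uminus(2)[of g] by (auto intro!: integrable_cnj L2fun_cnj L2fun_uminus)
  have "(LINT \<xi>|lborel. cnj (F (- \<xi>)) * g \<xi>) = (LINT \<xi>|lborel. cnj (F \<xi>) * g (- \<xi>))"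
    using integral_lborel_uminus(1)[of "\<lambda>\<xi>. cnj (F \<xi>) * g (- \<xi>)"] by simp
  also have "\<dots> = cnj (LINT \<xi>|lborel. F \<xi> * ?h \<xi>)"
    unfolding Bochner_Integration.integral_cnj[symmetric] by simp
  also have "\<dots> = cnj (LINT x|lborel. f x * fourier_L1 ?h x)"
    using assms h by (simp add: is_fourier_L2_def)
  also have "\<dots> = (LINT x|lborel. cnj (f x) * fourier_L1 g x)"
    unfolding Bochner_Integration.integral_cnj[symmetric] complex_cnj_mult cnj_fourier_L1[of g, symmetric, OF \<open>g \<in> borel_measurable borel\<close>]
    by simp
  finally show "(LINT \<xi>|lborel. cnj (F (- \<xi>)) * g \<xi>) = (LINT x|lborel. cnj (f x) * fourier_L1 g x)" .
qed

text \<open>Orthogonal maps preserve both Lebesgue measure and the inner product in the exponent.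
  For radial \<open>f\<close> the left function is \<open>f\<close> again, so uniqueness makes its
  spectrum invariant.\<close>

lemma is_fourier_L2_orthogonal:
  fixes f :: "'a::euclidean_space \<Rightarrow> complex" and T :: "'a \<Rightarrow> 'a"
  assumes T: "orthogonal_transformation T" and f: "is_fourier_L2 f F" "f \<in> borel_measurable borel"
  shows "is_fourier_L2 (\<lambda>x. f (T x)) (\<lambda>\<xi>. F (T \<xi>))"
  unfolding is_fourier_L2_def
proof (intro conjI allI impI)
  have F: "L2fun F" using f by (auto simp: is_fourier_L2_def)
  have meas: "R \<in> borel \<rightarrow>\<^sub>M borel" if "orthogonal_transformation R" for R :: "'a \<Rightarrow> 'a"
    using linear_continuous_on[of R UNIV] that
    by (simp add: linear_conv_bounded_linear borel_measurable_continuous_onI orthogonal_transformation_def)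
  define T' where "T' = inv T"
  have T': "orthogonal_transformation T'"
    unfolding T'_def by (rule orthogonal_transformation_inv[OF T])
  have inv: "T' (T x) = x" "T (T' x) = x" for x
    using orthogonal_transformation_inj[OF T] orthogonal_transformation_surj[OF T]
    by (auto simp: T'_def surj_f_inv_f)
  note [measurable] = meas[OF T] meas[OF T'] f(2) L2fun_measurable[OF F, simplified]
  note pres = lborel_distr_orthogonal[OF T] meas[OF T]
  note pres' = lborel_distr_orthogonal[OF T'] meas[OF T']
  show "L2fun (\<lambda>\<xi>. F (T \<xi>))"
    using F integrable_lborel_preserving[OF pres, of "\<lambda>x. (cmod (F x))\<^sup>2"] by (simp add: L2fun_def)
  fix g :: "'a \<Rightarrow> complex" assume "integrable lborel g \<and> L2fun g"
  then have g: "integrable lborel g" "L2fun g" by auto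
  have [measurable]: "g \<in> borel_measurable borel" using g by auto
  have h: "integrable lborel (\<lambda>\<xi>. g (T' \<xi>))" "L2fun (\<lambda>\<xi>. g (T' \<xi>))"
    using g integrable_lborel_preserving[OF pres', of g] integrable_lborel_preserving[OF pres', of "\<lambda>x. (cmod (g x))\<^sup>2"]
    by (auto simp: L2fun_def)
  have ft: "fourier_L1 (\<lambda>\<xi>. g (T' \<xi>)) (T x) = fourier_L1 g x" for x
  proof -
    have "x \<bullet> T' \<xi> = T x \<bullet> \<xi>" for \<xi>
      using T inv(2)[of \<xi>] by (metis orthogonal_transformation_def)
    then have "fourier_int (\<lambda>\<xi>. g (T' \<xi>)) (- T x) = (LINT \<xi>|lborel. iexp (- x \<bullet> T' \<xi>) * g (T' \<xi>))"
      unfolding fourier_int_def by simp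
    also have "\<dots> = fourier_int g (- x)"
      unfolding fourier_int_def
      using integral_lborel_preserving[OF pres', of "\<lambda>\<xi>. iexp (- x \<bullet> \<xi>) * g \<xi>"] by simp
    finally show ?thesis by (simp add: fourier_L1_eq)
  qed
  have [measurable]: "fourier_L1 (\<lambda>\<xi>. g (T' \<xi>)) \<in> borel_measurable borel"
    unfolding fourier_L1_eq[abs_def] by measurable
  have "(LINT \<xi>|lborel. F (T \<xi>) * g \<xi>) = (LINT \<xi>|lborel. F \<xi> * g (T' \<xi>))"
    using integral_lborel_preserving[OF pres, of "\<lambda>\<xi>. F \<xi> * g (T' \<xi>)"] by (simp add: inv)
  also have "\<dots> = (LINT x|lborel. f x * fourier_L1 (\<lambda>\<xi>. g (T' \<xi>)) x)"
    using f(1) h by (simp add: is_fourier_L2_def)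
  also have "\<dots> = (LINT x|lborel. f (T x) * fourier_L1 g x)"
    using integral_lborel_preserving[OF pres, of "\<lambda>x. f x * fourier_L1 (\<lambda>\<xi>. g (T' \<xi>)) x"] by (simp add: ft)
  finally show "(LINT \<xi>|lborel. F (T \<xi>) * g \<xi>) = (LINT x|lborel. f (T x) * fourier_L1 g x)" .
qed

lemma L2_inner_tendsto:
  assumes f: "\<And>k. L2fun (f k)" "L2fun h" "(\<lambda>k. L2sq (\<lambda>x. f k x - h x)) \<longlonglongrightarrow> 0" and g: "L2fun g"
  shows "(\<lambda>k. LINT x|lborel. f k x * g x) \<longlonglongrightarrow> (LINT x|lborel. h x * g x)"
proof -
  have le: "cmod ((LINT x|lborel. f k x * g x) - (LINT x|lborel. h x * g x)) \<le> sqrt (L2sq (\<lambda>x. f k x - h x)) * sqrt (L2sq g)" for k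
    using L2_Cauchy_Schwarz[OF L2fun_diff[OF f(1)[of k] f(2)] g] L2fun_mult_integrable[OF f(1)[of k] g] L2fun_mult_integrable[OF f(2) g]
    by (simp add: left_diff_distrib)
  have lim: "(\<lambda>k. sqrt (L2sq (\<lambda>x. f k x - h x)) * sqrt (L2sq g)) \<longlonglongrightarrow> 0"
    using tendsto_mult_left_zero[OF tendsto_real_sqrt[OF f(3), simplified]] .
  have "(\<lambda>k. (LINT x|lborel. f k x * g x) - (LINT x|lborel. h x * g x)) \<longlonglongrightarrow> 0"
    by (rule Lim_null_comparison[OF _ lim]) (use le in auto)
  then show ?thesis by (simp add: LIM_zero_iff)
qed

lemma L2_truncation_tendsto:
  fixes F :: "'a::euclidean_space \<Rightarrow> complex"
  assumes F: "L2fun F"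
  shows "(\<lambda>k. L2sq (\<lambda>x. indicator (ball 0 (real k)) x * F x - F x)) \<longlonglongrightarrow> 0"
proof -
  have [measurable]: "F \<in> borel_measurable borel" using L2fun_measurable[OF F] by simp
  have "(\<lambda>k. LINT x|lborel. (cmod (indicator (ball 0 (real k)) x * F x - F x))\<^sup>2) \<longlonglongrightarrow> (LINT x|(lborel::'a measure). 0)"
  proof (rule integral_dominated_convergence[OF _ _ L2fun_integrable[OF F]])
    show "AE x in lborel. (\<lambda>k. (cmod (indicator (ball 0 (real k)) x * F x - F x))\<^sup>2) \<longlonglongrightarrow> 0"
    proof (rule AE_I2)
      fix x :: 'a
      obtain n where n: "norm x < real n" using reals_Archimedean2 by blast
      have "eventually (\<lambda>k. (cmod (indicator (ball 0 (real k)) x * F x - F x))\<^sup>2 = 0) sequentially"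
        using n by (intro eventually_sequentiallyI[of n]) (auto simp: indicator_def)
      then show "(\<lambda>k. (cmod (indicator (ball 0 (real k)) x * F x - F x))\<^sup>2) \<longlonglongrightarrow> 0"
        by (rule tendsto_eventually)
    qed
    show "AE x in lborel. norm ((cmod (indicator (ball 0 (real k)) x * F x - F x))\<^sup>2) \<le> (cmod (F x))\<^sup>2" for k
      by (intro AE_I2) (auto simp: indicator_def)
  qed auto
  then show ?thesis by (simp add: L2sq_def)
qed

text \<open>Since \<open>fourier_L1 g\<close> is a conjugated Fourier integral of the conjugate of
  \<open>g\<close>, the multiplication formula is Plancherel's identity for inner products, and
  \<open>fourier_const\<close> is exactly what cancels its factor.\<close>

lemma is_fourier_L2_fourier_int:
  fixes F :: "'a::euclidean_space \<Rightarrow> complex"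
  assumes F: "integrable lborel F" "L2fun F"
  shows "is_fourier_L2 (\<lambda>x. complex_of_real (fourier_const TYPE('a)) * fourier_int F x) F"
  unfolding is_fourier_L2_def
proof (intro conjI allI impI F)
  let ?c = "complex_of_real (fourier_const TYPE('a))"
  fix g :: "'a \<Rightarrow> complex" assume "integrable lborel g \<and> L2fun g"
  then have g: "integrable lborel g" "L2fun g" by auto
  have "(LINT x|lborel. ?c * fourier_int F x * fourier_L1 g x) =
      (LINT x|lborel. ?c * ?c * (fourier_int F x * cnj (fourier_int (\<lambda>\<xi>. cnj (g \<xi>)) x)))"
    by (simp add: fourier_L1_eq cnj_fourier_int mult_ac)
  also have "\<dots> = ?c * ?c * (2 * pi) ^ DIM('a) * (LINT \<xi>|lborel. F \<xi> * g \<xi>)"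
    using Plancherel_inner[OF F integrable_cnj[OF g(1)] L2fun_cnj[OF g(2)]] by simp
  also have "?c * ?c * (2 * pi) ^ DIM('a) = 1"
    using arg_cong[OF fourier_const_sq[where 'a='a], of complex_of_real] by simp
  finally show "(LINT \<xi>|lborel. F \<xi> * g \<xi>) = (LINT x|lborel. ?c * fourier_int F x * fourier_L1 g x)" by simp
qed

text \<open>Surjectivity of the transform, needed to realise the limiting spectrum by a function.
  Truncations of \<open>F\<close> to balls have explicit preimages, and Plancherel turns their
  convergence into a Cauchy sequence of preimages.\<close>

theorem is_fourier_L2_exists:
  fixes F :: "'a::euclidean_space \<Rightarrow> complex"
  assumes F: "L2fun F"
  obtains f where "L2fun f" "is_fourier_L2 f F"
proof -
  let ?c = "complex_of_real (fourier_const TYPE('a))"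
  define Fk where "Fk k x = indicator (ball 0 (real k)) x * F x" for k :: nat and x
  define f where "f k x = ?c * fourier_int (Fk k) x" for k x
  have Fk: "integrable lborel (Fk k)" "L2fun (Fk k)" for k
    unfolding Fk_def[abs_def] by (rule integrable_indicator_mult_L2[OF F])+
  have fk: "L2fun (f k)" for k
    unfolding f_def[abs_def] by (intro L2fun_cmult Plancherel Fk)
  have lim: "(\<lambda>k. L2sq (\<lambda>x. Fk k x - F x)) \<longlonglongrightarrow> 0"
    unfolding Fk_def by (rule L2_truncation_tendsto[OF F])
  have iso: "L2sq (\<lambda>x. f m x - f n x) = L2sq (\<lambda>x. Fk m x - Fk n x)" for m n
  proof -
    have "L2sq (\<lambda>x. f m x - f n x) = L2sq (\<lambda>x. ?c * fourier_int (\<lambda>\<xi>. Fk m \<xi> - Fk n \<xi>) x)"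
      unfolding fourier_int_diff[OF Fk(1) Fk(1)] f_def by (simp add: right_diff_distrib)
    also have "\<dots> = (fourier_const TYPE('a))\<^sup>2 * L2sq (fourier_int (\<lambda>\<xi>. Fk m \<xi> - Fk n \<xi>))"
      unfolding L2sq_def by (simp add: norm_mult power_mult_distrib)
    also have "\<dots> = fourier_const TYPE('a) * fourier_const TYPE('a) * (2 * pi) ^ DIM('a) * L2sq (\<lambda>\<xi>. Fk m \<xi> - Fk n \<xi>)"
      by (subst Plancherel(2)) (auto intro: Fk L2fun_diff simp: power2_eq_square)
    finally show ?thesis by (simp only: fourier_const_sq mult_1_left)
  qed
  have "\<exists>N. \<forall>m\<ge>N. \<forall>n\<ge>N. L2sq (\<lambda>x. f m x - f n x) \<le> e" if e: "e > 0" for e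
  proof -
    obtain N where N: "\<And>k. k \<ge> N \<Longrightarrow> norm (L2sq (\<lambda>x. Fk k x - F x) - 0) < e / 4"
      using LIMSEQ_D[OF lim, of "e/4"] e by auto
    have "L2sq (\<lambda>x. f m x - f n x) \<le> e" if "m \<ge> N" "n \<ge> N" for m n
      using L2sq_diff_triangle[OF Fk(2)[of m] F Fk(2)[of n]] N[OF that(1)] N[OF that(2)]
      by (simp add: iso L2sq_commute[of F])
    then show ?thesis by blast
  qed
  then obtain h \<sigma> where h: "L2fun h" "(\<lambda>k. L2sq (\<lambda>x. f k x - h x)) \<longlonglongrightarrow> 0"
    using L2_complete[of f, OF fk] by blast
  show ?thesis
  proof (rule that[OF h(1)])
    show "is_fourier_L2 h F" unfolding is_fourier_L2_def
    proof (intro conjI allI impI F)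
      fix g :: "'a \<Rightarrow> complex" assume "integrable lborel g \<and> L2fun g"
      then have g: "integrable lborel g" "L2fun g" by auto
      have eq: "(LINT \<xi>|lborel. Fk k \<xi> * g \<xi>) = (LINT x|lborel. f k x * fourier_L1 g x)" for k
        using is_fourier_L2_fourier_int[OF Fk] g by (simp add: is_fourier_L2_def f_def)
      have 1: "(\<lambda>k. LINT \<xi>|lborel. Fk k \<xi> * g \<xi>) \<longlonglongrightarrow> (LINT \<xi>|lborel. F \<xi> * g \<xi>)"
        by (rule L2_inner_tendsto[OF Fk(2) F lim g(2)])
      have 2: "(\<lambda>k. LINT x|lborel. f k x * fourier_L1 g x) \<longlonglongrightarrow> (LINT x|lborel. h x * fourier_L1 g x)"
        by (rule L2_inner_tendsto[OF fk h L2fun_fourier_L1[OF g]])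
      show "(LINT \<xi>|lborel. F \<xi> * g \<xi>) = (LINT x|lborel. h x * fourier_L1 g x)"
        using LIMSEQ_unique[OF 1[unfolded eq] 2] .
    qed
  qed
qed

text \<open>The conjugate of a preimage has spectrum \<open>cnj (F (- \<xi>))\<close>, which agrees
  with \<open>F\<close> almost everywhere. Hence the average of the two, the real part, is a
  preimage as well.\<close>

lemma is_fourier_L2_exists_real:
  fixes F :: "'a::euclidean_space \<Rightarrow> complex"
  assumes F: "L2fun F" and sym: "AE \<xi> in lborel. cnj (F (- \<xi>)) = F \<xi>"
  obtains \<phi> :: "'a \<Rightarrow> real" where "L2fun (\<lambda>x. complex_of_real (\<phi> x))" "is_fourier_L2 (\<lambda>x. complex_of_real (\<phi> x)) F"
proof -
  obtain f where f: "L2fun f" "is_fourier_L2 f F" using is_fourier_L2_exists[OF F] .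
  have [measurable]: "F \<in> borel_measurable borel" using L2fun_measurable[OF F] by simp
  note fc = is_fourier_L2_cnj[OF f(2)]
  show ?thesis
  proof (rule that)
    have re: "complex_of_real (Re (f x)) = (1/2) * (f x + cnj (f x))" for x by (simp add: complex_eq_iff)
    show "L2fun (\<lambda>x. complex_of_real (Re (f x)))"
      unfolding re by (intro L2fun_cmult L2fun_add L2fun_cnj f)
    show "is_fourier_L2 (\<lambda>x. complex_of_real (Re (f x))) F"
      unfolding is_fourier_L2_def
    proof (intro conjI allI impI F)
      fix g :: "'a \<Rightarrow> complex" assume "integrable lborel g \<and> L2fun g"
      then have g: "integrable lborel g" "L2fun g" by auto
      note [measurable] = L2fun_measurable[OF g(2), simplified]
      note ft = L2fun_fourier_L1[OF g]
      have "(LINT x|lborel. cnj (f x) * fourier_L1 g x) = (LINT \<xi>|lborel. cnj (F (- \<xi>)) * g \<xi>)"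
        using fc g by (simp add: is_fourier_L2_def)
      also have "\<dots> = (LINT \<xi>|lborel. F \<xi> * g \<xi>)"
        by (rule integral_cong_AE) (use sym in auto)
      finally have c: "(LINT x|lborel. cnj (f x) * fourier_L1 g x) = (LINT \<xi>|lborel. F \<xi> * g \<xi>)" .
      have "(LINT x|lborel. complex_of_real (Re (f x)) * fourier_L1 g x) =
         (LINT x|lborel. (1/2) * (f x * fourier_L1 g x + cnj (f x) * fourier_L1 g x))"
        unfolding re by (simp add: distrib_right)
      also have "\<dots> = (1/2) * ((LINT x|lborel. f x * fourier_L1 g x) + (LINT x|lborel. cnj (f x) * fourier_L1 g x))"
        using L2fun_mult_integrable[OF f(1) ft] L2fun_mult_integrable[OF L2fun_cnj[OF f(1)] ft] by simp
      also have "\<dots> = (LINT \<xi>|lborel. F \<xi> * g \<xi>)"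
        unfolding c using f(2) g by (simp add: is_fourier_L2_def)
      finally show "(LINT \<xi>|lborel. F \<xi> * g \<xi>) = (LINT x|lborel. complex_of_real (Re (f x)) * fourier_L1 g x)" by simp
    qed
  qed
qed


section \<open>Smoothed nonnegative radial functions\<close>

text \<open>A Householder reflection along \<open>x - y\<close>; equality of the norms gives
  \<open>2 * (v \<bullet> x) = v \<bullet> v\<close>, so that exactly \<open>v\<close> is subtracted
  from \<open>x\<close>.\<close>

lemma orthogonal_transformation_exists_euclidean:
  fixes x y :: "'a::euclidean_space"
  assumes "norm x = norm y"
  obtains T where "orthogonal_transformation T" "T x = y"
proof (cases "x = y")
  case True
  then show ?thesis using that[of id] by (simp add: orthogonal_transformation_id[unfolded id_def] id_def)
next
  case False
  define v where "v = x - y"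
  have vv: "v \<bullet> v \<noteq> 0" using False by (simp add: v_def)
  have vx: "2 * (v \<bullet> x) = v \<bullet> v"
    using assms by (simp add: v_def inner_diff_left inner_diff_right inner_commute norm_eq)
  define T where "T z = z - (2 * (v \<bullet> z) / (v \<bullet> v)) *\<^sub>R v" for z
  have "linear T"
    unfolding T_def by (auto intro!: linearI simp: algebra_simps inner_add_right add_divide_distrib)
  moreover have "T z \<bullet> T w = z \<bullet> w" for z w
    using vv by (simp add: T_def inner_diff_left inner_diff_right inner_commute field_simps)
  ultimately have "orthogonal_transformation T"
    by (simp add: orthogonal_transformation_def)
  moreover have "T x = y"
  proof -
    have "2 * (v \<bullet> x) / (v \<bullet> v) = 1" unfolding vx using vv by (rule divide_self)
    then have "T x = x - 1 *\<^sub>R v" unfolding T_def by (simp only:)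
    then show ?thesis by (simp add: v_def)
  qed
  ultimately show ?thesis by (rule that)
qed

section \<open>Powers of the frequency damped by a Gaussian\<close>

text \<open>The symbol of D^p followed by convolution with a Gaussian of variance
  \<open>s\<close>.\<close>

definition pgauss :: "real \<Rightarrow> real \<Rightarrow> 'a::euclidean_space \<Rightarrow> complex" where
  "pgauss p s \<xi> = complex_of_real (norm \<xi> powr p * gauss s \<xi>)"

lemma pgauss_measurable [measurable]: "pgauss p s \<in> borel_measurable borel"
  unfolding pgauss_def[abs_def] by measurable

lemma norm_pgauss: "cmod (pgauss p s \<xi>) = norm \<xi> powr p * gauss s \<xi>"
  by (simp add: pgauss_def norm_mult)

text \<open>From \<open>ln (\<kappa> y / r) \<le> \<kappa> y / r - 1\<close> with \<open>y = \<bar>\<xi>\<bar>\<^sup>2\<close>, \<open>r = p / 2\<close> and \<open>\<kappa> = s / 4\<close>.\<close>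

lemma powr_gauss_le:
  fixes p s :: real
  assumes p: "p > 0" and s: "s > 0"
  shows "\<exists>C>0. \<forall>\<xi>::'a::euclidean_space. norm \<xi> powr p * gauss s \<xi> \<le> C * gauss (s / 2) \<xi>"
proof (intro exI conjI allI)
  define r \<kappa> where "r = p / 2" and "\<kappa> = s / 4"
  have r: "r > 0" "\<kappa> > 0" using p s by (auto simp: r_def \<kappa>_def)
  show "0 < exp (r * ln (r / \<kappa>))" by simp
  fix \<xi> :: 'a
  have "norm \<xi> powr p \<le> exp (r * ln (r / \<kappa>)) * exp (\<kappa> * (norm \<xi>)\<^sup>2)"
  proof (cases "\<xi> = 0")
    case False
    define y where "y = (norm \<xi>)\<^sup>2"
    have y: "y > 0" using False by (simp add: y_def)
    have "norm \<xi> powr p = y powr r"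
      using False by (simp add: y_def r_def powr_powr powr_numeral[symmetric] del: powr_numeral)
    also have "\<dots> = exp (r * ln y)" using y by (simp add: powr_def)
    also have "\<dots> \<le> exp (r * ln (r / \<kappa>) + \<kappa> * y)"
    proof -
      have "ln (\<kappa> * y / r) \<le> \<kappa> * y / r - 1" using r y by (intro ln_le_minus_one) auto
      then have "ln \<kappa> + ln y - ln r \<le> \<kappa> * y / r"
        using r y by (simp add: ln_mult ln_div)
      then have "r * (ln \<kappa> + ln y - ln r) \<le> r * (\<kappa> * y / r)"
        using r by (intro mult_left_mono) auto
      then show ?thesis using r by (simp add: ln_div algebra_simps)
    qed
    finally show ?thesis by (simp add: exp_add y_def)
  qed simp
  then have "norm \<xi> powr p * gauss s \<xi> \<le> exp (r * ln (r / \<kappa>)) * exp (\<kappa> * (norm \<xi>)\<^sup>2) * gauss s \<xi>"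
    by (intro mult_right_mono) auto
  also have "\<dots> = exp (r * ln (r / \<kappa>)) * gauss (s / 2) \<xi>"
    by (simp add: gauss_def \<kappa>_def exp_add[symmetric] mult.assoc algebra_simps)
  finally show "norm \<xi> powr p * gauss s \<xi> \<le> exp (r * ln (r / \<kappa>)) * gauss (s / 2) \<xi>" .
qed

lemma
  assumes p: "p > 0" and s: "s > 0"
  shows L2fun_pgauss: "L2fun (pgauss p s :: 'a::euclidean_space \<Rightarrow> complex)"
    and L2fun_pgauss_mult: "\<And>F::'a \<Rightarrow> complex. L2fun F \<Longrightarrow> L2fun (\<lambda>\<xi>. pgauss p s \<xi> * F \<xi>)"
proof -
  obtain C where C: "C > 0" "\<And>\<xi>::'a. norm \<xi> powr p * gauss s \<xi> \<le> C * gauss (s / 2) \<xi>"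
    using powr_gauss_le[OF p s] by blast
  show "L2fun (pgauss p s :: 'a \<Rightarrow> complex)"
  proof (rule L2fun_dominated)
    show "integrable lborel (\<lambda>\<xi>::'a. C\<^sup>2 * gauss s \<xi>)"
      using integrable_gauss[OF s, where 'a='a] by simp
    show "AE \<xi> in lborel. (cmod (pgauss p s (\<xi>::'a)))\<^sup>2 \<le> C\<^sup>2 * gauss s \<xi>"
    proof (rule AE_I2)
      fix \<xi> :: 'a
      have "(cmod (pgauss p s \<xi>))\<^sup>2 \<le> (C * gauss (s / 2) \<xi>)\<^sup>2"
        unfolding norm_pgauss by (intro power_mono C) auto
      also have "\<dots> = C\<^sup>2 * gauss s \<xi>"
        using gauss_mult[of "s / 2" \<xi> "s / 2"] by (simp add: power_mult_distrib power2_eq_square)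
      finally show "(cmod (pgauss p s \<xi>))\<^sup>2 \<le> C\<^sup>2 * gauss s \<xi>" .
    qed
  qed simp
  show "L2fun (\<lambda>\<xi>. pgauss p s \<xi> * F \<xi>)" if "L2fun F" for F :: "'a \<Rightarrow> complex"
  proof (rule L2fun_mult_bounded[OF that])
    show "cmod (pgauss p s \<xi>) \<le> C" for \<xi> :: 'a
      using C(2)[of \<xi>] mult_left_mono[of "gauss (s / 2) \<xi>" 1 C] gauss_le_1[of "s / 2" \<xi>] C(1) s
      unfolding norm_pgauss by linarith
  qed simp
qed

text \<open>Up to a constant factor, D^r of the function with spectrum \<open>F\<close>, averaged by
  a Gaussian of variance \<open>s\<close>. Being an absolutely convergent integral for L^2 data, it
  is defined at every point.\<close>

definition smoothed :: "real \<Rightarrow> real \<Rightarrow> ('a::euclidean_space \<Rightarrow> complex) \<Rightarrow> 'a \<Rightarrow> complex" where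
  "smoothed r s F = fourier_int (\<lambda>\<xi>. pgauss r s \<xi> * F \<xi>)"

lemma smoothed_measurable [measurable]:
  "F \<in> borel_measurable borel \<Longrightarrow> smoothed r s F \<in> borel_measurable borel"
  unfolding smoothed_def by measurable

lemma integrable_pgauss_mult:
  "r > 0 \<Longrightarrow> s > 0 \<Longrightarrow> L2fun F \<Longrightarrow> integrable lborel (\<lambda>\<xi>. pgauss r s \<xi> * F \<xi>)"
  by (intro L2fun_mult_integrable L2fun_pgauss)

lemma
  assumes "r > 0" "s > 0" "L2fun (F :: 'a::euclidean_space \<Rightarrow> complex)"
  shows L2fun_smoothed: "L2fun (smoothed r s F)"
    and L2sq_smoothed: "L2sq (smoothed r s F) = (2 * pi) ^ DIM('a) * L2sq (\<lambda>\<xi>. pgauss r s \<xi> * F \<xi>)"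
  unfolding smoothed_def
  by (intro Plancherel integrable_pgauss_mult L2fun_pgauss_mult assms)+

lemma smoothed_diff:
  assumes "r > 0" "s > 0" "L2fun F" "L2fun G"
  shows "smoothed r s (\<lambda>\<xi>. F \<xi> - G \<xi>) = (\<lambda>x. smoothed r s F x - smoothed r s G x)"
  unfolding smoothed_def right_diff_distrib
  by (rule fourier_int_diff) (intro integrable_pgauss_mult assms)+

lemma norm_smoothed_le:
  assumes "r > 0" "s > 0" "L2fun (F :: 'a::euclidean_space \<Rightarrow> complex)"
  shows "cmod (smoothed r s F x) \<le> sqrt (L2sq (pgauss r s :: 'a \<Rightarrow> complex)) * sqrt (L2sq F)"
proof -
  have "cmod (smoothed r s F x) \<le> (LINT \<xi>|lborel. cmod (pgauss r s \<xi> * F \<xi>))"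
    unfolding smoothed_def by (rule norm_fourier_int_le)
  then show ?thesis
    using L2_Cauchy_Schwarz_norm[OF L2fun_pgauss[OF assms(1,2)] assms(3)] by (simp add: norm_mult)
qed

lemma norm_iexp_diff_le: "cmod (iexp a - iexp b) \<le> \<bar>a - b\<bar>"
proof -
  have "iexp a - iexp b =
      iexp b * (iexp (a - b) - 1)"
    by (simp add: right_diff_distrib exp_add[symmetric] algebra_simps)
  then have "cmod (iexp a - iexp b) = cmod (iexp (a - b) - 1)"
    by simp
  also have "\<dots> \<le> \<bar>a - b\<bar>" using iexp_approx1[of "a - b" 0] by simp
  finally show ?thesis .
qed

text \<open>Differences of characters cost one factor |xi|, which the Gaussian absorbs: the exponent
  rises from \<open>r\<close> to \<open>1 + r\<close>.\<close>

lemma smoothed_Lipschitz: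
  assumes r: "r > 0" and s: "s > 0" and F: "L2fun (F :: 'a::euclidean_space \<Rightarrow> complex)"
  shows "cmod (smoothed r s F x - smoothed r s F y) \<le> norm (x - y) * (sqrt (L2sq (pgauss (1 + r) s :: 'a \<Rightarrow> complex)) * sqrt (L2sq F))"
proof -
  let ?P = "\<lambda>\<xi>. pgauss r s \<xi> * F \<xi>"
  let ?e = "\<lambda>x \<xi>. iexp (x \<bullet> \<xi>)"
  have P: "integrable lborel ?P" by (rule integrable_pgauss_mult[OF r s F])
  have r1: "1 + r > 0" using r by simp
  have Q: "integrable lborel (\<lambda>\<xi>. cmod (pgauss (1 + r) s \<xi>) * cmod (F \<xi>))"
    using integrable_norm[OF integrable_pgauss_mult[OF r1 s F]] by (simp add: norm_mult)
  have "smoothed r s F x - smoothed r s F y = (LINT \<xi>|lborel. ?e x \<xi> * ?P \<xi> - ?e y \<xi> * ?P \<xi>)"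
    unfolding smoothed_def fourier_int_def
    by (rule Bochner_Integration.integral_diff[symmetric]) (intro integrable_exp_i_mult P)+
  also have "cmod \<dots> \<le> (LINT \<xi>|lborel. norm (x - y) * (cmod (pgauss (1 + r) s \<xi>) * cmod (F \<xi>)))"
  proof (rule order.trans[OF integral_norm_bound integral_mono])
    show "integrable lborel (\<lambda>\<xi>. norm (?e x \<xi> * ?P \<xi> - ?e y \<xi> * ?P \<xi>))"
      by (intro integrable_norm Bochner_Integration.integrable_diff integrable_exp_i_mult P)
    show "integrable lborel (\<lambda>\<xi>. norm (x - y) * (cmod (pgauss (1 + r) s \<xi>) * cmod (F \<xi>)))"
      using Q by simp
    fix \<xi> :: 'a
    have "norm (?e x \<xi> * ?P \<xi> - ?e y \<xi> * ?P \<xi>) = cmod (?e x \<xi> - ?e y \<xi>) * cmod (?P \<xi>)"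
      by (simp add: left_diff_distrib[symmetric] norm_mult)
    also have "\<dots> \<le> (norm (x - y) * norm \<xi>) * cmod (?P \<xi>)"
    proof (rule mult_right_mono)
      have "cmod (?e x \<xi> - ?e y \<xi>) \<le> \<bar>(x - y) \<bullet> \<xi>\<bar>"
        using norm_iexp_diff_le[of "x \<bullet> \<xi>" "y \<bullet> \<xi>"] by (simp add: inner_diff_left)
      also have "\<dots> \<le> norm (x - y) * norm \<xi>" by (rule Cauchy_Schwarz_ineq2)
      finally show "cmod (?e x \<xi> - ?e y \<xi>) \<le> norm (x - y) * norm \<xi>" .
    qed simp
    also have "\<dots> = norm (x - y) * (cmod (pgauss (1 + r) s \<xi>) * cmod (F \<xi>))"
      by (cases "\<xi> = 0") (auto simp: norm_mult norm_pgauss powr_add)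
    finally show "norm (?e x \<xi> * ?P \<xi> - ?e y \<xi> * ?P \<xi>) \<le> norm (x - y) * (cmod (pgauss (1 + r) s \<xi>) * cmod (F \<xi>))" .
  qed
  also have "\<dots> = norm (x - y) * (LINT \<xi>|lborel. cmod (pgauss (1 + r) s \<xi>) * cmod (F \<xi>))" by simp
  also have "\<dots> \<le> norm (x - y) * (sqrt (L2sq (pgauss (1 + r) s :: 'a \<Rightarrow> complex)) * sqrt (L2sq F))"
    by (intro mult_left_mono L2_Cauchy_Schwarz_norm L2fun_pgauss r1 s F) simp
  finally show ?thesis .
qed

lemma smoothed_orthogonal:
  fixes F :: "'a::euclidean_space \<Rightarrow> complex"
  assumes T: "orthogonal_transformation T" and F: "AE \<xi> in lborel. F (T \<xi>) = F \<xi>" and [measurable]: "F \<in> borel_measurable borel"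
  shows "smoothed r s F (T x) = smoothed r s F x"
proof -
  have [measurable]: "T \<in> borel \<rightarrow>\<^sub>M borel"
    using linear_continuous_on[of T UNIV] T
    by (simp add: linear_conv_bounded_linear borel_measurable_continuous_onI orthogonal_transformation_def)
  have nT: "norm (T \<xi>) = norm \<xi>" for \<xi> using T by (simp add: orthogonal_transformation)
  have iT: "T x \<bullet> T \<xi> = x \<bullet> \<xi>" for \<xi> using T by (simp add: orthogonal_transformation_def)
  let ?h = "\<lambda>\<xi>. iexp (T x \<bullet> \<xi>) * (pgauss r s \<xi> * F \<xi>)"
  have "smoothed r s F (T x) = (LINT \<xi>|lborel. ?h (T \<xi>))"
    unfolding smoothed_def fourier_int_def
    by (rule integral_lborel_preserving[symmetric, OF lborel_distr_orthogonal[OF T]]) measurable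
  also have "\<dots> = smoothed r s F x"
    unfolding smoothed_def fourier_int_def
    by (rule integral_cong_AE) (use F in \<open>auto simp: iT pgauss_def gauss_def nT\<close>)
  finally show ?thesis .
qed


text \<open>The multiplication formula does not force \<open>f\<close> to be locally integrable: the Bochner integral of a
  non-integrable function is \<open>0\<close>. A single non-integrable pairing, however, makes all pairings vanish.\<close>

lemma is_fourier_L2_dichotomy:
  fixes f :: "'a::euclidean_space \<Rightarrow> complex"
  assumes f: "is_fourier_L2 f G"
  shows "(\<forall>g. integrable lborel g \<and> L2fun g \<longrightarrow> integrable lborel (\<lambda>x. f x * fourier_L1 g x)) \<or>
    (\<forall>g. integrable lborel g \<and> L2fun g \<longrightarrow> (LINT \<xi>|lborel. G \<xi> * g \<xi>) = 0)"
proof (rule disjCI, rule ccontr)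
  assume "\<not> (\<forall>g. integrable lborel g \<and> L2fun g \<longrightarrow> (LINT \<xi>|lborel. G \<xi> * g \<xi>) = 0)"
    and "\<not> (\<forall>g. integrable lborel g \<and> L2fun g \<longrightarrow> integrable lborel (\<lambda>x. f x * fourier_L1 g x))"
  then obtain g h where g: "integrable lborel g" "L2fun g" "(LINT \<xi>|lborel. G \<xi> * g \<xi>) \<noteq> 0"
    and h: "integrable lborel h" "L2fun h" "\<not> integrable lborel (\<lambda>x. f x * fourier_L1 h x)"
    by blast
  have G: "L2fun G" and eq: "\<And>u. integrable lborel u \<Longrightarrow> L2fun u \<Longrightarrow> (LINT \<xi>|lborel. G \<xi> * u \<xi>) = (LINT x|lborel. f x * fourier_L1 u x)"
    using f by (auto simp: is_fourier_L2_def)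
  \<comment> \<open>A nonzero Bochner integral cannot be the default value of a non-integrable
    function.\<close>
  have gi: "integrable lborel (\<lambda>x. f x * fourier_L1 g x)"
    using g eq[OF g(1,2)] not_integrable_integral_eq by metis
  \<comment> \<open>Adding the integrable pairing of \<open>g\<close> to the non-integrable one of
    \<open>h\<close> leaves it non-integrable. So the pairings of \<open>h\<close> and of
    \<open>h + g\<close> both take the default value 0, while the integrals against \<open>G\<close>
    are genuinely linear; the pairing of \<open>g\<close> must vanish.\<close>
  let ?u = "\<lambda>\<xi>. h \<xi> + g \<xi>"
  have u: "integrable lborel ?u" "L2fun ?u" using g h by (auto intro: L2fun_add)
  have add: "fourier_L1 ?u x = fourier_L1 h x + fourier_L1 g x" for x
    unfolding fourier_L1_eq fourier_int_add[OF h(1) g(1)] by (simp add: distrib_left)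
  have "\<not> integrable lborel (\<lambda>x. f x * fourier_L1 ?u x)"
  proof
    assume "integrable lborel (\<lambda>x. f x * fourier_L1 ?u x)"
    then have "integrable lborel (\<lambda>x. f x * fourier_L1 ?u x - f x * fourier_L1 g x)"
      using gi by (rule Bochner_Integration.integrable_diff)
    then show False using h(3) by (simp add: add distrib_left)
  qed
  then have "(LINT \<xi>|lborel. G \<xi> * ?u \<xi>) = 0"
    using eq[OF u] by (simp add: not_integrable_integral_eq)
  moreover have "(LINT \<xi>|lborel. G \<xi> * h \<xi>) = 0"
    using eq[OF h(1,2)] h(3) by (simp add: not_integrable_integral_eq)
  moreover have "(LINT \<xi>|lborel. G \<xi> * ?u \<xi>) = (LINT \<xi>|lborel. G \<xi> * h \<xi>) + (LINT \<xi>|lborel. G \<xi> * g \<xi>)"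
    using L2fun_mult_integrable[OF G h(2)] L2fun_mult_integrable[OF G g(2)] by (simp add: distrib_left)
  ultimately show False using g(3) by simp
qed

section \<open>Gaussian averages of a nonnegative function: positivity, Harnack inequality,
  radiality\<close>

text \<open>Test functions whose transforms are Gaussians centred at \<open>a\<close>; pairing with
  them evaluates the smoothed function at \<open>a\<close>.\<close>

definition modgauss :: "real \<Rightarrow> 'a::euclidean_space \<Rightarrow> 'a \<Rightarrow> complex" where
  "modgauss s a \<xi> = iexp (a \<bullet> \<xi>) * complex_of_real (gauss s \<xi>)"

lemma modgauss:
  assumes s: "s > 0"
  shows "integrable lborel (modgauss s a)" "L2fun (modgauss s a)"
proof -
  have [measurable]: "modgauss s a \<in> borel_measurable borel"
    unfolding modgauss_def[abs_def] by measurable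
  show "integrable lborel (modgauss s a)"
    unfolding modgauss_def[abs_def] using integrable_gauss[OF s, where 'a='a]
    by (intro integrable_exp_i_mult integrable_of_real)
  show "L2fun (modgauss s a)"
  proof (rule L2fun_dominated)
    show "AE \<xi> in lborel. (cmod (modgauss s a \<xi>))\<^sup>2 \<le> gauss s \<xi>"
      using gauss_le_1[of s] s
      by (intro AE_I2) (auto simp: modgauss_def power2_eq_square intro!: mult_left_le)
  qed (use integrable_gauss[OF s] in auto)
qed

lemma fourier_L1_modgauss:
  fixes a :: "'a::euclidean_space"
  assumes s: "s > 0"
  shows "fourier_L1 (modgauss s a) y = complex_of_real (s powr (- (DIM('a) / 2)) * gauss (1 / s) (a - y))"
proof -
  have "fourier_int (modgauss s a) (- y) = fourier_int (\<lambda>\<xi>. complex_of_real (gauss s \<xi>)) (a - y)"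
    unfolding fourier_int_def modgauss_def
    by (intro Bochner_Integration.integral_cong refl) (simp add: exp_add[symmetric] inner_diff_left algebra_simps)
  also have "\<dots> = complex_of_real ((2 * pi / s) powr (DIM('a) / 2) * gauss (1 / s) (a - y))"
    by (rule fourier_int_gauss[OF s])
  finally have "fourier_L1 (modgauss s a) y = complex_of_real (fourier_const TYPE('a) * (2 * pi / s) powr (DIM('a) / 2) * gauss (1 / s) (a - y))"
    by (simp add: fourier_L1_eq)
  also have "fourier_const TYPE('a) * (2 * pi / s) powr (DIM('a) / 2) = s powr (- (DIM('a) / 2))"
  proof -
    have "(2 * pi / s) powr (DIM('a) / 2) = (2 * pi) powr (DIM('a) / 2) * s powr (- (DIM('a) / 2))"
      using s by (simp add: powr_divide powr_minus_divide del: powr_mult)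
    moreover have "(2 * pi) powr (- real DIM('a) / 2) * (2 * pi) powr (DIM('a) / 2) = 1"
      by (subst powr_add[symmetric]) simp
    ultimately show ?thesis unfolding fourier_const_def by (simp only: mult.assoc[symmetric] mult_1)
  qed
  finally show ?thesis .
qed

lemma smoothed_eq_pairing:
  "smoothed r s F a = (LINT \<xi>|lborel. (complex_of_real (norm \<xi> powr r) * F \<xi>) * modgauss s a \<xi>)"
  unfolding smoothed_def fourier_int_def modgauss_def pgauss_def by (simp add: mult_ac)

text \<open>The radiality and sign conditions of \<open>H_rad_plus\<close>, expressed through the
  spectrum. The exceptional null set may depend on \<open>T\<close>, since \<open>F\<close> is only
  known up to null sets.\<close>

definition nonneg_radial_spectrum :: "real \<Rightarrow> ('a::euclidean_space \<Rightarrow> complex) \<Rightarrow> bool" where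
  "nonneg_radial_spectrum r F \<longleftrightarrow> L2fun F \<and>
     (\<forall>T. orthogonal_transformation T \<longrightarrow> (AE \<xi> in lborel. F (T \<xi>) = F \<xi>)) \<and>
     (\<exists>\<psi>. is_fourier_L2 (\<lambda>x. complex_of_real (\<psi> x)) (\<lambda>\<xi>. complex_of_real (norm \<xi> powr r) * F \<xi>) \<and>
        (AE x in lborel. \<psi> x \<ge> 0))"

text \<open>The two branches of the dichotomy. If the pairings with \<psi> degenerate, the smoothed
  function vanishes identically and every estimate is trivial; otherwise it is a true Gaussian
  average of \<psi>, on which the sign of \<psi> can act.\<close>

lemma smoothed_kernel_cases:
  fixes F :: "'a::euclidean_space \<Rightarrow> complex"
  assumes "nonneg_radial_spectrum r F"
  obtains "\<And>s a. s > 0 \<Longrightarrow> smoothed r s F a = 0"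
  | \<psi> where "AE x in lborel. \<psi> x \<ge> 0"
     "\<And>s a. s > 0 \<Longrightarrow> integrable lborel (\<lambda>y. \<psi> y * (s powr (- (DIM('a) / 2)) * gauss (1 / s) (a - y)))"
     "\<And>s a. s > 0 \<Longrightarrow> smoothed r s F a = complex_of_real (LINT y|lborel. \<psi> y * (s powr (- (DIM('a) / 2)) * gauss (1 / s) (a - y)))"
proof -
  obtain \<psi> where \<psi>: "is_fourier_L2 (\<lambda>x. complex_of_real (\<psi> x)) (\<lambda>\<xi>. complex_of_real (norm \<xi> powr r) * F \<xi>)"
    "AE x in lborel. \<psi> x \<ge> 0"
    using assms by (auto simp: nonneg_radial_spectrum_def)
  let ?k = "\<lambda>s a y. s powr (- (DIM('a) / 2)) * gauss (1 / s) (a - y)"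
  show ?thesis
    using is_fourier_L2_dichotomy[OF \<psi>(1)]
  proof
    assume z: "\<forall>g. integrable lborel g \<and> L2fun g \<longrightarrow> (LINT \<xi>|lborel. complex_of_real (norm \<xi> powr r) * F \<xi> * g \<xi>) = 0"
    show ?thesis
      by (rule that(1)) (unfold smoothed_eq_pairing, rule z[rule_format], intro conjI modgauss)
  next
    assume i: "\<forall>g. integrable lborel g \<and> L2fun g \<longrightarrow> integrable lborel (\<lambda>x. complex_of_real (\<psi> x) * fourier_L1 g x)"
    show ?thesis
    proof (rule that(2)[OF \<psi>(2)])
      fix s :: real and a :: 'a assume s: "s > 0"
      have "integrable lborel (\<lambda>y. complex_of_real (\<psi> y) * fourier_L1 (modgauss s a) y)"
        by (rule i[rule_format]) (intro conjI modgauss s)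
      then have "integrable lborel (\<lambda>y. complex_of_real (\<psi> y * ?k s a y))"
        by (simp only: fourier_L1_modgauss[OF s] of_real_mult)
      from integrable_Re[OF this] show "integrable lborel (\<lambda>y. \<psi> y * ?k s a y)" by simp
      have "smoothed r s F a = (LINT y|lborel. complex_of_real (\<psi> y) * fourier_L1 (modgauss s a) y)"
        unfolding smoothed_eq_pairing using \<psi>(1) modgauss[OF s, of a] by (simp add: is_fourier_L2_def)
      also have "\<dots> = (LINT y|lborel. complex_of_real (\<psi> y * ?k s a y))"
        by (simp add: fourier_L1_modgauss[OF s])
      finally show "smoothed r s F a = complex_of_real (LINT y|lborel. \<psi> y * ?k s a y)"
        by (simp only: integral_complex_of_real)
    qed
  qed
qed

text \<open>Stated as equality with the modulus so that moduli under an integral can be rewritten to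
  the smoothed function, which is linear in \<open>F\<close>.\<close>

lemma smoothed_nonneg:
  assumes F: "nonneg_radial_spectrum r F" and s: "s > 0"
  shows "smoothed r s F a = complex_of_real (cmod (smoothed r s F a))"
  using F
proof (cases rule: smoothed_kernel_cases)
  case (2 \<psi>)
  have "0 \<le> (LINT y|lborel. \<psi> y * (s powr (- (DIM('a) / 2)) * gauss (1 / s) (a - y)))"
    by (rule integral_nonneg_AE) (use 2(1) in auto)
  then show ?thesis unfolding 2(3)[OF s] by simp
qed (use s in simp)

text \<open>A comparison of kernels. From |a - y|^2 \<le> 2 |x - y|^2 + 2, the variance 1 kernel at
  \<open>x\<close> is at most \<open>exp (1 / 2)\<close> times the unnormalised variance 2 kernel at
  \<open>a\<close>; the power of 2 undoes the normalisation. Since \<psi> is nonnegative, the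
  comparison survives integration.\<close>

lemma smoothed_Harnack:
  fixes F :: "'a::euclidean_space \<Rightarrow> complex"
  assumes F: "nonneg_radial_spectrum r F" and near: "norm (x - a) \<le> 1"
  shows "cmod (smoothed r 1 F x) \<le> 2 powr (DIM('a) / 2) * exp (1 / 2) * cmod (smoothed r 2 F a)"
  using F
proof (cases rule: smoothed_kernel_cases)
  case (2 \<psi>)
  let ?C = "2 powr (DIM('a) / 2) * exp (1 / 2) :: real"
  let ?k = "\<lambda>s a y. s powr (- (DIM('a) / 2)) * gauss (1 / s) (a - y)"
  have ker: "?k 1 x y \<le> ?C * ?k 2 a y" for y
  proof -
    have "(norm (a - y))\<^sup>2 \<le> 2 * (norm (x - y))\<^sup>2 + 2 * (norm (a - x))\<^sup>2"
      using norm_sq_add_le[of "x - y" "a - x"] by simp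
    also have "(norm (a - x))\<^sup>2 \<le> 1" using near by (simp add: norm_minus_commute power_le_one)
    finally have le: "- ((norm (x - y))\<^sup>2 / 2) \<le> 1 / 2 - (norm (a - y))\<^sup>2 / 4" by simp
    have "?k 1 x y = exp (- ((norm (x - y))\<^sup>2 / 2))" by (simp add: gauss_def)
    also have "\<dots> \<le> exp (1 / 2 - (norm (a - y))\<^sup>2 / 4)" using le by simp
    also have "\<dots> = exp (1 / 2) * gauss (1 / 2) (a - y)" by (simp add: gauss_def exp_add[symmetric])
    also have "\<dots> = ?C * ?k 2 a y" by (simp add: powr_minus field_simps)
    finally show ?thesis .
  qed
  have nn: "0 \<le> (LINT y|lborel. \<psi> y * ?k s b y)" for s b
    by (rule integral_nonneg_AE) (use 2(1) in auto)
  have "(LINT y|lborel. \<psi> y * ?k 1 x y) \<le> (LINT y|lborel. ?C * (\<psi> y * ?k 2 a y))"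
  proof (rule integral_mono_AE)
    show "AE y in lborel. \<psi> y * ?k 1 x y \<le> ?C * (\<psi> y * ?k 2 a y)"
      using 2(1)
    proof eventually_elim
      case (elim y)
      then show ?case using mult_left_mono[OF ker[of y], of "\<psi> y"] by (simp only: mult_ac)
    qed
    show "integrable lborel (\<lambda>y. \<psi> y * ?k 1 x y)" by (rule 2(2)) simp
    show "integrable lborel (\<lambda>y. ?C * (\<psi> y * ?k 2 a y))"
      by (rule integrable_mult_right, rule 2(2)) simp
  qed
  also have "\<dots> = ?C * (LINT y|lborel. \<psi> y * ?k 2 a y)" by (rule integral_mult_right_zero)
  finally have "(LINT y|lborel. \<psi> y * ?k 1 x y) \<le> ?C * (LINT y|lborel. \<psi> y * ?k 2 a y)" .
  then show ?thesis
    unfolding 2(3)[OF zero_less_one] 2(3)[OF zero_less_numeral] norm_of_real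
    using nn[of 1 x] nn[of 2 a] by (simp only: abs_of_nonneg)
qed simp

text \<open>Null sets disappear under the integral, so almost-everywhere invariance of
  \<open>F\<close> gives equality at every pair of points.\<close>

lemma smoothed_radial:
  assumes F: "nonneg_radial_spectrum r F" and "norm x = norm y"
  shows "smoothed r s F x = smoothed r s F y"
proof -
  obtain T where T: "orthogonal_transformation T" "T x = y"
    using orthogonal_transformation_exists_euclidean[OF assms(2)] .
  have "smoothed r s F (T x) = smoothed r s F x"
    using F T(1) by (intro smoothed_orthogonal) (auto simp: nonneg_radial_spectrum_def L2fun_def)
  then show ?thesis by (simp add: T(2))
qed

section \<open>Growth of the mass of the averaged function\<close>

lemma L2sq_pgauss_scale:
  fixes R :: real
  assumes R: "R > 0"
  shows "L2sq (pgauss r (R\<^sup>2) :: 'a::euclidean_space \<Rightarrow> complex) = R powr (- (real DIM('a) + 2 * r)) * L2sq (pgauss r 1 :: 'a \<Rightarrow> complex)"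
proof -
  have "cmod (pgauss r (R\<^sup>2) ((1 / R) *\<^sub>R x)) = R powr (- r) * cmod (pgauss r 1 x)" for x :: 'a
    using R by (simp add: norm_pgauss gauss_scaleR power_divide powr_divide powr_minus_divide)
  then have "L2sq (pgauss r (R\<^sup>2) :: 'a \<Rightarrow> complex) = (1 / R) ^ DIM('a) * (LINT x|lborel. (R powr (- r))\<^sup>2 * (cmod (pgauss r 1 (x::'a)))\<^sup>2)"
    unfolding L2sq_def
    using integral_lborel_scaleR(1)[of "\<lambda>x::'a. (cmod (pgauss r (R\<^sup>2) x))\<^sup>2" "1 / R"] R
    by (simp add: power_mult_distrib)
  also have "\<dots> = (1 / R) ^ DIM('a) * (R powr (- r))\<^sup>2 * L2sq (pgauss r 1 :: 'a \<Rightarrow> complex)"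
    by (simp add: L2sq_def)
  also have "(1 / R) ^ DIM('a) * (R powr (- r))\<^sup>2 = R powr (- (real DIM('a) + 2 * r))"
  proof -
    have "(1 / R) ^ DIM('a) = R powr (- real DIM('a))"
      using R by (simp add: powr_minus powr_realpow power_one_over divide_inverse power_inverse)
    moreover have "(R powr (- r))\<^sup>2 = R powr (- (2 * r))"
      by (simp add: power2_eq_square powr_add[symmetric])
    ultimately show ?thesis by (simp add: powr_add[symmetric])
  qed
  finally show ?thesis .
qed

text \<open>In frequency space the Gaussian weight becomes R^d times a Gaussian living at |xi| of
  order 1/R. Combined with the symbol it has L^2 norm of order R^(-d/2 - r), and Cauchy-Schwarz
  against \<open>F\<close> leaves R^(d/2 - r).\<close>

lemma smoothed_gauss_mass:
  fixes F :: "'a::euclidean_space \<Rightarrow> complex"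
  assumes F: "nonneg_radial_spectrum r F" and r: "r > 0" and R: "R > 0"
  shows "integrable lborel (\<lambda>a. cmod (smoothed r 2 F a) * gauss (1 / R\<^sup>2) a)"
    and "(LINT a|lborel. cmod (smoothed r 2 F a) * gauss (1 / R\<^sup>2) a) \<le>
      (2 * pi) powr (DIM('a) / 2) * sqrt (L2sq (pgauss r 1 :: 'a \<Rightarrow> complex)) * R powr (real DIM('a) / 2 - r) * sqrt (L2sq F)"
proof -
  have L: "L2fun F" using F by (simp add: nonneg_radial_spectrum_def)
  have [measurable]: "F \<in> borel_measurable borel" using L2fun_measurable[OF L] by simp
  have R2: "1 / R\<^sup>2 > 0" "R\<^sup>2 > 0" using R by auto
  have ig: "integrable lborel (\<lambda>a::'a. complex_of_real (gauss (1 / R\<^sup>2) a))"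
    by (rule integrable_of_real[OF integrable_gauss[OF R2(1)]])
  show i: "integrable lborel (\<lambda>a. cmod (smoothed r 2 F a) * gauss (1 / R\<^sup>2) a)"
  proof (rule Bochner_Integration.integrable_bound)
    let ?K = "sqrt (L2sq (pgauss r 2 :: 'a \<Rightarrow> complex)) * sqrt (L2sq F)"
    show "integrable lborel (\<lambda>a::'a. ?K * gauss (1 / R\<^sup>2) a)"
      using integrable_gauss[OF R2(1), where 'a='a] by simp
    show "AE a in lborel. norm (cmod (smoothed r 2 F a) * gauss (1 / R\<^sup>2) a) \<le> norm (?K * gauss (1 / R\<^sup>2) a)"
      using norm_smoothed_le[OF r _ L, of 2]
      by (intro AE_I2) (auto simp: abs_mult intro!: mult_right_mono)
  qed measurable
  have "complex_of_real (LINT a|lborel. cmod (smoothed r 2 F a) * gauss (1 / R\<^sup>2) a) =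
      (LINT a|lborel. complex_of_real (cmod (smoothed r 2 F a)) * complex_of_real (gauss (1 / R\<^sup>2) a))"
    by (subst integral_complex_of_real[symmetric]) simp
  \<comment> \<open>Positivity enters here: without the modulus the integrand is a Fourier integral
    and the multiplication formula applies.\<close>
  also have "\<dots> = (LINT a|lborel. smoothed r 2 F a * complex_of_real (gauss (1 / R\<^sup>2) a))"
    by (simp only: smoothed_nonneg[OF F zero_less_numeral, symmetric])
  also have "\<dots> = (LINT \<xi>|lborel. (pgauss r 2 \<xi> * F \<xi>) * fourier_int (\<lambda>a. complex_of_real (gauss (1 / R\<^sup>2) a)) \<xi>)"
    unfolding smoothed_def by (intro fourier_int_multiplication integrable_pgauss_mult r L ig) simp
  also have "\<dots> = (LINT \<xi>|lborel. (pgauss r 2 \<xi> * F \<xi>) * complex_of_real ((2 * pi / (1 / R\<^sup>2)) powr (DIM('a) / 2) * gauss (1 / (1 / R\<^sup>2)) \<xi>))"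
    by (simp only: fourier_int_gauss[OF R2(1)])
  finally have eq: "complex_of_real (LINT a|lborel. cmod (smoothed r 2 F a) * gauss (1 / R\<^sup>2) a) =
     (LINT \<xi>|lborel. (pgauss r 2 \<xi> * F \<xi>) * complex_of_real ((2 * pi * R\<^sup>2) powr (DIM('a) / 2) * gauss (R\<^sup>2) \<xi>))"
    by (simp del: powr_mult)
  let ?c = "(2 * pi * R\<^sup>2) powr (DIM('a) / 2)"
  have "(LINT a|lborel. cmod (smoothed r 2 F a) * gauss (1 / R\<^sup>2) a) \<le> cmod (complex_of_real (LINT a|lborel. cmod (smoothed r 2 F a) * gauss (1 / R\<^sup>2) a))"
    by (simp only: norm_of_real abs_ge_self)
  also have "\<dots> \<le> (LINT \<xi>|lborel. cmod ((pgauss r 2 \<xi> * F \<xi>) * complex_of_real (?c * gauss (R\<^sup>2) \<xi>)))"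
    unfolding eq by (rule integral_norm_bound)
  also have "\<dots> \<le> (LINT \<xi>|lborel. ?c * (cmod (pgauss r (R\<^sup>2) \<xi>) * cmod (F \<xi>)))"
  proof (rule integral_mono')
    show "integrable lborel (\<lambda>\<xi>. ?c * (cmod (pgauss r (R\<^sup>2) \<xi>) * cmod (F \<xi>)))"
      using integrable_norm[OF integrable_pgauss_mult[OF r R2(2) L]] by (simp add: norm_mult)
    fix \<xi> :: 'a
    have "gauss 2 \<xi> * (?c * (norm \<xi> powr r * gauss (R\<^sup>2) \<xi> * cmod (F \<xi>))) \<le> 1 * (?c * (norm \<xi> powr r * gauss (R\<^sup>2) \<xi> * cmod (F \<xi>)))"
      by (intro mult_right_mono gauss_le_1) auto
    then show "cmod ((pgauss r 2 \<xi> * F \<xi>) * complex_of_real (?c * gauss (R\<^sup>2) \<xi>)) \<le> ?c * (cmod (pgauss r (R\<^sup>2) \<xi>) * cmod (F \<xi>))"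
      by (simp add: norm_mult norm_pgauss mult_ac del: powr_mult)
  qed (simp del: powr_mult)
  also have "\<dots> = ?c * (LINT \<xi>|lborel. cmod (pgauss r (R\<^sup>2) \<xi>) * cmod (F \<xi>))"
    by (rule integral_mult_right_zero)
  also have "\<dots> \<le> ?c * (sqrt (L2sq (pgauss r (R\<^sup>2) :: 'a \<Rightarrow> complex)) * sqrt (L2sq F))"
    by (intro mult_left_mono L2_Cauchy_Schwarz_norm L2fun_pgauss r R2 L) simp
  also have "\<dots> = (?c * sqrt (R powr (- (real DIM('a) + 2 * r)))) * sqrt (L2sq (pgauss r 1 :: 'a \<Rightarrow> complex)) * sqrt (L2sq F)"
    unfolding L2sq_pgauss_scale[OF R] real_sqrt_mult by (simp only: mult_ac)
  also have "?c * sqrt (R powr (- (real DIM('a) + 2 * r))) = (2 * pi) powr (DIM('a) / 2) * R powr (real DIM('a) / 2 - r)"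
  proof -
    have "R\<^sup>2 = R powr 2" using R by simp
    then have "?c = (2 * pi) powr (DIM('a) / 2) * R powr (real DIM('a))"
      using R by (subst powr_mult) (auto simp: powr_powr simp del: powr_mult powr_numeral)
    moreover have "sqrt (R powr (- (real DIM('a) + 2 * r))) = R powr (- (real DIM('a) / 2 + r))"
    proof -
      have "sqrt (R powr (- (real DIM('a) + 2 * r))) = R powr (- (real DIM('a) + 2 * r) * (1 / 2))"
        by (simp only: powr_half_sqrt[symmetric] powr_powr powr_ge_zero)
      also have "- (real DIM('a) + 2 * r) * (1 / 2) = - (real DIM('a) / 2 + r)" by simp
      finally show ?thesis .
    qed
    moreover have "R powr (real DIM('a)) * R powr (- (real DIM('a) / 2 + r)) = R powr (real DIM('a) / 2 - r)"
      by (subst powr_add[symmetric]) (simp add: field_simps)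
    ultimately show ?thesis by (simp only: mult.assoc)
  qed
  finally show "(LINT a|lborel. cmod (smoothed r 2 F a) * gauss (1 / R\<^sup>2) a) \<le>
      (2 * pi) powr (DIM('a) / 2) * sqrt (L2sq (pgauss r 1 :: 'a \<Rightarrow> complex)) * R powr (real DIM('a) / 2 - r) * sqrt (L2sq F)"
    by (simp only: mult_ac)
qed


section \<open>Decay and tightness\<close>

text \<open>On |a| \<le> 2 R the weight \<open>gauss (1 / R\<^sup>2)\<close> is at least
  \<open>exp (-2)\<close>. The radius 2 R contains, for R \<ge> 1, both the shell of thickness 1
  used for the decay and the dyadic shell.\<close>

lemma smoothed_local_mass:
  assumes r: "r > 0"
  shows "\<exists>K\<ge>0. \<forall>(F::'a::euclidean_space \<Rightarrow> complex) R. nonneg_radial_spectrum r F \<longrightarrow> R > 0 \<longrightarrow>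
    integrable lborel (\<lambda>a. indicat_real (cball 0 (2 * R)) a * cmod (smoothed r 2 F a)) \<and>
    (LINT a|lborel. indicat_real (cball 0 (2 * R)) a * cmod (smoothed r 2 F a)) \<le> K * R powr (real DIM('a) / 2 - r) * sqrt (L2sq F)"
proof -
  define K0 where "K0 = (2 * pi) powr (DIM('a) / 2) * sqrt (L2sq (pgauss r 1 :: 'a \<Rightarrow> complex))"
  have "integrable lborel (\<lambda>a. indicat_real (cball 0 (2 * R)) a * cmod (smoothed r 2 F a)) \<and>
      (LINT a|lborel. indicat_real (cball 0 (2 * R)) a * cmod (smoothed r 2 F a)) \<le> exp 2 * K0 * R powr (real DIM('a) / 2 - r) * sqrt (L2sq F)"
    if F: "nonneg_radial_spectrum r F" and R: "R > 0" for F :: "'a \<Rightarrow> complex" and R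
  proof -
    note m = smoothed_gauss_mass[OF F r R]
    have [measurable]: "F \<in> borel_measurable borel" using F by (simp add: nonneg_radial_spectrum_def L2fun_def)
    have le: "indicat_real (cball 0 (2 * R)) a * cmod (smoothed r 2 F a) \<le> exp 2 * (cmod (smoothed r 2 F a) * gauss (1 / R\<^sup>2) a)" for a
    proof (cases "norm a \<le> 2 * R")
      case True
      then have "(norm a)\<^sup>2 \<le> (2 * R)\<^sup>2" by (intro power_mono) auto
      then have "(norm a)\<^sup>2 \<le> 4 * R\<^sup>2" by (simp add: power_mult_distrib)
      then have "1 / R\<^sup>2 * (norm a)\<^sup>2 / 2 \<le> 2" using R by (simp add: field_simps)
      then have "1 \<le> exp (2 + - (1 / R\<^sup>2 * (norm a)\<^sup>2 / 2))" by simp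
      then have "1 \<le> exp 2 * gauss (1 / R\<^sup>2) a" unfolding gauss_def exp_add .
      then have "1 * cmod (smoothed r 2 F a) \<le> (exp 2 * gauss (1 / R\<^sup>2) a) * cmod (smoothed r 2 F a)"
        by (rule mult_right_mono) simp
      then show ?thesis using True by (simp add: mult_ac)
    qed (simp add: indicator_def)
    have [measurable]: "cball (0::'a) (2 * R) \<in> sets borel" by simp
    have i: "integrable lborel (\<lambda>a. exp 2 * (cmod (smoothed r 2 F a) * gauss (1 / R\<^sup>2) a))"
      using m(1) by simp
    have int: "integrable lborel (\<lambda>a. indicat_real (cball 0 (2 * R)) a * cmod (smoothed r 2 F a))"
      by (rule Bochner_Integration.integrable_bound[OF i]) (use le in auto)
    have "(LINT a|lborel. indicat_real (cball 0 (2 * R)) a * cmod (smoothed r 2 F a)) \<le>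
        (LINT a|lborel. exp 2 * (cmod (smoothed r 2 F a) * gauss (1 / R\<^sup>2) a))"
      by (rule integral_mono[OF int i le])
    also have "\<dots> = exp 2 * (LINT a|lborel. cmod (smoothed r 2 F a) * gauss (1 / R\<^sup>2) a)" by simp
    also have "\<dots> \<le> exp 2 * (K0 * R powr (real DIM('a) / 2 - r) * sqrt (L2sq F))"
      using m(2) unfolding K0_def by (intro mult_left_mono) auto
    finally show ?thesis using int by (simp add: mult_ac)
  qed
  moreover have "0 \<le> exp 2 * K0" by (simp add: K0_def)
  ultimately show ?thesis by blast
qed

lemma measure_shell_ge:
  fixes R :: real
  assumes R: "R > 0"
  shows "measure lborel (cball (0::'a::euclidean_space) (R + 1) - ball 0 R) \<ge> unit_ball_vol (real DIM('a)) * R ^ (DIM('a) - 1)"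
proof -
  have "measure lborel (cball (0::'a) (R + 1) - ball 0 R) = measure lborel (cball (0::'a) (R + 1)) - measure lborel (ball (0::'a) R)"
    using emeasure_lborel_cball_finite[of "0::'a" "R + 1"] emeasure_lborel_ball_finite[of "0::'a" R]
    by (intro measure_Diff) auto
  also have "\<dots> = unit_ball_vol (real DIM('a)) * ((R + 1) ^ DIM('a) - R ^ DIM('a))"
    using R by (simp add: content_cball content_ball right_diff_distrib)
  also have "\<dots> \<ge> unit_ball_vol (real DIM('a)) * R ^ (DIM('a) - 1)"
  proof (rule mult_left_mono)
    obtain n where n: "DIM('a) = Suc n" using DIM_positive[where 'a='a] gr0_conv_Suc by blast
    have "R ^ n \<le> (R + 1) ^ n" using R by (intro power_mono) auto
    then have "(R + 1) * R ^ n \<le> (R + 1) * (R + 1) ^ n" using R by (intro mult_left_mono) auto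
    then show "R ^ (DIM('a) - 1) \<le> (R + 1) ^ DIM('a) - R ^ DIM('a)"
      by (simp add: n algebra_simps)
  qed simp
  finally show ?thesis .
qed

text \<open>A radial function is comparable, by the Harnack inequality, with its average over the shell
  \<open>\<bar>x\<bar> \<le> \<bar>a\<bar> \<le> \<bar>x\<bar> + 1\<close>, whose volume is of order \<open>\<bar>x\<bar> ^ (d - 1)\<close>.\<close>

lemma smoothed_decay:
  assumes r: "r > 0"
  shows "\<exists>K\<ge>0. \<forall>(F::'a::euclidean_space \<Rightarrow> complex) x. nonneg_radial_spectrum r F \<longrightarrow> norm x \<ge> 1 \<longrightarrow>
    cmod (smoothed r 1 F x) \<le> K * norm x powr (1 - real DIM('a) / 2 - r) * sqrt (L2sq F)"
proof -
  obtain K where K: "K \<ge> 0" "\<And>(F::'a \<Rightarrow> complex) R. nonneg_radial_spectrum r F \<Longrightarrow> R > 0 \<Longrightarrow>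
    integrable lborel (\<lambda>a. indicat_real (cball 0 (2 * R)) a * cmod (smoothed r 2 F a)) \<and>
    (LINT a|lborel. indicat_real (cball 0 (2 * R)) a * cmod (smoothed r 2 F a)) \<le> K * R powr (real DIM('a) / 2 - r) * sqrt (L2sq F)"
    using smoothed_local_mass[OF r, where 'a='a] by blast
  define V where "V = unit_ball_vol (real DIM('a))"
  have V: "V > 0" by (simp add: V_def)
  define C where "C = 2 powr (DIM('a) / 2) * exp (1 / 2 :: real)"
  have C: "C > 0" by (simp add: C_def)
  have "cmod (smoothed r 1 F x) \<le> (C * K / V) * norm x powr (1 - real DIM('a) / 2 - r) * sqrt (L2sq F)"
    if F: "nonneg_radial_spectrum r F" and x: "norm x \<ge> 1" for F :: "'a \<Rightarrow> complex" and x
  proof -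
    define R where "R = norm x"
    have R: "R \<ge> 1" "R > 0" using x by (auto simp: R_def)
    let ?A = "cball (0::'a) (R + 1) - ball 0 R"
    have [measurable]: "?A \<in> sets borel" by simp
    let ?u = "cmod (smoothed r 1 F x)"
    note k = K(2)[OF F R(2)]
    have le: "?u * indicat_real ?A a \<le> C * (indicat_real (cball 0 (2 * R)) a * cmod (smoothed r 2 F a))" for a
    proof (cases "a \<in> ?A")
      case True
      then have a: "R \<le> norm a" "norm a \<le> R + 1" by auto
      \<comment> \<open>The radial projection of \<open>a\<close> to the sphere through
        \<open>x\<close>: it lies within distance 1 of \<open>a\<close>, as Harnack requires, and
        the smoothed function has the same value there as at \<open>x\<close>.\<close>
      define x' where "x' = (R / norm a) *\<^sub>R a"
      have na: "norm a > 0" using a R by linarith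
      have nx': "norm x' = norm x" using na R by (simp add: x'_def R_def)
      have "x' - a = (R / norm a - 1) *\<^sub>R a" by (simp add: x'_def scaleR_left_diff_distrib)
      then have "norm (x' - a) = \<bar>R / norm a - 1\<bar> * norm a" by simp
      also have "\<dots> = \<bar>(R / norm a - 1) * norm a\<bar>" by (simp add: abs_mult)
      also have "(R / norm a - 1) * norm a = R - norm a" using na by (simp add: field_simps)
      finally have "norm (x' - a) \<le> 1" using a by simp
      then have "cmod (smoothed r 1 F x') \<le> C * cmod (smoothed r 2 F a)"
        unfolding C_def by (rule smoothed_Harnack[OF F])
      then show ?thesis using True a R smoothed_radial[OF F nx'] by simp
    qed (use C in simp)
    have fin: "emeasure lborel ?A < \<infinity>"
      using emeasure_mono[of ?A "cball (0::'a) (R + 1)" lborel] emeasure_lborel_cball_finite[of "0::'a" "R + 1"]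
      by (simp add: order_le_less_trans)
    have iA: "integrable lborel (indicat_real ?A)" using fin by (simp add: integrable_indicator_iff)
    have "?u * (V * R ^ (DIM('a) - 1)) \<le> ?u * measure lborel ?A"
      unfolding V_def by (intro mult_left_mono measure_shell_ge R) simp
    also have "\<dots> = (LINT a|lborel. ?u * indicat_real ?A a)" by simp
    also have "\<dots> \<le> (LINT a|lborel. C * (indicat_real (cball 0 (2 * R)) a * cmod (smoothed r 2 F a)))"
      by (rule integral_mono) (use iA k le in auto)
    also have "\<dots> = C * (LINT a|lborel. indicat_real (cball 0 (2 * R)) a * cmod (smoothed r 2 F a))" by simp
    also have "\<dots> \<le> C * (K * R powr (real DIM('a) / 2 - r) * sqrt (L2sq F))"
      using k C by (intro mult_left_mono) auto
    finally have "?u * (V * R ^ (DIM('a) - 1)) \<le> C * (K * R powr (real DIM('a) / 2 - r) * sqrt (L2sq F))" .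
    moreover have "R ^ (DIM('a) - 1) = R powr (real DIM('a) - 1)"
      using R by (subst powr_realpow[symmetric]) (auto simp: of_nat_diff DIM_positive Suc_leI)
    ultimately have "?u * (V * R powr (real DIM('a) - 1)) \<le> C * (K * R powr (real DIM('a) / 2 - r) * sqrt (L2sq F))"
      by simp
    moreover have "R powr (real DIM('a) / 2 - r) = R powr (1 - real DIM('a) / 2 - r) * R powr (real DIM('a) - 1)"
      by (subst powr_add[symmetric]) (simp add: field_simps)
    ultimately have "(?u * V) * R powr (real DIM('a) - 1) \<le>
        (C * K * R powr (1 - real DIM('a) / 2 - r) * sqrt (L2sq F)) * R powr (real DIM('a) - 1)"
      by (simp only: mult_ac)
    then have "?u * V \<le> C * K * R powr (1 - real DIM('a) / 2 - r) * sqrt (L2sq F)"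
      using R by (subst (asm) mult_le_cancel_right) auto
    then show ?thesis using V by (simp add: field_simps R_def)
  qed
  moreover have "C * K / V \<ge> 0" using C V K(1) by simp
  ultimately show ?thesis by blast
qed

lemma smoothed_shell:
  assumes r: "r > 1 / 2"
  shows "\<exists>K\<ge>0. \<forall>(F::'a::euclidean_space \<Rightarrow> complex) R. nonneg_radial_spectrum r F \<longrightarrow> R \<ge> 1 \<longrightarrow>
    (LINT x|lborel. indicat_real (ball 0 (2 * R) - ball 0 R) x * (cmod (smoothed r 1 F x))\<^sup>2) \<le> K * R powr (1 - 2 * r) * L2sq F"
proof -
  have r0: "r > 0" using r by simp
  obtain K where K: "K \<ge> 0" "\<And>(F::'a \<Rightarrow> complex) R. nonneg_radial_spectrum r F \<Longrightarrow> R > 0 \<Longrightarrow>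
    integrable lborel (\<lambda>a. indicat_real (cball 0 (2 * R)) a * cmod (smoothed r 2 F a)) \<and>
    (LINT a|lborel. indicat_real (cball 0 (2 * R)) a * cmod (smoothed r 2 F a)) \<le> K * R powr (real DIM('a) / 2 - r) * sqrt (L2sq F)"
    using smoothed_local_mass[OF r0, where 'a='a] by blast
  obtain L where L: "L \<ge> 0" "\<And>(F::'a \<Rightarrow> complex) x. nonneg_radial_spectrum r F \<Longrightarrow> norm x \<ge> 1 \<Longrightarrow>
    cmod (smoothed r 1 F x) \<le> L * norm x powr (1 - real DIM('a) / 2 - r) * sqrt (L2sq F)"
    using smoothed_decay[OF r0, where 'a='a] by blast
  define C where "C = 2 powr (DIM('a) / 2) * exp (1 / 2 :: real)"
  have C: "C > 0" by (simp add: C_def)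
  have "(LINT x|lborel. indicat_real (ball 0 (2 * R) - ball 0 R) x * (cmod (smoothed r 1 F x))\<^sup>2) \<le> (L * C * K) * R powr (1 - 2 * r) * L2sq F"
    if F: "nonneg_radial_spectrum r F" and R: "R \<ge> 1" for F :: "'a \<Rightarrow> complex" and R
  proof -
    have [measurable]: "F \<in> borel_measurable borel" using F by (simp add: nonneg_radial_spectrum_def L2fun_def)
    have R0: "R > 0" using R by simp
    note k = K(2)[OF F R0]
    define M where "M = L * R powr (1 - real DIM('a) / 2 - r) * sqrt (L2sq F)"
    have M: "0 \<le> M" using L(1) by (simp add: M_def)
    have d1: "real DIM('a) \<ge> 1" using DIM_positive[where 'a='a] by (simp add: Suc_le_eq)
    \<comment> \<open>As the decay exponent is nonpositive, its power is largest at the inner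
      radius, and \<open>M\<close> bounds the function on the entire shell.\<close>
    have ex: "1 - real DIM('a) / 2 - r \<le> 0" using d1 r by linarith
    have le: "indicat_real (ball 0 (2 * R) - ball 0 R) x * (cmod (smoothed r 1 F x))\<^sup>2 \<le>
        M * C * (indicat_real (cball 0 (2 * R)) x * cmod (smoothed r 2 F x))" for x :: 'a
    proof (cases "x \<in> ball 0 (2 * R) - ball 0 R")
      case True
      then have x: "R \<le> norm x" "norm x \<le> 2 * R" by auto
      have "norm x powr (1 - real DIM('a) / 2 - r) \<le> R powr (1 - real DIM('a) / 2 - r)"
        using x R0 ex by (intro powr_mono2') auto
      then have "L * norm x powr (1 - real DIM('a) / 2 - r) * sqrt (L2sq F) \<le> M"
        unfolding M_def using L(1) by (intro mult_right_mono mult_left_mono) auto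
      then have 1: "cmod (smoothed r 1 F x) \<le> M"
        using L(2)[OF F, of x] x R by simp
      \<comment> \<open>Harnack with coinciding points: it only exchanges variance 1 for variance 2,
        the one in the mass bound.\<close>
      have 2: "cmod (smoothed r 1 F x) \<le> C * cmod (smoothed r 2 F x)"
        unfolding C_def by (rule smoothed_Harnack[OF F]) simp
      have "(cmod (smoothed r 1 F x))\<^sup>2 \<le> M * (C * cmod (smoothed r 2 F x))"
        unfolding power2_eq_square using M by (intro mult_mono 1 2) auto
      then show ?thesis using True x by simp
    qed (use M C in simp)
    have "(LINT x|lborel. indicat_real (ball 0 (2 * R) - ball 0 R) x * (cmod (smoothed r 1 F x))\<^sup>2)
       \<le> (LINT x|lborel. M * C * (indicat_real (cball 0 (2 * R)) x * cmod (smoothed r 2 F x)))"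
      by (rule integral_mono') (use k le M C in auto)
    also have "\<dots> = M * C * (LINT x|lborel. indicat_real (cball 0 (2 * R)) x * cmod (smoothed r 2 F x))" by simp
    also have "\<dots> \<le> M * C * (K * R powr (real DIM('a) / 2 - r) * sqrt (L2sq F))"
      using k M C by (intro mult_left_mono) auto
    also have "\<dots> = (L * C * K) * (R powr (1 - real DIM('a) / 2 - r) * R powr (real DIM('a) / 2 - r)) * (sqrt (L2sq F) * sqrt (L2sq F))"
      unfolding M_def by (simp only: mult_ac)
    also have "R powr (1 - real DIM('a) / 2 - r) * R powr (real DIM('a) / 2 - r) = R powr (1 - 2 * r)"
      by (subst powr_add[symmetric]) simp
    also have "sqrt (L2sq F) * sqrt (L2sq F) = L2sq F" by simp
    finally show ?thesis .
  qed
  moreover have "L * C * K \<ge> 0" using L C K by simp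
  ultimately show ?thesis by blast
qed

lemma smoothed_tail:
  assumes r: "r > 1 / 2"
  shows "\<exists>K\<ge>0. \<exists>q. 0 < q \<and> q < 1 \<and> (\<forall>(F::'a::euclidean_space \<Rightarrow> complex) j. nonneg_radial_spectrum r F \<longrightarrow>
    (LINT x|lborel. indicat_real (- ball 0 (2 ^ j)) x * (cmod (smoothed r 1 F x))\<^sup>2) \<le> K * q ^ j * L2sq F)"
proof -
  have r0: "r > 0" using r by simp
  obtain K where K: "K \<ge> 0" "\<And>(F::'a \<Rightarrow> complex) R. nonneg_radial_spectrum r F \<Longrightarrow> R \<ge> 1 \<Longrightarrow>
    (LINT x|lborel. indicat_real (ball 0 (2 * R) - ball 0 R) x * (cmod (smoothed r 1 F x))\<^sup>2) \<le> K * R powr (1 - 2 * r) * L2sq F"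
    using smoothed_shell[OF r, where 'a='a] by blast
  define q where "q = 2 powr (1 - 2 * r)"
  \<comment> \<open>The ratio is below 1 exactly because \<open>r\<close> exceeds 1/2.\<close>
  have q: "0 < q" "q < 1" using r powr_less_mono[of "1 - 2 * r" 0 2] by (auto simp: q_def)
  have qj: "(2 ^ j) powr (1 - 2 * r) = q ^ j" for j :: nat
    by (simp add: q_def powr_realpow[symmetric] powr_powr mult.commute)
  have "(LINT x|lborel. indicat_real (- ball 0 (2 ^ j)) x * (cmod (smoothed r 1 F x))\<^sup>2) \<le> (K / (1 - q)) * q ^ j * L2sq F"
    if F: "nonneg_radial_spectrum r F" for F :: "'a \<Rightarrow> complex" and j
  proof -
    have LF: "L2fun F" using F by (simp add: nonneg_radial_spectrum_def)
    have [measurable]: "F \<in> borel_measurable borel" using L2fun_measurable[OF LF] by simp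
    let ?U = "\<lambda>x. (cmod (smoothed r 1 F x))\<^sup>2"
    have iU: "integrable lborel ?U" by (rule L2fun_integrable[OF L2fun_smoothed[OF r0 zero_less_one LF]])
    have iS: "integrable lborel (\<lambda>x. indicat_real A x * ?U x)" if [measurable]: "A \<in> sets borel" for A
      by (rule Bochner_Integration.integrable_bound[OF iU]) (auto simp: indicator_def)
    define S where "S m = (LINT x|lborel. indicat_real (ball 0 (2 ^ m) - ball 0 (2 ^ j)) x * ?U x)" for m
    \<comment> \<open>Keeping the exact partial geometric sum, instead of its limit, is what lets
      the induction over dyadic shells close.\<close>
    have S: "S (j + m) \<le> K * L2sq F * (q ^ j - q ^ (j + m)) / (1 - q)" for m
    proof (induction m)
      case (Suc m)
      let ?R = "2 ^ (j + m) :: real"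
      have le: "(2::real) ^ j \<le> ?R" by (intro power_increasing) auto
      have gen: "indicat_real (ball 0 (2 * b) - ball 0 a) x =
          indicat_real (ball 0 b - ball 0 a) x + indicat_real (ball 0 (2 * b) - ball 0 b) x"
        if "a \<le> b" "0 \<le> b" for a b :: real and x :: 'a
        using that by (auto simp: indicator_def)
      have ind: "indicat_real (ball 0 (2 ^ Suc (j + m)) - ball 0 (2 ^ j)) x =
          indicat_real (ball 0 ?R - ball 0 (2 ^ j)) x + indicat_real (ball 0 (2 * ?R) - ball 0 ?R) x" for x :: 'a
        unfolding power_Suc by (rule gen[OF le]) simp
      have "S (j + Suc m) = S (j + m) + (LINT x|lborel. indicat_real (ball 0 (2 * ?R) - ball 0 ?R) x * ?U x)"
        unfolding S_def add_Suc_right ind distrib_right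
        by (rule Bochner_Integration.integral_add) (auto intro!: iS)
      also have "\<dots> \<le> K * L2sq F * (q ^ j - q ^ (j + m)) / (1 - q) + K * q ^ (j + m) * L2sq F"
        using K(2)[OF F, of ?R] Suc by (simp add: qj)
      also have "\<dots> = K * L2sq F * (q ^ j - q ^ (j + Suc m)) / (1 - q)"
        using q by (simp add: field_simps)
      finally show ?case .
    qed (simp add: S_def)
    have S': "S (j + m) \<le> (K / (1 - q)) * q ^ j * L2sq F" for m
    proof -
      have "K * L2sq F * (q ^ j - q ^ (j + m)) / (1 - q) \<le> K * L2sq F * q ^ j / (1 - q)"
        using q K(1) by (intro divide_right_mono mult_left_mono) auto
      then show ?thesis using S[of m] by (simp add: mult_ac)
    qed
    have "(\<lambda>m. S (j + m)) \<longlonglongrightarrow> (LINT x|lborel. indicat_real (- ball 0 (2 ^ j)) x * ?U x)"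
      unfolding S_def
    proof (rule integral_dominated_convergence[OF _ _ iU])
      show "AE x in lborel. (\<lambda>m. indicat_real (ball 0 (2 ^ (j + m)) - ball 0 (2 ^ j)) x * ?U x) \<longlonglongrightarrow> indicat_real (- ball 0 (2 ^ j)) x * ?U x"
      proof (rule AE_I2)
        fix x :: 'a
        obtain n where n: "norm x < 2 ^ n" using real_arch_pow[of 2 "norm x"] by auto
        have "eventually (\<lambda>m. indicat_real (ball 0 (2 ^ (j + m)) - ball 0 (2 ^ j)) x * ?U x = indicat_real (- ball 0 (2 ^ j)) x * ?U x) sequentially"
        proof (rule eventually_sequentiallyI[of n])
          fix m assume "m \<ge> n"
          then have "(2::real) ^ n \<le> 2 ^ (j + m)" by (intro power_increasing) auto
          then have "norm x < 2 ^ (j + m)" using n by linarith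
          then show "indicat_real (ball 0 (2 ^ (j + m)) - ball 0 (2 ^ j)) x * ?U x = indicat_real (- ball 0 (2 ^ j)) x * ?U x"
            by (simp add: indicator_def)
        qed
        then show "(\<lambda>m. indicat_real (ball 0 (2 ^ (j + m)) - ball 0 (2 ^ j)) x * ?U x) \<longlonglongrightarrow> indicat_real (- ball 0 (2 ^ j)) x * ?U x"
          by (rule tendsto_eventually)
      qed
      show "AE x in lborel. norm (indicat_real (ball 0 (2 ^ (j + m)) - ball 0 (2 ^ j)) x * ?U x) \<le> ?U x" for m
        by (intro AE_I2) (auto simp: indicator_def)
    qed measurable
    then show ?thesis by (rule LIMSEQ_le_const2) (use S' in auto)
  qed
  moreover have "K / (1 - q) \<ge> 0" using K q by simp
  ultimately show ?thesis using q by blast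
qed


section \<open>Compactness\<close>

text \<open>The diagonal part of Arzela-Ascoli: a subsequence converging on a countable dense set
  converges everywhere by equicontinuity. Pointwise convergence is enough, as the uniform bound
  permits dominated convergence on balls.\<close>

lemma Lipschitz_convergent_subsequence:
  fixes u :: "nat \<Rightarrow> 'a::euclidean_space \<Rightarrow> complex"
  assumes M: "\<And>n x. cmod (u n x) \<le> M" and L: "\<And>n x y. cmod (u n x - u n y) \<le> norm (x - y) * L"
  obtains \<sigma> :: "nat \<Rightarrow> nat" where "strict_mono \<sigma>" "\<And>x. convergent (\<lambda>n. u (\<sigma> n) x)"
proof -
  obtain D :: "'a set" where D: "countable D" "\<And>X. open X \<Longrightarrow> X \<noteq> {} \<Longrightarrow> \<exists>d\<in>D. d \<in> X"
    using countable_dense_exists by blast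
  obtain \<sigma> :: "nat \<Rightarrow> nat" where \<sigma>: "strict_mono \<sigma>" "\<And>x. x \<in> D \<Longrightarrow> \<exists>l. (\<lambda>n. u (\<sigma> n) x) \<longlonglongrightarrow> l"
    using function_convergent_subsequence[OF D(1), of u M] M by blast
  have "convergent (\<lambda>n. u (\<sigma> n) x)" for x
  proof -
    have "Cauchy (\<lambda>n. u (\<sigma> n) x)"
    proof (rule CauchyI)
      fix e :: real assume e: "0 < e"
      \<comment> \<open>The denominator stays positive although nothing is assumed about the sign of
        \<open>L\<close>.\<close>
      define \<rho> where "\<rho> = e / (4 * (\<bar>L\<bar> + 1))"
      have \<rho>: "\<rho> > 0" using e by (simp add: \<rho>_def add_nonneg_pos)
      obtain d where d: "d \<in> D" "d \<in> ball x \<rho>" using D(2)[of "ball x \<rho>"] \<rho> by auto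
      have near: "cmod (u n x - u n d) \<le> e / 4" for n
      proof -
        have "norm (x - d) * L \<le> norm (x - d) * (\<bar>L\<bar> + 1)" by (intro mult_left_mono) auto
        also have "\<dots> \<le> \<rho> * (\<bar>L\<bar> + 1)"
          using d by (intro mult_right_mono) (auto simp: dist_norm)
        also have "\<rho> * (\<bar>L\<bar> + 1) = e / 4" by (simp add: \<rho>_def field_simps)
        finally show ?thesis using L[of n x d] by linarith
      qed
      have "Cauchy (\<lambda>n. u (\<sigma> n) d)" using \<sigma>(2)[OF d(1)] LIMSEQ_imp_Cauchy by blast
      then obtain N where N: "\<And>m n. m \<ge> N \<Longrightarrow> n \<ge> N \<Longrightarrow> norm (u (\<sigma> m) d - u (\<sigma> n) d) < e / 4"
        using CauchyD[of _ "e / 4"] e by fastforce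
      have "norm (u (\<sigma> m) x - u (\<sigma> n) x) < e" if "m \<ge> N" "n \<ge> N" for m n
      proof -
        have "u (\<sigma> m) x - u (\<sigma> n) x = (u (\<sigma> m) x - u (\<sigma> m) d) + (u (\<sigma> m) d - u (\<sigma> n) d) - (u (\<sigma> n) x - u (\<sigma> n) d)"
          by simp
        also have "norm \<dots> \<le> norm (u (\<sigma> m) x - u (\<sigma> m) d) + norm (u (\<sigma> m) d - u (\<sigma> n) d) + norm (u (\<sigma> n) x - u (\<sigma> n) d)"
          by (intro order.trans[OF norm_triangle_ineq4] add_right_mono norm_triangle_ineq)
        finally show ?thesis using near[of "\<sigma> m"] near[of "\<sigma> n"] N[OF that] e by linarith
      qed
      then show "\<exists>N. \<forall>m\<ge>N. \<forall>n\<ge>N. norm (u (\<sigma> m) x - u (\<sigma> n) x) < e" by blast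
    qed
    then show ?thesis by (simp add: Cauchy_convergent_iff)
  qed
  then show ?thesis using that \<sigma>(1) by blast
qed

text \<open>Inside a large ball the uniform bound allows dominated convergence; outside, tightness
  makes each function small uniformly in the index.\<close>

lemma L2_Cauchy_if_pointwise_tight:
  fixes u :: "nat \<Rightarrow> 'a::euclidean_space \<Rightarrow> complex"
  assumes u: "\<And>n. L2fun (u n)" and M: "\<And>n x. cmod (u n x) \<le> M"
    and conv: "\<And>x. convergent (\<lambda>n. u n x)"
    and tight: "\<And>e. e > 0 \<Longrightarrow> \<exists>R. \<forall>n. (LINT x|lborel. indicat_real (- ball 0 R) x * (cmod (u n x))\<^sup>2) \<le> e"
    and e: "e > 0"
  shows "\<exists>N. \<forall>m\<ge>N. \<forall>n\<ge>N. L2sq (\<lambda>x. u m x - u n x) \<le> e"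
proof -
  note [measurable] = L2fun_measurable[OF u, simplified]
  \<comment> \<open>Four terms, each with weight 2, make up the final estimate: two from inside the
    ball and two from outside.\<close>
  obtain R where R: "\<And>n. (LINT x|lborel. indicat_real (- ball 0 R) x * (cmod (u n x))\<^sup>2) \<le> e / 8"
    using tight[of "e / 8"] e by auto
  define l where "l x = lim (\<lambda>n. u n x)" for x
  have l: "(\<lambda>n. u n x) \<longlonglongrightarrow> l x" for x using conv by (simp add: l_def convergent_LIMSEQ_iff)
  have [measurable]: "l \<in> borel_measurable borel" unfolding l_def[abs_def] by measurable
  have lM: "cmod (l x) \<le> M" for x
    by (rule LIMSEQ_le_const2[OF tendsto_norm[OF l]]) (use M in auto)
  let ?B = "indicat_real (ball (0::'a) R)"
  have iB: "integrable lborel ?B" using emeasure_lborel_ball_finite[of "0::'a" R] by (simp add: integrable_indicator_iff)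
  have b: "?B x * (cmod (v - w))\<^sup>2 \<le> (2 * M)\<^sup>2 * ?B x" if "cmod v \<le> M" "cmod w \<le> M" for v w x
  proof -
    have "(cmod (v - w))\<^sup>2 \<le> (2 * M)\<^sup>2"
      using that norm_triangle_ineq4[of v w] by (intro power_mono) auto
    then show ?thesis by (simp add: indicator_def)
  qed
  have dom: "norm (?B x * (cmod (u n x - l x))\<^sup>2) \<le> (2 * M)\<^sup>2 * ?B x" for n x
    using b[OF M lM] by simp
  have iD: "integrable lborel (\<lambda>x. ?B x * (cmod (u n x - l x))\<^sup>2)" for n
    by (rule Bochner_Integration.integrable_bound[of _ "\<lambda>x. (2 * M)\<^sup>2 * ?B x"]) (use iB dom in auto)
  have "(\<lambda>n. LINT x|lborel. ?B x * (cmod (u n x - l x))\<^sup>2) \<longlonglongrightarrow> (LINT x|(lborel::'a measure). 0)"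
  proof (rule integral_dominated_convergence[of _ _ _ "\<lambda>x. (2 * M)\<^sup>2 * ?B x"])
    show "AE x in lborel. (\<lambda>n. ?B x * (cmod (u n x - l x))\<^sup>2) \<longlonglongrightarrow> 0"
    proof (rule AE_I2)
      fix x
      have "(\<lambda>n. ?B x * (cmod (u n x - l x))\<^sup>2) \<longlonglongrightarrow> ?B x * (cmod (l x - l x))\<^sup>2"
        by (intro tendsto_intros l)
      then show "(\<lambda>n. ?B x * (cmod (u n x - l x))\<^sup>2) \<longlonglongrightarrow> 0" by simp
    qed
  qed (use iB dom in auto)
  then have "(\<lambda>n. LINT x|lborel. ?B x * (cmod (u n x - l x))\<^sup>2) \<longlonglongrightarrow> 0" by simp
  then obtain N where N: "\<And>n. n \<ge> N \<Longrightarrow> norm ((LINT x|lborel. ?B x * (cmod (u n x - l x))\<^sup>2) - 0) < e / 8"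
    using LIMSEQ_D[of _ 0 "e / 8"] e by fastforce
  have "L2sq (\<lambda>x. u m x - u n x) \<le> e" if mn: "m \<ge> N" "n \<ge> N" for m n
  proof -
    let ?T = "indicat_real (- ball (0::'a) R)"
    have iT: "integrable lborel (\<lambda>x. ?T x * (cmod (u k x))\<^sup>2)" for k
      by (rule Bochner_Integration.integrable_bound[OF L2fun_integrable[OF u[of k]]]) (auto simp: indicator_def)
    have "L2sq (\<lambda>x. u m x - u n x) \<le> (LINT x|lborel.
        (2 * (?B x * (cmod (u m x - l x))\<^sup>2) + 2 * (?B x * (cmod (u n x - l x))\<^sup>2)) +
        (2 * (?T x * (cmod (u m x))\<^sup>2) + 2 * (?T x * (cmod (u n x))\<^sup>2)))"
      unfolding L2sq_def
    proof (rule integral_mono)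
      show "integrable lborel (\<lambda>x. (cmod (u m x - u n x))\<^sup>2)" by (intro L2fun_integrable L2fun_diff u)
      show "(cmod (u m x - u n x))\<^sup>2 \<le> (2 * (?B x * (cmod (u m x - l x))\<^sup>2) + 2 * (?B x * (cmod (u n x - l x))\<^sup>2)) +
        (2 * (?T x * (cmod (u m x))\<^sup>2) + 2 * (?T x * (cmod (u n x))\<^sup>2))" for x
        using norm_sq_add_le[of "u m x - l x" "l x - u n x"] norm_sq_add_le[of "u m x" "- u n x"]
        by (cases "x \<in> ball 0 R") (auto simp: norm_minus_commute)
    qed (use iD iT in auto)
    also have "\<dots> = (2 * (LINT x|lborel. ?B x * (cmod (u m x - l x))\<^sup>2) + 2 * (LINT x|lborel. ?B x * (cmod (u n x - l x))\<^sup>2)) +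
        (2 * (LINT x|lborel. ?T x * (cmod (u m x))\<^sup>2) + 2 * (LINT x|lborel. ?T x * (cmod (u n x))\<^sup>2))"
      using iD iT by simp
    also have "\<dots> \<le> e"
      using R[of m] R[of n] N[OF mn(1)] N[OF mn(2)] by simp
    finally show ?thesis .
  qed
  then show ?thesis by blast
qed

lemma smoothed_compact:
  fixes F :: "nat \<Rightarrow> 'a::euclidean_space \<Rightarrow> complex"
  assumes r: "r > 1 / 2" and F: "\<And>n. nonneg_radial_spectrum r (F n)" and B: "\<And>n. L2sq (F n) \<le> B"
  obtains \<sigma> :: "nat \<Rightarrow> nat" where "strict_mono \<sigma>"
    "\<And>e. e > 0 \<Longrightarrow> \<exists>N. \<forall>m\<ge>N. \<forall>n\<ge>N. L2sq (\<lambda>\<xi>. pgauss r 1 \<xi> * F (\<sigma> m) \<xi> - pgauss r 1 \<xi> * F (\<sigma> n) \<xi>) \<le> e"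
proof -
  have r0: "r > 0" using r by simp
  have LF: "L2fun (F n)" for n using F by (simp add: nonneg_radial_spectrum_def)
  have B0: "0 \<le> B" using order.trans[OF L2sq_nonneg B[of 0]] .
  define u where "u n = smoothed r 1 (F n)" for n
  have Lu: "L2fun (u n)" for n unfolding u_def by (rule L2fun_smoothed[OF r0 _ LF]) simp
  define M where "M = sqrt (L2sq (pgauss r 1 :: 'a \<Rightarrow> complex)) * sqrt B"
  define L where "L = sqrt (L2sq (pgauss (1 + r) 1 :: 'a \<Rightarrow> complex)) * sqrt B"
  have uM: "cmod (u n x) \<le> M" for n x
    unfolding u_def M_def
    by (rule order.trans[OF norm_smoothed_le[OF r0 _ LF]]) (auto intro!: mult_left_mono B)
  have uL: "cmod (u n x - u n y) \<le> norm (x - y) * L" for n x y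
    unfolding u_def L_def
    by (rule order.trans[OF smoothed_Lipschitz[OF r0 _ LF]]) (auto intro!: mult_left_mono B)
  obtain \<sigma> where \<sigma>: "strict_mono \<sigma>" "\<And>x. convergent (\<lambda>n. u (\<sigma> n) x)"
    using Lipschitz_convergent_subsequence[of u M L, OF uM uL] by blast
  obtain K q where K: "K \<ge> 0" "0 < q" "q < 1" "\<And>(F::'a \<Rightarrow> complex) j. nonneg_radial_spectrum r F \<Longrightarrow>
    (LINT x|lborel. indicat_real (- ball 0 (2 ^ j)) x * (cmod (smoothed r 1 F x))\<^sup>2) \<le> K * q ^ j * L2sq F"
    using smoothed_tail[OF r, where 'a='a] by blast
  have tight: "\<exists>R. \<forall>n. (LINT x|lborel. indicat_real (- ball 0 R) x * (cmod (u (\<sigma> n) x))\<^sup>2) \<le> e" if e: "e > 0" for e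
  proof -
    have "(\<lambda>j. K * q ^ j * B) \<longlonglongrightarrow> K * 0 * B"
      using K by (intro tendsto_intros LIMSEQ_power_zero) auto
    then have "(\<lambda>j. K * q ^ j * B) \<longlonglongrightarrow> 0" by simp
    then obtain j where "norm (K * q ^ j * B - 0) < e" using LIMSEQ_D[OF _ e] by blast
    then have j: "K * q ^ j * B \<le> e" by simp
    have "(LINT x|lborel. indicat_real (- ball 0 (2 ^ j)) x * (cmod (u (\<sigma> n) x))\<^sup>2) \<le> e" for n
    proof -
      have "K * q ^ j * L2sq (F (\<sigma> n)) \<le> K * q ^ j * B" using K by (intro mult_left_mono B) auto
      then show ?thesis using K(4)[OF F[of "\<sigma> n"], of j] j unfolding u_def by linarith
    qed
    then show ?thesis by blast
  qed
  show ?thesis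
  proof (rule that[OF \<sigma>(1)])
    fix e :: real assume e: "e > 0"
    define c where "c = (2 * pi) ^ DIM('a)"
    have c: "c > 0" by (simp add: c_def)
    obtain N where N: "\<And>m n. m \<ge> N \<Longrightarrow> n \<ge> N \<Longrightarrow> L2sq (\<lambda>x. u (\<sigma> m) x - u (\<sigma> n) x) \<le> c * e"
      using L2_Cauchy_if_pointwise_tight[of "\<lambda>n. u (\<sigma> n)" M "c * e", OF Lu uM \<sigma>(2) tight] e c by fastforce
    have "L2sq (\<lambda>\<xi>. pgauss r 1 \<xi> * F (\<sigma> m) \<xi> - pgauss r 1 \<xi> * F (\<sigma> n) \<xi>) \<le> e" if "m \<ge> N" "n \<ge> N" for m n
    proof -
      have "L2sq (\<lambda>x. u (\<sigma> m) x - u (\<sigma> n) x) = c * L2sq (\<lambda>\<xi>. pgauss r 1 \<xi> * (F (\<sigma> m) \<xi> - F (\<sigma> n) \<xi>))"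
        unfolding u_def c_def smoothed_diff[OF r0 zero_less_one LF LF, symmetric]
        by (rule L2sq_smoothed[OF r0 zero_less_one L2fun_diff[OF LF LF]])
      then have "c * L2sq (\<lambda>\<xi>. pgauss r 1 \<xi> * (F (\<sigma> m) \<xi> - F (\<sigma> n) \<xi>)) \<le> c * e"
        using N[OF that] by simp
      then show ?thesis using c by (simp add: right_diff_distrib)
    qed
    then show "\<exists>N. \<forall>m\<ge>N. \<forall>n\<ge>N. L2sq (\<lambda>\<xi>. pgauss r 1 \<xi> * F (\<sigma> m) \<xi> - pgauss r 1 \<xi> * F (\<sigma> n) \<xi>) \<le> e" by blast
  qed
qed

section \<open>Comparison of frequency weights and weak convergence\<close>

text \<open>For low frequencies |xi|^(2 r) is below \<delta> because r > 0, for high ones it is a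
  small fraction of the Sobolev weight because r < S, and on the remaining annulus the Gaussian
  symbol is bounded below. The thresholds solve a^(2 r) = \<delta> and b^(2 (S - r)) =
  1/\<delta>.\<close>

lemma powr_le_weight_plus_pgauss:
  fixes r r0 S \<delta> :: real
  assumes r: "0 < r" "r < S" and r0: "0 < r0" and \<delta>: "\<delta> > 0"
  shows "\<exists>K\<ge>0. \<forall>\<xi>::'a::euclidean_space. norm \<xi> powr (2 * r) \<le> \<delta> * (1 + (norm \<xi>)\<^sup>2) powr S + K * (cmod (pgauss r0 1 \<xi>))\<^sup>2"
proof -
  define a where "a = \<delta> powr (1 / (2 * r))"
  define b where "b = (1 / \<delta>) powr (1 / (2 * (S - r)))"
  have a: "a > 0" and b: "b > 0" using \<delta> by (auto simp: a_def b_def)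
  \<comment> \<open>A lower bound for the symbol when |xi| lies between \<open>a\<close> and
    \<open>b\<close>: smallest power times smallest exponential.\<close>
  define m where "m = a powr r0 * exp (- (b\<^sup>2 / 2))"
  have m: "m > 0" using a by (simp add: m_def)
  have "norm \<xi> powr (2 * r) \<le> \<delta> * (1 + (norm \<xi>)\<^sup>2) powr S + (b powr (2 * r) / m\<^sup>2) * (cmod (pgauss r0 1 \<xi>))\<^sup>2" for \<xi> :: 'a
  proof -
    define y where "y = norm \<xi>"
    have y: "y \<ge> 0" by (simp add: y_def)
    have nn: "0 \<le> \<delta> * (1 + y\<^sup>2) powr S" "0 \<le> (b powr (2 * r) / m\<^sup>2) * (cmod (pgauss r0 1 \<xi>))\<^sup>2" using \<delta> by auto
    \<comment> \<open>The thresholds need not be ordered; if \<open>b < a\<close>, the first two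
      cases already cover everything.\<close>
    consider "y \<le> a" | "y \<ge> b" "y > 0" | "a \<le> y" "y \<le> b" using a by linarith
    then show ?thesis
    proof cases
      case 1
      have "y powr (2 * r) \<le> a powr (2 * r)" using 1 y r by (intro powr_mono2) auto
      also have "\<dots> = \<delta>" using \<delta> r by (simp add: a_def powr_powr)
      also have "\<delta> \<le> \<delta> * (1 + y\<^sup>2) powr S" using \<delta> r ge_one_powr_ge_zero[of "1 + y\<^sup>2" S] by simp
      finally show ?thesis using nn unfolding y_def by linarith
    next
      case 2
      have "1 / \<delta> = b powr (2 * (S - r))" using \<delta> r by (simp add: b_def powr_powr)
      also have "\<dots> \<le> y powr (2 * (S - r))" using 2 b r by (intro powr_mono2) auto
      finally have "1 \<le> \<delta> * y powr (2 * (S - r))" using \<delta> by (simp add: field_simps)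
      then have "1 * y powr (2 * r) \<le> \<delta> * y powr (2 * (S - r)) * y powr (2 * r)" by (intro mult_right_mono) auto
      also have "\<dots> = \<delta> * y powr (2 * S)" by (simp add: mult.assoc powr_add[symmetric])
      also have "y powr (2 * S) = (y\<^sup>2) powr S" using 2 by (simp add: powr_powr[symmetric])
      also have "\<delta> * (y\<^sup>2) powr S \<le> \<delta> * (1 + y\<^sup>2) powr S" using \<delta> r by (intro mult_left_mono powr_mono2) auto
      finally show ?thesis using nn unfolding y_def by linarith
    next
      case 3
      have "m \<le> y powr r0 * exp (- (y\<^sup>2 / 2))"
        unfolding m_def using 3 a y r0 by (intro mult_mono powr_mono2) (auto intro!: power_mono)
      then have "m\<^sup>2 \<le> (cmod (pgauss r0 1 \<xi>))\<^sup>2"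
        using m unfolding norm_pgauss gauss_def y_def by (intro power_mono) auto
      then have "1 \<le> (cmod (pgauss r0 1 \<xi>))\<^sup>2 / m\<^sup>2" using m by (simp add: field_simps)
      then have "b powr (2 * r) * 1 \<le> b powr (2 * r) * ((cmod (pgauss r0 1 \<xi>))\<^sup>2 / m\<^sup>2)" by (intro mult_left_mono) auto
      moreover have "y powr (2 * r) \<le> b powr (2 * r)" using 3 y r by (intro powr_mono2) auto
      ultimately have "y powr (2 * r) \<le> (b powr (2 * r) / m\<^sup>2) * (cmod (pgauss r0 1 \<xi>))\<^sup>2" by (simp add: field_simps)
      then show ?thesis using nn unfolding y_def by linarith
    qed
  qed
  moreover have "b powr (2 * r) / m\<^sup>2 \<ge> 0" by simp
  ultimately show ?thesis by blast
qed

text \<open>The test function is truncated to the sets \<open>1 \<le> k \<bar>p\<bar>\<close>, on which \<open>h n\<close> tends to \<open>0\<close> strongly.\<close>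

lemma L2_weak_null_if_weighted_null:
  fixes h :: "nat \<Rightarrow> 'a::euclidean_space \<Rightarrow> complex"
  assumes h: "\<And>n. L2fun (h n)" and B: "\<And>n. L2sq (h n) \<le> B"
    and [measurable]: "p \<in> borel_measurable borel" and p0: "AE x in lborel. p x \<noteq> 0"
    and ph: "\<And>n. L2fun (\<lambda>x. p x * h n x)" "(\<lambda>n. L2sq (\<lambda>x. p x * h n x)) \<longlonglongrightarrow> 0"
    and g: "L2fun g"
  shows "(\<lambda>n. LINT x|lborel. h n x * g x) \<longlonglongrightarrow> 0"
proof (rule LIMSEQ_I)
  fix e :: real assume e: "0 < e"
  note [measurable] = L2fun_measurable[OF h, simplified] L2fun_measurable[OF g, simplified]
  define E where "E k x = (if 1 \<le> real k * cmod (p x) then 1 else 0 :: complex)" for k x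
  have [measurable]: "E k \<in> borel_measurable borel" for k unfolding E_def[abs_def] by measurable
  have E1: "cmod (E k x) \<le> 1" for k x by (simp add: E_def)
  have gE: "L2fun (\<lambda>x. E k x * g x)" for k by (rule L2fun_mult_bounded[OF g _ E1]) simp
  have hE: "L2fun (\<lambda>x. E k x * h n x)" for k n by (rule L2fun_mult_bounded[OF h _ E1]) simp
  have gd: "L2fun (\<lambda>x. g x - E k x * g x)" for k by (rule L2fun_diff[OF g gE])
  have "(\<lambda>k. LINT x|lborel. (cmod (g x - E k x * g x))\<^sup>2) \<longlonglongrightarrow> (LINT x|(lborel::'a measure). 0)"
  proof (rule integral_dominated_convergence[OF _ _ L2fun_integrable[OF g]])
    show "AE x in lborel. (\<lambda>k. (cmod (g x - E k x * g x))\<^sup>2) \<longlonglongrightarrow> 0"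
      using p0
    proof eventually_elim
      case (elim x)
      obtain k0 :: nat where k0: "1 / cmod (p x) \<le> real k0" using real_arch_simple by blast
      have "eventually (\<lambda>k. (cmod (g x - E k x * g x))\<^sup>2 = 0) sequentially"
      proof (rule eventually_sequentiallyI[of k0])
        fix k assume "k \<ge> k0"
        then have "1 / cmod (p x) \<le> real k" using k0 by linarith
        then have "1 \<le> real k * cmod (p x)" using elim by (simp add: field_simps)
        then show "(cmod (g x - E k x * g x))\<^sup>2 = 0" by (simp add: E_def)
      qed
      then show ?case by (rule tendsto_eventually)
    qed
    show "AE x in lborel. norm ((cmod (g x - E k x * g x))\<^sup>2) \<le> (cmod (g x))\<^sup>2" for k
      by (intro AE_I2) (auto simp: E_def)
  qed auto
  then have "(\<lambda>k. L2sq (\<lambda>x. g x - E k x * g x)) \<longlonglongrightarrow> 0" by (simp add: L2sq_def)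
  then have "(\<lambda>k. sqrt B * sqrt (L2sq (\<lambda>x. g x - E k x * g x))) \<longlonglongrightarrow> sqrt B * sqrt 0"
    by (intro tendsto_intros)
  then have "(\<lambda>k. sqrt B * sqrt (L2sq (\<lambda>x. g x - E k x * g x))) \<longlonglongrightarrow> 0" by simp
  then obtain k where "norm (sqrt B * sqrt (L2sq (\<lambda>x. g x - E k x * g x)) - 0) < e / 2"
    using LIMSEQ_D[of _ 0 "e / 2"] e by (meson half_gt_zero order.refl)
  then have k: "sqrt B * sqrt (L2sq (\<lambda>x. g x - E k x * g x)) < e / 2" by (simp only: diff_0_right real_norm_def abs_less_iff)
  have "(\<lambda>n. real k * (sqrt (L2sq (\<lambda>x. p x * h n x)) * sqrt (L2sq g))) \<longlonglongrightarrow> real k * (sqrt 0 * sqrt (L2sq g))"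
    by (intro tendsto_intros ph)
  then have "(\<lambda>n. real k * (sqrt (L2sq (\<lambda>x. p x * h n x)) * sqrt (L2sq g))) \<longlonglongrightarrow> 0" by simp
  then obtain N where N: "\<And>n. n \<ge> N \<Longrightarrow> norm (real k * (sqrt (L2sq (\<lambda>x. p x * h n x)) * sqrt (L2sq g)) - 0) < e / 2"
    using LIMSEQ_D[of _ 0 "e / 2"] e by (meson half_gt_zero)
  have "cmod (LINT x|lborel. h n x * g x) < e" if n: "n \<ge> N" for n
  proof -
    have i1: "integrable lborel (\<lambda>x. (E k x * h n x) * g x)" by (rule L2fun_mult_integrable[OF hE g])
    have i2: "integrable lborel (\<lambda>x. h n x * (g x - E k x * g x))" by (rule L2fun_mult_integrable[OF h gd])
    have "(LINT x|lborel. h n x * g x) = (LINT x|lborel. (E k x * h n x) * g x + h n x * (g x - E k x * g x))"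
      by (intro Bochner_Integration.integral_cong) (auto simp: algebra_simps)
    also have "\<dots> = (LINT x|lborel. (E k x * h n x) * g x) + (LINT x|lborel. h n x * (g x - E k x * g x))"
      by (rule Bochner_Integration.integral_add[OF i1 i2])
    finally have split: "cmod (LINT x|lborel. h n x * g x) \<le>
        cmod (LINT x|lborel. (E k x * h n x) * g x) + cmod (LINT x|lborel. h n x * (g x - E k x * g x))"
      by (simp only: norm_triangle_ineq)
    have "cmod (LINT x|lborel. (E k x * h n x) * g x) \<le> (LINT x|lborel. cmod ((E k x * h n x) * g x))"
      by (rule integral_norm_bound)
    also have "\<dots> \<le> (LINT x|lborel. real k * (cmod (p x * h n x) * cmod (g x)))"
    proof (rule integral_mono')
      show "integrable lborel (\<lambda>x. real k * (cmod (p x * h n x) * cmod (g x)))"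
        using integrable_norm[OF L2fun_mult_integrable[OF ph(1)[of n] g]] by (simp add: norm_mult)
      show "cmod ((E k x * h n x) * g x) \<le> real k * (cmod (p x * h n x) * cmod (g x))" for x
      proof (cases "1 \<le> real k * cmod (p x)")
        case True
        then have "1 * (cmod (h n x) * cmod (g x)) \<le> (real k * cmod (p x)) * (cmod (h n x) * cmod (g x))"
          by (intro mult_right_mono) auto
        then show ?thesis using True by (simp add: E_def norm_mult mult_ac)
      qed (simp add: E_def)
    qed simp
    also have "\<dots> = real k * (LINT x|lborel. cmod (p x * h n x) * cmod (g x))" by simp
    also have "\<dots> \<le> real k * (sqrt (L2sq (\<lambda>x. p x * h n x)) * sqrt (L2sq g))"
      by (intro mult_left_mono L2_Cauchy_Schwarz_norm ph g) simp
    also have "\<dots> < e / 2" using N[OF n] by (simp only: diff_0_right real_norm_def abs_less_iff)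
    finally have 1: "cmod (LINT x|lborel. (E k x * h n x) * g x) < e / 2" .
    have "cmod (LINT x|lborel. h n x * (g x - E k x * g x)) \<le> sqrt (L2sq (h n)) * sqrt (L2sq (\<lambda>x. g x - E k x * g x))"
      by (rule L2_Cauchy_Schwarz[OF h gd])
    also have "\<dots> \<le> sqrt B * sqrt (L2sq (\<lambda>x. g x - E k x * g x))"
      by (intro mult_right_mono real_sqrt_le_mono B) simp
    finally show ?thesis using 1 k split by linarith
  qed
  then show "\<exists>N. \<forall>n\<ge>N. norm ((LINT x|lborel. h n x * g x) - 0) < e" by auto
qed


section \<open>Bessel weights and compactness of spectra\<close>

text \<open>The symbol of the S/2-th power of 1 minus the Laplacian; the exponent is halved so that
  the H^S norm is the L^2 norm of the multiplied spectrum.\<close>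

definition bessel :: "real \<Rightarrow> 'a::euclidean_space \<Rightarrow> real" where
  "bessel S \<xi> = (1 + (norm \<xi>)\<^sup>2) powr (S / 2)"

lemma bessel_measurable [measurable]: "bessel S \<in> borel_measurable borel"
  unfolding bessel_def[abs_def] by measurable

lemma bessel_pos [simp]: "0 < bessel S \<xi>"
  unfolding bessel_def by (simp add: add_pos_nonneg add_nonneg_eq_0_iff)

lemma bessel_ge_1: "0 \<le> S \<Longrightarrow> 1 \<le> bessel S \<xi>"
  unfolding bessel_def by (rule ge_one_powr_ge_zero) auto

lemma bessel_sq: "(bessel S \<xi>)\<^sup>2 = (1 + (norm \<xi>)\<^sup>2) powr S"
  unfolding bessel_def power2_eq_square by (simp add: powr_add[symmetric])

abbreviation bessel_mult :: "real \<Rightarrow> ('a::euclidean_space \<Rightarrow> complex) \<Rightarrow> 'a \<Rightarrow> complex" where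
  "bessel_mult S F \<equiv> (\<lambda>\<xi>. complex_of_real (bessel S \<xi>) * F \<xi>)"

lemma norm_bessel_mult_sq: "(cmod (complex_of_real (bessel S \<xi>) * z))\<^sup>2 = (1 + (norm \<xi>)\<^sup>2) powr S * (cmod z)\<^sup>2"
  unfolding norm_mult power_mult_distrib by (simp add: bessel_sq)

lemma L2fun_bessel_iff:
  assumes "F \<in> borel_measurable borel"
  shows "L2fun (bessel_mult S F) \<longleftrightarrow> integrable lborel (\<lambda>\<xi>. (1 + (norm \<xi>)\<^sup>2) powr S * (cmod (F \<xi>))\<^sup>2)"
  using assms unfolding L2fun_def norm_bessel_mult_sq by simp

lemma L2_bessel_dominates:
  assumes S: "0 \<le> S" and F: "L2fun (bessel_mult S F)" and [measurable]: "F \<in> borel_measurable borel"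
  shows "L2fun F" "L2sq F \<le> L2sq (bessel_mult S F)"
proof -
  have le: "(cmod (F \<xi>))\<^sup>2 \<le> (cmod (complex_of_real (bessel S \<xi>) * F \<xi>))\<^sup>2" for \<xi>
  proof (rule power_mono)
    have "1 * cmod (F \<xi>) \<le> bessel S \<xi> * cmod (F \<xi>)" by (intro mult_right_mono bessel_ge_1 S) simp
    then show "cmod (F \<xi>) \<le> cmod (complex_of_real (bessel S \<xi>) * F \<xi>)"
      by (simp add: norm_mult less_imp_le)
  qed simp
  show "L2fun F" by (rule L2fun_dominated[OF _ L2fun_integrable[OF F]]) (use le in auto)
  show "L2sq F \<le> L2sq (bessel_mult S F)"
    unfolding L2sq_def by (rule integral_mono[OF L2fun_integrable[OF \<open>L2fun F\<close>] L2fun_integrable[OF F] le])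
qed

text \<open>The weighted spectra converge in L^2 and, along a further subsequence, almost
  everywhere. The pointwise limit lets Fatou carry the H^S bound over to \<open>G\<close>; the
  weighted convergence is kept because both modes of convergence in the theorem follow from
  it.\<close>

lemma spectrum_compact:
  fixes F :: "nat \<Rightarrow> 'a::euclidean_space \<Rightarrow> complex"
  assumes r: "r > 1 / 2" and S: "0 \<le> S" and F: "\<And>n. nonneg_radial_spectrum r (F n)"
    and b: "\<And>n. L2fun (bessel_mult S (F n))"
    and B: "\<And>n. L2sq (bessel_mult S (F n)) \<le> B"
  obtains \<sigma> :: "nat \<Rightarrow> nat" and G where "strict_mono \<sigma>" "G \<in> borel_measurable borel"
    "AE \<xi> in lborel. (\<lambda>n. F (\<sigma> n) \<xi>) \<longlonglongrightarrow> G \<xi>"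
    "L2fun (bessel_mult S G)" "L2sq (bessel_mult S G) \<le> B"
    "(\<lambda>n. L2sq (\<lambda>\<xi>. pgauss r 1 \<xi> * (F (\<sigma> n) \<xi> - G \<xi>))) \<longlonglongrightarrow> 0"
proof -
  have r0: "r > 0" using r by simp
  have LF: "L2fun (F n)" for n using F by (simp add: nonneg_radial_spectrum_def)
  note [measurable] = L2fun_measurable[OF LF, simplified]
  have BF: "L2sq (F n) \<le> B" for n
    using L2_bessel_dominates(2)[OF S b[of n]] B[of n] by simp
  obtain \<sigma> :: "nat \<Rightarrow> nat" where \<sigma>: "strict_mono \<sigma>"
    "\<And>e. e > 0 \<Longrightarrow> \<exists>N. \<forall>m\<ge>N. \<forall>n\<ge>N. L2sq (\<lambda>\<xi>. pgauss r 1 \<xi> * F (\<sigma> m) \<xi> - pgauss r 1 \<xi> * F (\<sigma> n) \<xi>) \<le> e"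
    using smoothed_compact[of r F B, OF r F BF] by blast
  have LP: "L2fun (\<lambda>\<xi>. pgauss r 1 \<xi> * F (\<sigma> n) \<xi>)" for n by (rule L2fun_pgauss_mult[OF r0 zero_less_one LF])
  obtain H \<tau> where H: "L2fun H" "(\<lambda>k. L2sq (\<lambda>\<xi>. pgauss r 1 \<xi> * F (\<sigma> k) \<xi> - H \<xi>)) \<longlonglongrightarrow> 0"
    "strict_mono (\<tau>::nat\<Rightarrow>nat)" "AE \<xi> in lborel. (\<lambda>k. pgauss r 1 \<xi> * F (\<sigma> (\<tau> k)) \<xi>) \<longlonglongrightarrow> H \<xi>"
    using L2_complete[of "\<lambda>n \<xi>. pgauss r 1 \<xi> * F (\<sigma> n) \<xi>", OF LP \<sigma>(2)] by blast
  have [measurable]: "H \<in> borel_measurable borel" using L2fun_measurable[OF H(1)] by simp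
  \<comment> \<open>The symbol vanishes only at the origin, a null set, so dividing by it loses
    nothing; the value there is immaterial.\<close>
  define G where "G \<xi> = H \<xi> / pgauss r 1 \<xi>" for \<xi>
  have [measurable]: "G \<in> borel_measurable borel" unfolding G_def[abs_def] by measurable
  have p0: "pgauss r 1 \<xi> \<noteq> 0" if "\<xi> \<noteq> 0" for \<xi> :: 'a
    using that gauss_pos[of 1 \<xi>] by (simp add: pgauss_def less_imp_neq[symmetric])
  have n0: "AE \<xi> in (lborel::'a measure). \<xi> \<noteq> 0"
    by (rule AE_lborel_singleton)
  have HG: "AE \<xi> in lborel. H \<xi> = pgauss r 1 \<xi> * G \<xi>"
    using n0 by eventually_elim (simp add: G_def p0)
  have lim: "AE \<xi> in lborel. (\<lambda>k. F (\<sigma> (\<tau> k)) \<xi>) \<longlonglongrightarrow> G \<xi>"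
    using H(4) n0
  proof eventually_elim
    case (elim \<xi>)
    have "(\<lambda>k. pgauss r 1 \<xi> * F (\<sigma> (\<tau> k)) \<xi> / pgauss r 1 \<xi>) \<longlonglongrightarrow> G \<xi>"
      unfolding G_def by (rule tendsto_divide[OF elim(1) tendsto_const p0[OF elim(2)]])
    then show ?case using p0[OF elim(2)] by simp
  qed
  have limb: "AE \<xi> in lborel. (\<lambda>k. complex_of_real (bessel S \<xi>) * F (\<sigma> (\<tau> k)) \<xi>) \<longlonglongrightarrow> complex_of_real (bessel S \<xi>) * G \<xi>"
    using lim by eventually_elim (intro tendsto_intros)
  show ?thesis
  proof (rule that[of "\<sigma> \<circ> \<tau>" G])
    show "strict_mono (\<sigma> \<circ> \<tau>)" using \<sigma>(1) H(3) by (rule strict_mono_o)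
    show "AE \<xi> in lborel. (\<lambda>n. F ((\<sigma> \<circ> \<tau>) n) \<xi>) \<longlonglongrightarrow> G \<xi>" using lim by simp
    show "L2fun (bessel_mult S G)"
      by (rule L2_Fatou(1)[of "\<lambda>k \<xi>. complex_of_real (bessel S \<xi>) * F (\<sigma> (\<tau> k)) \<xi>" _ B]) (use b B limb in auto)
    show "L2sq (bessel_mult S G) \<le> B"
      by (rule L2_Fatou(2)[of "\<lambda>k \<xi>. complex_of_real (bessel S \<xi>) * F (\<sigma> (\<tau> k)) \<xi>"]) (use b B limb in auto)
    have "L2sq (\<lambda>\<xi>. pgauss r 1 \<xi> * (F (\<sigma> (\<tau> n)) \<xi> - G \<xi>)) = L2sq (\<lambda>\<xi>. pgauss r 1 \<xi> * F (\<sigma> (\<tau> n)) \<xi> - H \<xi>)" for n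
      unfolding L2sq_def
    proof (rule integral_cong_AE)
      show "AE \<xi> in lborel. (cmod (pgauss r 1 \<xi> * (F (\<sigma> (\<tau> n)) \<xi> - G \<xi>)))\<^sup>2 = (cmod (pgauss r 1 \<xi> * F (\<sigma> (\<tau> n)) \<xi> - H \<xi>))\<^sup>2"
        using HG by eventually_elim (simp add: right_diff_distrib)
    qed measurable
    then show "(\<lambda>n. L2sq (\<lambda>\<xi>. pgauss r 1 \<xi> * (F ((\<sigma> \<circ> \<tau>) n) \<xi> - G \<xi>))) \<longlonglongrightarrow> 0"
      using LIMSEQ_subseq_LIMSEQ[OF H(2) H(3)] by (simp add: o_def)
  qed fact
qed

section \<open>Transfer to Sobolev functions\<close>

text \<open>\<open>sobolev\<close> provides weighted integrability for some representative of the
  spectrum, whereas \<open>FT\<close> may choose another; uniqueness almost everywhere carries it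
  over.\<close>

lemma
  assumes "sobolev S \<phi>"
  shows sobolev_is_fourier_FT: "is_fourier_L2 (\<lambda>x. complex_of_real (\<phi> x)) (FT (\<lambda>x. complex_of_real (\<phi> x)))"
    and L2fun_bessel_FT: "L2fun (\<lambda>\<xi>. complex_of_real (bessel S \<xi>) * FT (\<lambda>x. complex_of_real (\<phi> x)) \<xi>)"
proof -
  let ?\<phi> = "\<lambda>x. complex_of_real (\<phi> x)"
  obtain F where F: "is_fourier_L2 ?\<phi> F" "integrable lborel (\<lambda>\<xi>. (1 + (norm \<xi>)\<^sup>2) powr S * (cmod (F \<xi>))\<^sup>2)"
    using assms by (auto simp: sobolev_def)
  show ft: "is_fourier_L2 ?\<phi> (FT ?\<phi>)" unfolding FT_def by (rule someI[of _ F]) (rule F(1))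
  have m: "F \<in> borel_measurable borel" "FT ?\<phi> \<in> borel_measurable borel"
    using F(1) ft by (auto simp: is_fourier_L2_def L2fun_def)
  have "L2fun (bessel_mult S F)" using F(2) by (simp add: L2fun_bessel_iff[OF m(1)])
  then show "L2fun (\<lambda>\<xi>. complex_of_real (bessel S \<xi>) * FT ?\<phi> \<xi>)"
  proof (rule L2fun_AE_eq)
    show "(\<lambda>\<xi>. complex_of_real (bessel S \<xi>) * FT ?\<phi> \<xi>) \<in> borel_measurable lborel"
      using m(2) by simp
    show "AE \<xi> in lborel. complex_of_real (bessel S \<xi>) * F \<xi> = complex_of_real (bessel S \<xi>) * FT ?\<phi> \<xi>"
      using is_fourier_L2_unique[OF F(1) ft] by eventually_elim (simp only:)
  qed
qed

text \<open>A radial function equals its composition with any orthogonal map, so the rotated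
  spectrum is another spectrum of the same function and agrees with \<open>FT\<close> almost
  everywhere.\<close>

lemma H_rad_plus_spectrum:
  fixes \<phi> :: "'a::euclidean_space \<Rightarrow> real"
  assumes "\<phi> \<in> H_rad_plus S r0"
  shows "nonneg_radial_spectrum r0 (FT (\<lambda>x. complex_of_real (\<phi> x)))"
proof -
  let ?\<phi> = "\<lambda>x. complex_of_real (\<phi> x)"
  have \<phi>: "sobolev S \<phi>" "radial \<phi>" "Dpow_nonneg r0 \<phi>" using assms by (auto simp: H_rad_plus_def)
  note ft = sobolev_is_fourier_FT[OF \<phi>(1)]
  have m: "?\<phi> \<in> borel_measurable borel" using \<phi>(1) by (simp add: sobolev_def L2fun_def)
  have "AE \<xi> in lborel. FT ?\<phi> (T \<xi>) = FT ?\<phi> \<xi>" if T: "orthogonal_transformation T" for T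
  proof -
    have "norm (T x) = norm x" for x using T by (simp add: orthogonal_transformation)
    then have "\<phi> (T x) = \<phi> x" for x using \<phi>(2)[unfolded radial_def] by blast
    then have "is_fourier_L2 ?\<phi> (\<lambda>\<xi>. FT ?\<phi> (T \<xi>))" using is_fourier_L2_orthogonal[OF T ft m] by simp
    then show ?thesis by (rule is_fourier_L2_unique[OF _ ft])
  qed
  then show ?thesis
    using ft \<phi>(3) by (auto simp: nonneg_radial_spectrum_def is_fourier_L2_def Dpow_nonneg_def)
qed

lemma sobolev_norm_eq: "sobolev_norm S \<phi> = sqrt (L2sq (\<lambda>\<xi>. complex_of_real (bessel S \<xi>) * FT (\<lambda>x. complex_of_real (\<phi> x)) \<xi>))"
  unfolding sobolev_norm_def L2sq_def norm_bessel_mult_sq ..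

lemma sobolev_inner_eq:
  "sobolev_inner S \<phi> \<psi> = (LINT \<xi>|lborel. (complex_of_real (bessel S \<xi>) * FT (\<lambda>x. complex_of_real (\<phi> x)) \<xi>) *
     cnj (complex_of_real (bessel S \<xi>) * FT (\<lambda>x. complex_of_real (\<psi> x)) \<xi>))"
  unfolding sobolev_inner_def bessel_sq[symmetric] by (simp add: power2_eq_square mult_ac)

text \<open>Frees the seminorm from the choice made by \<open>FT\<close>: the spectrum of a
  difference may be taken as the difference of spectra.\<close>

lemma hom_sobolev_norm_cong:
  assumes "is_fourier_L2 (\<lambda>x. complex_of_real (\<phi> x)) F"
  shows "hom_sobolev_norm r \<phi> = sqrt (LINT \<xi>|lborel. (norm \<xi>) powr (2 * r) * (cmod (F \<xi>))\<^sup>2)"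
proof -
  let ?F = "FT (\<lambda>x. complex_of_real (\<phi> x))"
  have ft: "is_fourier_L2 (\<lambda>x. complex_of_real (\<phi> x)) ?F" unfolding FT_def by (rule someI[of _ F]) (rule assms)
  have [measurable]: "F \<in> borel_measurable borel" "?F \<in> borel_measurable borel"
    using assms ft by (auto simp: is_fourier_L2_def L2fun_def)
  have "(LINT \<xi>|lborel. (norm \<xi>) powr (2 * r) * (cmod (?F \<xi>))\<^sup>2) = (LINT \<xi>|lborel. (norm \<xi>) powr (2 * r) * (cmod (F \<xi>))\<^sup>2)"
    by (rule integral_cong_AE) (use is_fourier_L2_unique[OF ft assms] in auto)
  then show ?thesis by (simp add: hom_sobolev_norm_def)
qed

text \<open>Splitting the weight costs \<delta> times the uniformly bounded H^S energy, plus a fixed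
  multiple of a quantity that tends to 0.\<close>

lemma weighted_L2_tendsto_0:
  fixes D :: "nat \<Rightarrow> 'a::euclidean_space \<Rightarrow> complex"
  assumes r: "0 < r" "r < S" and r0: "0 < r0"
    and D: "\<And>n. L2fun (bessel_mult S (D n))" "\<And>n. D n \<in> borel_measurable borel"
    and B: "\<And>n. L2sq (bessel_mult S (D n)) \<le> B"
    and lim: "(\<lambda>n. L2sq (\<lambda>\<xi>. pgauss r0 1 \<xi> * D n \<xi>)) \<longlonglongrightarrow> 0"
  shows "(\<lambda>n. LINT \<xi>|lborel. norm \<xi> powr (2 * r) * (cmod (D n \<xi>))\<^sup>2) \<longlonglongrightarrow> 0"
proof (rule LIMSEQ_I)
  fix e :: real assume e: "0 < e"
  have S: "0 \<le> S" using r by simp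
  have B0: "0 \<le> B" using order.trans[OF L2sq_nonneg B[of 0]] .
  \<comment> \<open>\<open>B + 1\<close> instead of \<open>B\<close> keeps the quotient meaningful
    when the bound is 0.\<close>
  define \<delta> where "\<delta> = e / (2 * (B + 1))"
  have \<delta>: "\<delta> > 0" using e B0 by (simp add: \<delta>_def)
  have \<delta>B: "\<delta> * B < e / 2"
  proof -
    have "\<delta> * B < \<delta> * (B + 1)" using \<delta> by simp
    also have "\<dots> = e / 2" using B0 by (simp add: \<delta>_def field_simps)
    finally show ?thesis .
  qed
  obtain K where K: "K \<ge> 0" "\<And>\<xi>::'a. norm \<xi> powr (2 * r) \<le> \<delta> * (1 + (norm \<xi>)\<^sup>2) powr S + K * (cmod (pgauss r0 1 \<xi>))\<^sup>2"
    using powr_le_weight_plus_pgauss[OF r r0 \<delta>, where 'a='a] by blast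
  have "(\<lambda>n. K * L2sq (\<lambda>\<xi>. pgauss r0 1 \<xi> * D n \<xi>)) \<longlonglongrightarrow> 0"
    using lim by (rule tendsto_mult_right_zero)
  then obtain N where N: "\<And>n. n \<ge> N \<Longrightarrow> norm (K * L2sq (\<lambda>\<xi>. pgauss r0 1 \<xi> * D n \<xi>) - 0) < e / 2"
    using LIMSEQ_D[of _ 0 "e / 2"] e by (meson half_gt_zero)
  have "norm ((LINT \<xi>|lborel. norm \<xi> powr (2 * r) * (cmod (D n \<xi>))\<^sup>2) - 0) < e" if n: "n \<ge> N" for n
  proof -
    have LD: "L2fun (D n)" by (rule L2_bessel_dominates(1)[OF S D(1) D(2)])
    let ?b = "\<lambda>\<xi>. (cmod (complex_of_real (bessel S \<xi>) * D n \<xi>))\<^sup>2"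
    let ?p = "\<lambda>\<xi>. (cmod (pgauss r0 1 \<xi> * D n \<xi>))\<^sup>2"
    have ib: "integrable lborel ?b" by (rule L2fun_integrable[OF D(1)])
    have ip: "integrable lborel ?p" by (rule L2fun_integrable[OF L2fun_pgauss_mult[OF r0 zero_less_one LD]])
    have "(LINT \<xi>|lborel. norm \<xi> powr (2 * r) * (cmod (D n \<xi>))\<^sup>2) \<le> (LINT \<xi>|lborel. \<delta> * ?b \<xi> + K * ?p \<xi>)"
    proof (rule integral_mono')
      show "integrable lborel (\<lambda>\<xi>. \<delta> * ?b \<xi> + K * ?p \<xi>)" using ib ip by simp
      fix \<xi> :: 'a
      have "norm \<xi> powr (2 * r) * (cmod (D n \<xi>))\<^sup>2 \<le> (\<delta> * (1 + (norm \<xi>)\<^sup>2) powr S + K * (cmod (pgauss r0 1 \<xi>))\<^sup>2) * (cmod (D n \<xi>))\<^sup>2"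
        by (intro mult_right_mono K) simp
      also have "\<dots> = \<delta> * ?b \<xi> + K * ?p \<xi>"
        unfolding norm_bessel_mult_sq by (simp add: norm_mult power_mult_distrib algebra_simps)
      finally show "norm \<xi> powr (2 * r) * (cmod (D n \<xi>))\<^sup>2 \<le> \<delta> * ?b \<xi> + K * ?p \<xi>" .
      show "0 \<le> \<delta> * ?b \<xi> + K * ?p \<xi>" using \<delta> K(1) by simp
    qed
    also have "\<dots> = \<delta> * L2sq (bessel_mult S (D n)) + K * L2sq (\<lambda>\<xi>. pgauss r0 1 \<xi> * D n \<xi>)"
      unfolding L2sq_def using ib ip by simp
    also have "\<dots> \<le> \<delta> * B + K * L2sq (\<lambda>\<xi>. pgauss r0 1 \<xi> * D n \<xi>)"
      using \<delta> by (intro add_right_mono mult_left_mono B) simp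
    also have "\<dots> < e" using \<delta>B N[OF n] by simp
    finally show ?thesis by (simp add: integral_nonneg_AE)
  qed
  then show "\<exists>N. \<forall>n\<ge>N. norm ((LINT \<xi>|lborel. norm \<xi> powr (2 * r) * (cmod (D n \<xi>))\<^sup>2) - 0) < e" by blast
qed

theorem theorem1p2:
  fixes S r0 r :: real and \<phi> :: "nat \<Rightarrow> 'a::euclidean_space \<Rightarrow> real"
  assumes "DIM('a) \<ge> 2"
    and "1/2 < r0" and "r0 < real DIM('a) / 2" and "r0 < S - 1/2"
    and "0 < r" and "r < S"
    and "\<And>n. \<phi> n \<in> H_rad_plus S r0"
    and "\<exists>C. \<forall>n. sobolev_norm S (\<phi> n) \<le> C"
  shows "\<exists>\<sigma> \<phi>lim. strict_mono \<sigma> \<and> sobolev S \<phi>lim \<and>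
           (\<forall>\<psi>. sobolev S \<psi> \<longrightarrow>
              (\<lambda>n. sobolev_inner S (\<phi> (\<sigma> n)) \<psi>) \<longlonglongrightarrow> sobolev_inner S \<phi>lim \<psi>) \<and>
           (\<lambda>n. hom_sobolev_norm r (\<lambda>x. \<phi> (\<sigma> n) x - \<phi>lim x)) \<longlonglongrightarrow> 0"
proof -
  define F where "F n = FT (\<lambda>x. complex_of_real (\<phi> n x))" for n
  obtain C where C: "\<And>n. sobolev_norm S (\<phi> n) \<le> C" using assms(8) by blast
  have S: "0 \<le> S" and r0: "0 < r0" using assms by linarith+
  have sob: "sobolev S (\<phi> n)" for n using assms(7) by (simp add: H_rad_plus_def)
  note ft = sobolev_is_fourier_FT[OF sob, folded F_def]
  have L\<phi>: "L2fun (\<lambda>x. complex_of_real (\<phi> n x))" for n using sob by (simp add: sobolev_def)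
  have b: "L2fun (bessel_mult S (F n))" for n
    unfolding F_def by (rule L2fun_bessel_FT[OF sob])
  have B: "L2sq (bessel_mult S (F n)) \<le> C\<^sup>2" for n
    using C[of n] unfolding sobolev_norm_eq F_def by (rule sqrt_le_D)
  have rad: "nonneg_radial_spectrum r0 (F n)" for n
    unfolding F_def by (rule H_rad_plus_spectrum[OF assms(7)])
  obtain \<sigma> :: "nat \<Rightarrow> nat" and G where \<sigma>: "strict_mono \<sigma>" and [measurable]: "G \<in> borel_measurable borel"
    and lim: "AE \<xi> in lborel. (\<lambda>n. F (\<sigma> n) \<xi>) \<longlonglongrightarrow> G \<xi>"
    and bG: "L2fun (bessel_mult S G)" "L2sq (bessel_mult S G) \<le> C\<^sup>2"
    and pG: "(\<lambda>n. L2sq (\<lambda>\<xi>. pgauss r0 1 \<xi> * (F (\<sigma> n) \<xi> - G \<xi>))) \<longlonglongrightarrow> 0"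
    using spectrum_compact[of r0 S F "C\<^sup>2", OF assms(2) S rad b B] .
  have LF: "L2fun (F n)" for n using rad by (simp add: nonneg_radial_spectrum_def)
  note [measurable] = L2fun_measurable[OF LF, simplified]
  have LG: "L2fun G" by (rule L2_bessel_dominates(1)[OF S bG(1)]) measurable
  \<comment> \<open>Hermitian symmetry, valid for each real \<open>\<phi> n\<close>, passes to the
    pointwise limit; reflection preserves null sets, so the convergence holds at
    \<open>- \<xi>\<close> as well.\<close>
  have sym: "AE \<xi> in lborel. cnj (G (- \<xi>)) = G \<xi>"
  proof -
    have "AE \<xi> in lborel. cnj (F n (- \<xi>)) = F n \<xi>" for n
      using is_fourier_L2_cnj[OF ft[of n]] by (intro is_fourier_L2_unique[OF _ ft[of n]]) simp
    then have "AE \<xi> in lborel. \<forall>n. cnj (F n (- \<xi>)) = F n \<xi>" unfolding AE_all_countable by blast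
    moreover have "AE \<xi> in lborel. (\<lambda>n. F (\<sigma> n) (- \<xi>)) \<longlonglongrightarrow> G (- \<xi>)"
      by (rule AE_lborel_preserving[OF lborel_distr_uminus_euclidean _ lim]) simp
    ultimately show ?thesis using lim
    proof eventually_elim
      case (elim \<xi>)
      have "(\<lambda>n. cnj (F (\<sigma> n) (- \<xi>))) \<longlonglongrightarrow> cnj (G (- \<xi>))" by (intro tendsto_cnj elim)
      then have "(\<lambda>n. F (\<sigma> n) \<xi>) \<longlonglongrightarrow> cnj (G (- \<xi>))" using elim(1) by simp
      then show ?case using elim(3) by (rule LIMSEQ_unique)
    qed
  qed
  obtain \<phi>lim :: "'a \<Rightarrow> real" where \<phi>lim: "L2fun (\<lambda>x. complex_of_real (\<phi>lim x))" "is_fourier_L2 (\<lambda>x. complex_of_real (\<phi>lim x)) G"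
    using is_fourier_L2_exists_real[OF LG sym] .
  have sob_lim: "sobolev S \<phi>lim"
    unfolding sobolev_def using \<phi>lim bG(1) by (auto simp: L2fun_bessel_iff)
  define H where "H = FT (\<lambda>x. complex_of_real (\<phi>lim x))"
  note ftH = sobolev_is_fourier_FT[OF sob_lim, folded H_def]
  have HG: "AE \<xi> in lborel. H \<xi> = G \<xi>" by (rule is_fourier_L2_unique[OF ftH \<phi>lim(2)])
  have [measurable]: "H \<in> borel_measurable borel" using ftH by (simp add: is_fourier_L2_def L2fun_def)
  define D where "D n \<xi> = F (\<sigma> n) \<xi> - G \<xi>" for n \<xi>
  have [measurable]: "D n \<in> borel_measurable borel" for n unfolding D_def[abs_def] by measurable
  have bD_eq: "bessel_mult S (D n) =
      (\<lambda>\<xi>. complex_of_real (bessel S \<xi>) * F (\<sigma> n) \<xi> - complex_of_real (bessel S \<xi>) * G \<xi>)" for n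
    by (simp add: D_def right_diff_distrib)
  have bD: "L2fun (bessel_mult S (D n))" for n
    unfolding bD_eq by (rule L2fun_diff[OF b bG(1)])
  \<comment> \<open>Each of the two spectra contributes \<open>2 * C\<^sup>2\<close> through the
    inequality for the square of a sum.\<close>
  have BD: "L2sq (bessel_mult S (D n)) \<le> 4 * C\<^sup>2" for n
    using L2sq_add_le[OF b[of "\<sigma> n"] L2fun_cmult[OF bG(1), of "-1"]] B[of "\<sigma> n"] bG(2)
    unfolding bD_eq by (simp add: L2sq_def)
  have pD: "(\<lambda>n. L2sq (\<lambda>\<xi>. pgauss r0 1 \<xi> * D n \<xi>)) \<longlonglongrightarrow> 0" using pG by (simp add: D_def)
  have "(\<lambda>n. sobolev_inner S (\<phi> (\<sigma> n)) \<psi>) \<longlonglongrightarrow> sobolev_inner S \<phi>lim \<psi>" if \<psi>: "sobolev S \<psi>" for \<psi>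
  proof -
    define g where "g \<xi> = cnj (complex_of_real (bessel S \<xi>) * FT (\<lambda>x. complex_of_real (\<psi> x)) \<xi>)" for \<xi>
    have g: "L2fun g" unfolding g_def[abs_def] by (rule L2fun_cnj[OF L2fun_bessel_FT[OF \<psi>]])
    note [measurable] = L2fun_measurable[OF g, simplified]
    \<comment> \<open>Weak convergence concerns the sequence multiplied by \<open>bessel S\<close>,
      which is bounded in L^2. Dividing the Gaussian symbol by the same factor makes the weighted
      product \<open>pgauss r0 1 \<xi> * D n \<xi>\<close>, already known to tend to 0.\<close>
    let ?p = "\<lambda>\<xi>. pgauss r0 1 \<xi> / complex_of_real (bessel S \<xi>)"
    have pb: "?p \<xi> * (complex_of_real (bessel S \<xi>) * D n \<xi>) = pgauss r0 1 \<xi> * D n \<xi>" for n \<xi>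
      using bessel_pos[of S \<xi>] by (simp add: less_imp_neq[symmetric])
    have "(\<lambda>n. LINT \<xi>|lborel. (complex_of_real (bessel S \<xi>) * D n \<xi>) * g \<xi>) \<longlonglongrightarrow> 0"
    proof (rule L2_weak_null_if_weighted_null[OF bD BD, of ?p])
      have "AE \<xi> in (lborel::'a measure). \<xi> \<noteq> 0" by (rule AE_lborel_singleton)
      then show "AE \<xi> in lborel. ?p (\<xi>::'a) \<noteq> 0"
      proof eventually_elim
        case (elim \<xi>)
        then show ?case using gauss_pos[of 1 \<xi>] bessel_pos[of S \<xi>] by (simp add: pgauss_def less_imp_neq[symmetric])
      qed
      show "L2fun (\<lambda>\<xi>. ?p \<xi> * (complex_of_real (bessel S \<xi>) * D n \<xi>))" for n
        unfolding pb unfolding D_def by (rule L2fun_pgauss_mult[OF r0 zero_less_one L2fun_diff[OF LF LG]])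
      show "(\<lambda>n. L2sq (\<lambda>\<xi>. ?p \<xi> * (complex_of_real (bessel S \<xi>) * D n \<xi>))) \<longlonglongrightarrow> 0"
        unfolding pb by (rule pD)
    qed (measurable, rule g)
    moreover have "(LINT \<xi>|lborel. (complex_of_real (bessel S \<xi>) * D n \<xi>) * g \<xi>) = sobolev_inner S (\<phi> (\<sigma> n)) \<psi> - sobolev_inner S \<phi>lim \<psi>" for n
    proof -
      have "sobolev_inner S \<phi>lim \<psi> = (LINT \<xi>|lborel. (complex_of_real (bessel S \<xi>) * G \<xi>) * g \<xi>)"
        unfolding sobolev_inner_eq H_def[symmetric] g_def[symmetric]
        by (rule integral_cong_AE) (use HG in auto)
      moreover have "sobolev_inner S (\<phi> (\<sigma> n)) \<psi> = (LINT \<xi>|lborel. (complex_of_real (bessel S \<xi>) * F (\<sigma> n) \<xi>) * g \<xi>)"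
        unfolding sobolev_inner_eq F_def g_def ..
      ultimately show ?thesis
        using L2fun_mult_integrable[OF b[of "\<sigma> n"] g] L2fun_mult_integrable[OF bG(1) g]
        by (simp add: D_def right_diff_distrib left_diff_distrib)
    qed
    ultimately show ?thesis by (simp add: LIM_zero_iff)
  qed
  moreover have "(\<lambda>n. hom_sobolev_norm r (\<lambda>x. \<phi> (\<sigma> n) x - \<phi>lim x)) \<longlonglongrightarrow> 0"
  proof -
    have "hom_sobolev_norm r (\<lambda>x. \<phi> (\<sigma> n) x - \<phi>lim x) = sqrt (LINT \<xi>|lborel. norm \<xi> powr (2 * r) * (cmod (D n \<xi>))\<^sup>2)" for n
      using is_fourier_L2_diff[OF ft \<phi>lim(2) L\<phi> \<phi>lim(1), of "\<sigma> n"]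
      by (intro hom_sobolev_norm_cong) (simp add: D_def)
    then show ?thesis
      using tendsto_real_sqrt[OF weighted_L2_tendsto_0[OF assms(5,6) r0 bD _ BD pD]] by simp
  qed
  ultimately show ?thesis using \<sigma> sob_lim by blast
qed

end
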